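(* Let $d=2$, let $W$ be a matrix $A_2$ weight, let the coefficients $A=(A^{\alpha\beta}_{ij})$ satisfy (E1) and (E2), and let $\vec u\in H^{1,2}(\Omega,W)$ be a weak solution of the system (S) with $F=0$. Suppose $B_{6R}\subseteq\Omega$ is an open ball of radius $6R$ and $B=B_R$ the concentric ball of radius $R$. Then there exists $\epsilon\approx[W]_{A_2}^{-8}$ such that (for the representative $\vec u(x)=\lim_{\rho\to0}\frac{1}{|B(x,\rho)|}\int_{B(x,\rho)}\vec u$) for all $x,y\in B$, $$|\vec u(x)-\vec u(y)|\lesssim C_{x,y}\left(\frac{|x-y|}{R}\right)^\epsilon,\qquad C_{x,y}=\left(\sup_{B'}\frac{1}{|B'|^{1-\epsilon}}\int_{B'}\|W^{-1/2}(\xi)\|^2d\xi\right)^{1/2},$$ where the supremum is over balls $B'\subset\Omega$ centered at $x$ or at $y$ with radius $\le 2|x-y|$, and the implicit constant does not depend on $x,y$.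
   Context: A matrix weight is $W:\mathbb{R}^d\to\mathcal{M}_{n\times n}(\mathbb{C})$ with locally integrable, a.e. positive definite values; $[W]_{A_2}=\sup_Q\frac1{|Q|}\int_Q\frac1{|Q|}\int_Q\|W^{1/2}(x)W^{-1/2}(y)\|^2dy\,dx<\infty$. Coefficients $A^{\alpha\beta}_{ij}:\Omega\to\mathbb{C}$ are measurable and satisfy for a.e. $x$ and all $\eta,\nu\in\mathcal{M}_{n\times d}(\mathbb{C})$: (E1) $\mathrm{Re}\sum A^{\alpha\beta}_{ij}(x)\eta^j_\beta\overline{\eta^i_\alpha}\gtrsim\|W^{1/2}(x)\eta\|^2$; (E2) $|\sum A^{\alpha\beta}_{ij}(x)\nu^j_\beta\overline{\eta^i_\alpha}|\lesssim\|W^{1/2}(x)\eta\|\|W^{1/2}(x)\nu\|$. System (S) with $F=0$: $\sum_j\sum_{\alpha,\beta}\partial_\alpha(A^{\alpha\beta}_{ij}\partial_\beta u_j)=0$, $i=1,\dots,n$; weak solution means $\int_\Omega\sum A^{\alpha\beta}_{ij}\partial_\beta u_j\overline{\partial_\alpha\varphi_i}=0$ for all $\vec\varphi\in C_c^\infty(\Omega;\mathbb{C}^n)$. $H^{1,2}(\Omega,W)$ is the completion of smooth functions in the norm $(\int_\Omega|W^{1/2}\vec u|^2)^{1/2}+(\int_\Omega\|W^{1/2}D\vec u\|^2)^{1/2}$. *)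

theory Defs
  imports "HOL-Analysis.Analysis"
begin

definition hermitian :: "complex^'n^'n \<Rightarrow> bool" where
  "hermitian M \<longleftrightarrow> (\<forall>i j. M$i$j = cnj (M$j$i))"

definition hquad :: "complex^'n^'n \<Rightarrow> complex^'n \<Rightarrow> complex" where
  "hquad M v = (\<Sum>i\<in>UNIV. cnj (v$i) * (M *v v)$i)"

definition pos_semidef :: "complex^'n^'n \<Rightarrow> bool" where
  "pos_semidef M \<longleftrightarrow> hermitian M \<and> (\<forall>v. 0 \<le> Re (hquad M v))"

definition pos_def :: "complex^'n^'n \<Rightarrow> bool" where
  "pos_def M \<longleftrightarrow> hermitian M \<and> (\<forall>v. v \<noteq> 0 \<longrightarrow> 0 < Re (hquad M v))"

definition msqrt :: "complex^'n^'n \<Rightarrow> complex^'n^'n" where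
  "msqrt M = (THE S. pos_semidef S \<and> S ** S = M)"

definition mnorm :: "complex^'n^'m \<Rightarrow> real" where
  "mnorm M = onorm (\<lambda>v. M *v v)"

definition frob :: "complex^'d^'n \<Rightarrow> real" where
  "frob M = sqrt (\<Sum>i\<in>UNIV. \<Sum>j\<in>UNIV. (cmod (M$i$j))\<^sup>2)"

definition is_cube :: "(real^2) set \<Rightarrow> bool" where
  "is_cube Q \<longleftrightarrow> (\<exists>a h. 0 < h \<and> Q = cbox a (a + h *\<^sub>R One))"

definition A2_char :: "(real^2 \<Rightarrow> complex^'n^'n) \<Rightarrow> ennreal" where
  "A2_char W = (SUP Q \<in> {Q. is_cube Q}.
      ennreal (1 / (measure lebesgue Q)\<^sup>2) *
      (\<integral>\<^sup>+x\<in>Q. (\<integral>\<^sup>+y\<in>Q. ennreal ((mnorm (msqrt (W x) ** msqrt (matrix_inv (W y))))\<^sup>2) \<partial>lebesgue) \<partial>lebesgue))"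

definition matrix_A2_weight :: "(real^2 \<Rightarrow> complex^'n^'n) \<Rightarrow> bool" where
  "matrix_A2_weight W \<longleftrightarrow>
     (\<forall>K. compact K \<longrightarrow> (\<forall>i j. integrable (lebesgue_on K) (\<lambda>x. W x $ i $ j))) \<and>
     (AE x in lebesgue. pos_def (W x)) \<and>
     A2_char W < (top::ennreal)"

text \<open>[W]_{A_2} as a real number (meaningful when it is finite).\<close>
definition A2_const :: "(real^2 \<Rightarrow> complex^'n^'n) \<Rightarrow> real" where
  "A2_const W = enn2real (A2_char W)"

fun Ck :: "nat \<Rightarrow> 'a::real_normed_vector set \<Rightarrow> ('a \<Rightarrow> 'b::real_normed_vector) \<Rightarrow> bool" where
  "Ck 0 S f = continuous_on S f"
| "Ck (Suc k) S f = (\<exists>f'. (\<forall>x\<in>S. (f has_derivative f' x) (at x)) \<and> (\<forall>v. Ck k S (\<lambda>x. f' x v)))"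

definition smooth_on :: "'a::real_normed_vector set \<Rightarrow> ('a \<Rightarrow> 'b::real_normed_vector) \<Rightarrow> bool" where
  "smooth_on S f \<longleftrightarrow> (\<forall>k. Ck k S f)"

definition Dmat :: "(real^2 \<Rightarrow> complex^'n) \<Rightarrow> real^2 \<Rightarrow> complex^2^'n" where
  "Dmat f x = (\<chi> i \<beta>. (frechet_derivative f (at x) (axis \<beta> 1)) $ i)"

definition tsupp :: "('a::topological_space \<Rightarrow> 'b::zero) \<Rightarrow> 'a set" where
  "tsupp f = closure {x. f x \<noteq> 0}"

definition wL2 :: "(real^2 \<Rightarrow> complex^'n^'n) \<Rightarrow> (real^2) set \<Rightarrow> (real^2 \<Rightarrow> complex^'n) \<Rightarrow> ennreal" where
  "wL2 W \<Omega> f = (\<integral>\<^sup>+x\<in>\<Omega>. ennreal ((norm (msqrt (W x) *v f x))\<^sup>2) \<partial>lebesgue)"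

definition wL2grad :: "(real^2 \<Rightarrow> complex^'n^'n) \<Rightarrow> (real^2) set \<Rightarrow> (real^2 \<Rightarrow> complex^2^'n) \<Rightarrow> ennreal" where
  "wL2grad W \<Omega> G = (\<integral>\<^sup>+x\<in>\<Omega>. ennreal ((frob (msqrt (W x) ** G x))\<^sup>2) \<partial>lebesgue)"

text \<open>(u, Du) is an element of the completion of the smooth functions of finite norm:
  it is the limit of a sequence of such smooth functions, Du being the limit of their gradients.\<close>
definition in_H12 :: "(real^2) set \<Rightarrow> (real^2 \<Rightarrow> complex^'n^'n) \<Rightarrow> (real^2 \<Rightarrow> complex^'n)
    \<Rightarrow> (real^2 \<Rightarrow> complex^2^'n) \<Rightarrow> bool" where
  "in_H12 \<Omega> W u Du \<longleftrightarrow>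
     u \<in> borel_measurable (lebesgue_on \<Omega>) \<and> Du \<in> borel_measurable (lebesgue_on \<Omega>) \<and>
     (\<exists>\<phi>. (\<forall>k. smooth_on \<Omega> (\<phi> k) \<and> wL2 W \<Omega> (\<phi> k) < (top::ennreal) \<and> wL2grad W \<Omega> (Dmat (\<phi> k)) < (top::ennreal)) \<and>
          (\<lambda>k. wL2 W \<Omega> (\<lambda>x. u x - \<phi> k x)) \<longlonglongrightarrow> 0 \<and>
          (\<lambda>k. wL2grad W \<Omega> (\<lambda>x. Du x - Dmat (\<phi> k) x)) \<longlonglongrightarrow> 0)"

text \<open>A x i j alpha beta = A^{alpha beta}_{ij}(x);
  form A x nu eta = sum A^{alpha beta}_{ij}(x) nu^j_beta conj(eta^i_alpha).\<close>
definition form :: "(real^2 \<Rightarrow> 'n \<Rightarrow> 'n \<Rightarrow> 2 \<Rightarrow> 2 \<Rightarrow> complex) \<Rightarrow> real^2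
    \<Rightarrow> complex^2^'n \<Rightarrow> complex^2^'n \<Rightarrow> complex" where
  "form A x \<nu> \<eta> = (\<Sum>i\<in>UNIV. \<Sum>j\<in>UNIV. \<Sum>\<alpha>\<in>UNIV. \<Sum>\<beta>\<in>UNIV.
       A x i j \<alpha> \<beta> * \<nu>$j$\<beta> * cnj (\<eta>$i$\<alpha>))"

definition elliptic :: "real \<Rightarrow> real \<Rightarrow> (real^2 \<Rightarrow> complex^'n^'n) \<Rightarrow> (real^2) set
    \<Rightarrow> (real^2 \<Rightarrow> 'n \<Rightarrow> 'n \<Rightarrow> 2 \<Rightarrow> 2 \<Rightarrow> complex) \<Rightarrow> bool" where
  "elliptic lam Lam W \<Omega> A \<longleftrightarrow>
     (\<forall>i j \<alpha> \<beta>. (\<lambda>x. A x i j \<alpha> \<beta>) \<in> borel_measurable (lebesgue_on \<Omega>)) \<and>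
     (AE x in lebesgue. x \<in> \<Omega> \<longrightarrow>
        (\<forall>\<eta>. lam * (frob (msqrt (W x) ** \<eta>))\<^sup>2 \<le> Re (form A x \<eta> \<eta>)) \<and>
        (\<forall>\<eta> \<nu>. cmod (form A x \<nu> \<eta>) \<le> Lam * frob (msqrt (W x) ** \<eta>) * frob (msqrt (W x) ** \<nu>)))"

definition weak_solution :: "(real^2) set \<Rightarrow> (real^2 \<Rightarrow> 'n \<Rightarrow> 'n \<Rightarrow> 2 \<Rightarrow> 2 \<Rightarrow> complex)
    \<Rightarrow> (real^2 \<Rightarrow> complex^2^'n) \<Rightarrow> bool" where
  "weak_solution \<Omega> A Du \<longleftrightarrow>
     (\<forall>\<phi> :: real^2 \<Rightarrow> complex^'n. smooth_on UNIV \<phi> \<and> compact (tsupp \<phi>) \<and> tsupp \<phi> \<subseteq> \<Omega> \<longrightarrow>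
        (\<integral>x. form A x (Du x) (Dmat \<phi> x) \<partial>lebesgue_on \<Omega>) = 0)"

definition rep :: "(real^2 \<Rightarrow> complex^'n) \<Rightarrow> real^2 \<Rightarrow> complex^'n" where
  "rep u x = Lim (at_right 0)
     (\<lambda>\<rho>. (1 / measure lebesgue (ball x \<rho>)) *\<^sub>R (\<integral>z. u z \<partial>lebesgue_on (ball x \<rho>)))"

definition esqrt :: "ennreal \<Rightarrow> ennreal" where
  "esqrt z = (if z = (top::ennreal) then (top::ennreal) else ennreal (sqrt (enn2real z)))"

definition Cxy :: "(real^2 \<Rightarrow> complex^'n^'n) \<Rightarrow> (real^2) set \<Rightarrow> real \<Rightarrow> real^2 \<Rightarrow> real^2 \<Rightarrow> ennreal" where
  "Cxy W \<Omega> \<epsilon> x y = esqrt (SUP B' \<in> {ball c r | c r. (c = x \<or> c = y) \<and> 0 < r \<and> r \<le> 2 * dist x y \<and> ball c r \<subseteq> \<Omega>}.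
      ennreal (1 / (measure lebesgue B') powr (1 - \<epsilon>)) *
      (\<integral>\<^sup>+\<xi>\<in>B'. ennreal ((mnorm (msqrt (matrix_inv (W \<xi>))))\<^sup>2) \<partial>lebesgue))"

end

theory Submission
  imports Defs
begin

text \<open>
  For a smooth \<open>v\<close> on a cube \<open>Q\<close>, the difference of \<open>v(x)\<close> and its mean is an average over
  \<open>t \<in> (0, 1]\<close> of the means of \<open>Dv\<close> over the cubes \<open>x + t (Q - x)\<close>. At a fixed scale
  Cauchy--Schwarz bounds the kernel \<open>\<parallel>W\<^sup>1\<^sup>/\<^sup>2(x) W\<^sup>-\<^sup>1\<^sup>/\<^sup>2(z)\<parallel>\<close> in mean square by
  \<open>[W]\<close>, so the weighted Poincare inequality holds with a constant linear in \<open>[W]\<close>.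
  Testing the system with \<open>\<eta> (u - c)\<close> and filling the hole, the energy on concentric cubes
  decays like \<open>r\<^sup>\<kappa>\<close> with \<open>\<kappa>\<close> of order \<open>1 / [W]\<close>. Since \<open>[W] \<ge> 1\<close>, a small multiple
  \<open>\<epsilon>\<close> of \<open>[W]\<^sup>-\<^sup>8\<close> satisfies \<open>4\<epsilon> \<le> \<kappa>\<close>. In two dimensions the means of \<open>u\<close> over
  balls of radius \<open>r\<close> and \<open>r/2\<close> differ by at most a multiple of \<open>1/r\<close> times the integral of
  \<open>\<bar>Du\<bar>\<close>, which by Cauchy--Schwarz is at most a multiple of \<open>C\<^sub>x\<^sub>y r\<^sup>\<epsilon>\<close>; summing over
  dyadic radii gives the claim.
\<close>

section \<open>Square roots of positive definite matrices\<close>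

text \<open>Two obstacles shape the proof. Hence the estimates are proved for the approximants
  \<open>\<phi> k\<close>, with the weighted energy of \<open>Du - Dmat (\<phi> k)\<close> as error,
  and then passed to the limit. Moreover \<open>msqrt\<close> is a description, which carries no
  measurability of its own: lengths of vectors under the root are rewritten as quadratic forms in
  the entries of the weight, and operator norms as countable suprema of quotients of such forms.
  Fubini calls for Borel functions on the product, so the weight is replaced by a Borel version that
  is positive definite at every point; the weighted quantities do not change. Cubes carry the energy
  because the characteristic is defined by cubes and because a product of one-dimensional steps is a
  smooth cutoff for them; balls remain in the means and in \<open>Cxy\<close>. The Poincare
  inequality has the same cube on both sides, which keeps the hole-filling step between two
  radii.\<close>

lemma inner_complex_vec: "inner (v::complex^'n) w = Re (\<Sum>i\<in>UNIV. cnj (v$i) * w$i)"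
  by (simp add: inner_vec_def inner_complex_def)

lemma Re_hquad: "Re (hquad M v) = inner v (M *v v)"
  by (simp add: hquad_def inner_complex_vec)

lemma hermitian_selfadjoint:
  assumes "hermitian M"
  shows "inner (M *v v) w = inner v (M *v w)"
proof -
  have "(\<Sum>i\<in>UNIV. cnj ((M *v v)$i) * w$i) = (\<Sum>i\<in>UNIV. \<Sum>j\<in>UNIV. cnj (M$i$j) * cnj (v$j) * w$i)"
    by (simp add: matrix_vector_mult_def sum_distrib_right)
  also have "\<dots> = (\<Sum>j\<in>UNIV. \<Sum>i\<in>UNIV. cnj (M$i$j) * cnj (v$j) * w$i)"
    by (rule sum.swap)
  also have "\<dots> = (\<Sum>j\<in>UNIV. \<Sum>i\<in>UNIV. cnj (v$j) * (M$j$i * w$i))"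
  proof (intro sum.cong refl)
    fix i j
    have "M$j$i = cnj (M$i$j)" using assms unfolding hermitian_def by blast
    then show "cnj (M$i$j) * cnj (v$j) * w$i = cnj (v$j) * (M$j$i * w$i)" by (simp add: mult_ac)
  qed
  also have "\<dots> = (\<Sum>j\<in>UNIV. cnj (v$j) * (M *v w)$j)"
    by (simp add: matrix_vector_mult_def sum_distrib_left)
  finally show ?thesis by (simp add: inner_complex_vec)
qed

lemma mult_axis_eq_column: "(M::complex^'n^'m) *v axis j 1 = (\<chi> i. M$i$j)"
  by (simp add: vec_eq_iff matrix_vector_mult_def axis_def if_distrib sum.delta cong: if_cong)

lemma inner_axis_one: "inner (axis i 1) (v::complex^'n) = Re (v$i)"
  by (simp add: inner_axis' inner_complex_def)

lemma inner_axis_ii: "inner (axis i \<i>) (v::complex^'n) = Im (v$i)"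
  by (simp add: inner_axis' inner_complex_def)

text \<open>Symmetry for the real inner product is enough because the matrix commutes with
  multiplication by \<i>: real unit vectors give the real parts of the entries, and
  \<open>axis i \<i>\<close> against \<open>axis j 1\<close> gives the imaginary parts.\<close>

lemma selfadjoint_hermitian:
  assumes "\<And>v w. inner ((M::complex^'n^'n) *v v) w = inner v (M *v w)"
  shows "hermitian M"
  unfolding hermitian_def
proof (intro allI)
  fix i j
  have ax: "axis j \<i> = \<i> *s (axis j 1 :: complex^'n)" for j
    by (simp add: vec_eq_iff axis_def)
  have Mi: "M *v axis j \<i> = \<i> *s (M *v axis j 1)" for j
    by (simp add: ax vector_scalar_commute)
  have "Re (M$i$j) = Re (M$j$i)"
    using assms[of "axis i 1" "axis j 1"] inner_axis_one[of i "M *v axis j 1"]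
      inner_axis_one[of j "M *v axis i 1"]
    by (simp add: inner_commute[of _ "axis j 1"] mult_axis_eq_column)
  moreover have "Im (M$i$j) = - Im (M$j$i)"
    using assms[of "axis i \<i>" "axis j 1"] inner_axis_ii[of i "M *v axis j 1"]
      inner_axis_one[of j "M *v axis i \<i>"]
    by (simp add: inner_commute[of _ "axis j 1"] Mi mult_axis_eq_column)
  ultimately show "M$i$j = cnj (M$j$i)" by (simp add: complex_eq_iff)
qed

lemma pos_def_inner:
  "pos_def M \<longleftrightarrow> hermitian M \<and> (\<forall>v. v \<noteq> 0 \<longrightarrow> 0 < inner v (M *v v))"
  by (simp add: pos_def_def Re_hquad)

lemma pos_semidef_inner:
  "pos_semidef M \<longleftrightarrow> hermitian M \<and> (\<forall>v. 0 \<le> inner v (M *v v))"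
  by (simp add: pos_semidef_def Re_hquad)

lemma pos_def_imp_pos_semidef: "pos_def M \<Longrightarrow> pos_semidef M"
  unfolding pos_def_inner pos_semidef_inner
  by (metis inner_zero_left less_eq_real_def)

lemma bounded_linear_mult_vec: "bounded_linear (\<lambda>v. (M::complex^'n^'m) *v v)"
  by (simp add: linear_conv_bounded_linear[symmetric])

text \<open>The quadratic form attains a positive minimum on the compact unit sphere, and scaling
  carries it to all vectors. In the fixed point argument below, \<open>m\<close> measures how far
  the operator norm stays below 1.\<close>

lemma pos_def_lower_bound:
  assumes "pos_def (M::complex^'n^'n)"
  obtains m where "0 < m" "\<And>v. m * (norm v)\<^sup>2 \<le> inner v (M *v v)"
proof -
  let ?S = "sphere (0::complex^'n) 1"
  have "continuous_on ?S (\<lambda>v. inner v (M *v v))"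
    by (intro continuous_intros linear_continuous_on bounded_linear_mult_vec)
  moreover have "?S \<noteq> {}" by simp
  ultimately obtain w where w: "w \<in> ?S" "\<And>v. v \<in> ?S \<Longrightarrow> inner w (M *v w) \<le> inner v (M *v v)"
    using continuous_attains_inf[of ?S "\<lambda>v. inner v (M *v v)"] by auto
  define m where "m = inner w (M *v w)"
  have "w \<noteq> 0" using w(1) by auto
  then have "0 < m" using assms by (simp add: m_def pos_def_inner)
  moreover have "m * (norm v)\<^sup>2 \<le> inner v (M *v v)" for v
  proof (cases "v = 0")
    case False
    let ?u = "v /\<^sub>R norm v"
    have lin: "M *v ?u = (M *v v) /\<^sub>R norm v"
      using linear_scale[OF matrix_vector_mul_linear[of M]] by simp
    have "?u \<in> ?S" using False by simp
    then have "m \<le> inner ?u (M *v ?u)" unfolding m_def by (rule w(2))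
    also have "\<dots> = inner v (M *v v) / (norm v)\<^sup>2"
      unfolding lin by (simp add: power2_eq_square divide_inverse)
    finally show ?thesis using False by (simp add: pos_le_divide_eq)
  qed simp
  ultimately show ?thesis using that by blast
qed

text \<open>With \<open>c = L\<^sup>2 / m\<close> the operator \<open>B = 1 - M / c\<close> is a strict contraction, so
  \<open>Y \<mapsto> (B + Y\<^sup>2) / 2\<close> is one as well on a ball of operators; its fixed point
  satisfies \<open>(1 - Y)\<^sup>2 = 1 - B = M / c\<close>.\<close>

lemma pos_def_sqrt_exists:
  assumes M: "pos_def (M::complex^'n^'n)"
  obtains S where "pos_def S" "S ** S = M"
proof -
  obtain m where m: "0 < m" "\<And>v. m * (norm v)\<^sup>2 \<le> inner v (M *v v)"
    using pos_def_lower_bound[OF M] by blast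
  obtain L0 where L0: "0 < L0" "\<And>v. norm (M *v v) \<le> norm v * L0"
    using bounded_linear.pos_bounded[OF bounded_linear_mult_vec[of M]] by blast
  \<comment> \<open>The second argument keeps \<open>m / L\<close> at most 1/2, so that
    \<open>q\<close> below is strictly between 0 and 1.\<close>
  define L where "L = max L0 (2 * m)"
  have L: "0 < L" "2 * m \<le> L" "norm (M *v v) \<le> L * norm v" for v
  proof -
    show "0 < L" "2 * m \<le> L" using m(1) by (auto simp: L_def)
    have "norm v * L0 \<le> norm v * L" by (intro mult_left_mono) (auto simp: L_def)
    then show "norm (M *v v) \<le> L * norm v" using L0(2)[of v] by (simp add: mult.commute)
  qed
  define c where "c = L\<^sup>2 / m"
  have c: "0 < c" using L m by (simp add: c_def)
  \<comment> \<open>Expanding the square of \<open>norm (v - M v / c)\<close> gives at most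
    \<open>1 - 2 * m / c + L^2 / c^2\<close> times the square of \<open>norm v\<close>. The choice
    \<open>c = L^2 / m\<close> minimises this factor, with value
    \<open>1 - m^2 / L^2\<close>.\<close>
  define q where "q = sqrt (1 - m\<^sup>2 / L\<^sup>2)"
  have mL: "0 < m\<^sup>2 / L\<^sup>2" "m\<^sup>2 / L\<^sup>2 < 1"
    using m(1) L by (auto simp: divide_simps intro!: power_strict_mono)
  have q: "0 \<le> q" "q < 1" "q\<^sup>2 = 1 - m\<^sup>2 / L\<^sup>2" using mL by (auto simp: q_def)
  define B where "B = Blinfun (\<lambda>v. v - (1/c) *\<^sub>R (M *v v))"
  have B: "blinfun_apply B v = v - (1/c) *\<^sub>R (M *v v)" for v
    unfolding B_def
    by (subst bounded_linear_Blinfun_apply)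
      (auto intro!: bounded_linear_sub bounded_linear_ident bounded_linear_const_scaleR bounded_linear_mult_vec)
  have "norm (B v) \<le> q * norm v" for v
  proof (rule power2_le_imp_le)
    have "(norm (B v))\<^sup>2 = (norm v)\<^sup>2 - 2/c * inner v (M *v v) + (norm (M *v v))\<^sup>2 / c\<^sup>2"
      unfolding power2_norm_eq_inner B
      by (simp add: inner_diff_left inner_diff_right inner_commute[of "M *v v" v] power2_eq_square[of c])
        (use c in \<open>simp add: field_simps\<close>)
    also have "\<dots> \<le> (norm v)\<^sup>2 - 2/c * (m * (norm v)\<^sup>2) + (L * norm v)\<^sup>2 / c\<^sup>2"
      using c m(2)[of v] power_mono[OF L(3)[of v], of 2]
      by (intro add_mono diff_mono mult_left_mono divide_right_mono) auto
    also have "\<dots> = (q * norm v)\<^sup>2"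
      using m(1) L(1) by (simp add: q(3) power_mult_distrib c_def divide_simps)
        (simp add: algebra_simps eval_nat_numeral)
    finally show "(norm (B v))\<^sup>2 \<le> (q * norm v)\<^sup>2" .
  qed (use q in simp)
  then have nB: "norm B \<le> q" using q(1) by (intro norm_blinfun_bound) auto
  \<comment> \<open>All three conditions are closed and survive \<open>F\<close>, so the fixed point
    inherits them. The norm bound makes \<open>1 - Y\<close> positive, self-adjointness makes it
    hermitian, and commuting with \<i> turns a real-linear operator into a complex matrix.\<close>
  define X where "X = {Y :: (complex^'n) \<Rightarrow>\<^sub>L (complex^'n). norm Y \<le> q \<and>
     (\<forall>v w. inner (blinfun_apply Y v) w = inner v (blinfun_apply Y w)) \<and>
     (\<forall>v. blinfun_apply Y (\<i> *s v) = \<i> *s blinfun_apply Y v)}"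
  have blis: "bounded_linear (\<lambda>v::complex^'n. \<i> *s v)"
  proof -
    have "linear (\<lambda>v::complex^'n. \<i> *s v)"
      by (rule linearI) (auto simp: vec_eq_iff algebra_simps)
    then show ?thesis by (simp add: linear_conv_bounded_linear)
  qed
  have "closed X"
    unfolding X_def
    by (intro closed_Collect_conj closed_Collect_all closed_Collect_le closed_Collect_eq continuous_intros
        bounded_linear.continuous_on[OF blis])
  then have "complete X" by (simp add: complete_eq_closed)
  define F where "F Y = (1/2) *\<^sub>R (B + (Y o\<^sub>L Y))" for Y :: "(complex^'n) \<Rightarrow>\<^sub>L (complex^'n)"
  have F_app: "blinfun_apply (F Y) v = (1/2) *\<^sub>R (B v + blinfun_apply Y (blinfun_apply Y v))" for Y v
    by (simp add: F_def blinfun.bilinear_simps)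
  have Bsym: "inner (B v) w = inner v (B w)" for v w
    using hermitian_selfadjoint[of M] M by (simp add: B pos_def_inner inner_diff_left inner_diff_right)
  have Bi: "B (\<i> *s v) = \<i> *s B v" for v
    by (simp add: B vector_scalar_commute vec_eq_iff algebra_simps)
  have "0 \<in> X" using q(1) unfolding X_def by (simp add: vec_eq_iff)
  then have "X \<noteq> {}" by blast
  moreover have "F ` X \<subseteq> X"
  proof (clarify)
    fix Y assume Y: "Y \<in> X"
    then have Yn: "norm Y \<le> q" and Ys: "\<And>v w. inner (blinfun_apply Y v) w = inner v (blinfun_apply Y w)"
      and Yi: "\<And>v. blinfun_apply Y (\<i> *s v) = \<i> *s blinfun_apply Y v" by (auto simp: X_def)
    have "norm (Y o\<^sub>L Y) \<le> q * q"
      using norm_blinfun_compose[of Y Y] mult_mono[OF Yn Yn q(1)] by simp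
    also have "\<dots> \<le> q * 1" using q by (intro mult_left_mono) auto
    finally have "norm (F Y) \<le> q"
      using nB norm_triangle_ineq[of B "Y o\<^sub>L Y"] by (simp add: F_def)
    moreover have "inner (F Y v) w = inner v (F Y w)" for v w
      by (simp add: F_app Bsym Ys inner_add_left inner_add_right)
    moreover have "F Y (\<i> *s v) = \<i> *s F Y v" for v
      by (simp add: F_app Bi Yi vec_eq_iff algebra_simps)
    ultimately show "F Y \<in> X" by (auto simp: X_def)
  qed
  moreover have "dist (F Y) (F Z) \<le> q * dist Y Z" if "Y \<in> X" "Z \<in> X" for Y Z
  proof -
    \<comment> \<open>This splitting of the difference of two squares does not require
      \<open>Y\<close> and \<open>Z\<close> to commute.\<close>
    have "F Y - F Z = (1/2) *\<^sub>R ((Y o\<^sub>L (Y - Z)) + ((Y - Z) o\<^sub>L Z))"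
      by (rule blinfun_eqI) (simp add: F_def blinfun.bilinear_simps algebra_simps)
    then have "norm (F Y - F Z) \<le> (1/2) * (norm Y * norm (Y - Z) + norm (Y - Z) * norm Z)"
      using norm_triangle_ineq[of "Y o\<^sub>L (Y - Z)" "(Y - Z) o\<^sub>L Z"]
        norm_blinfun_compose[of Y "Y - Z"] norm_blinfun_compose[of "Y - Z" Z] by simp
    also have "\<dots> \<le> (1/2) * (q * norm (Y - Z) + norm (Y - Z) * q)"
      using that unfolding X_def by (intro mult_left_mono add_mono mult_right_mono) auto
    finally show ?thesis by (simp add: dist_norm mult.commute)
  qed
  ultimately have "\<exists>!Y\<in>X. F Y = Y"
    using Banach_fix[of X q F] \<open>complete X\<close> q by auto
  then obtain Y where Y: "Y \<in> X" "F Y = Y" by blast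
  from Y(1) have Yn: "norm Y \<le> q" and Ys: "\<And>v w. inner (blinfun_apply Y v) w = inner v (blinfun_apply Y w)"
      and Yi: "\<And>v. blinfun_apply Y (\<i> *s v) = \<i> *s blinfun_apply Y v" by (auto simp: X_def)
  define f where "f v = sqrt c *\<^sub>R (v - Y v)" for v
  have Ycs: "Y (a *s v) = a *s Y v" for a v
  proof -
    have dec: "a *s w = Re a *\<^sub>R w + Im a *\<^sub>R (\<i> *s w)" for w :: "complex^'n"
      by (simp add: vec_eq_iff complex_eq_iff)
    show ?thesis by (simp only: dec[of v] dec[of "Y v"] blinfun.bilinear_simps Yi)
  qed
  have flin: "Vector_Spaces.linear (*s) (*s) f"
    by unfold_locales
      (auto simp: f_def Ycs blinfun.bilinear_simps vec_eq_iff algebra_simps)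
  define S where "S = matrix f"
  have S: "S *v v = f v" for v unfolding S_def by (rule matrix_works[OF flin])
  have "S ** S = M"
  proof (rule matrix_eq[THEN iffD2], intro allI)
    fix v
    have "Y (Y v) = 2 *\<^sub>R Y v - B v"
      using arg_cong[OF Y(2), of "\<lambda>Z. 2 *\<^sub>R blinfun_apply Z v"] by (simp add: F_app eq_diff_eq add.commute)
    moreover have "S ** S *v v = c *\<^sub>R (v - 2 *\<^sub>R Y v + Y (Y v))"
      using c by (simp add: matrix_vector_mul_assoc[symmetric] S f_def blinfun.bilinear_simps
          algebra_simps scaleR_2)
    ultimately have "S ** S *v v = c *\<^sub>R (v - B v)" by simp
    also have "\<dots> = M *v v" using c by (simp add: B)
    finally show "S ** S *v v = M *v v" .
  qed
  moreover have "pos_def S"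
    unfolding pos_def_inner
  proof (intro conjI allI impI)
    show "hermitian S"
      by (rule selfadjoint_hermitian) (simp add: S f_def Ys inner_diff_left inner_diff_right)
    fix v :: "complex^'n" assume v: "v \<noteq> 0"
    have "inner v (Y v) \<le> norm v * norm (Y v)" by (rule norm_cauchy_schwarz)
    also have "\<dots> \<le> norm v * (q * norm v)"
      using order_trans[OF norm_blinfun[of Y v] mult_right_mono[OF Yn]]
      by (intro mult_left_mono) auto
    also have "\<dots> < norm v * (1 * norm v)" using q v by (intro mult_strict_left_mono mult_strict_right_mono) auto
    finally have "inner v (Y v) < inner v v" by (simp add: power2_norm_eq_inner[symmetric] power2_eq_square)
    then show "0 < inner v (S *v v)" using c by (simp add: S f_def inner_diff_right)
  qed
  ultimately show ?thesis using that by blast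
qed

text \<open>With \<open>D\<close> hermitian, each diagonal entry of \<open>D ** S ** D\<close> is
  the quadratic form of \<open>S\<close> at a column of \<open>D\<close>, so positivity of
  \<open>S\<close> becomes positivity of a trace.\<close>

lemma trace_hermitian_conj:
  assumes "hermitian D"
  shows "trace (D ** S ** D) = (\<Sum>j\<in>UNIV. hquad S (\<chi> i. D$i$j))"
proof -
  have "trace (D ** S ** D) = (\<Sum>j\<in>UNIV. \<Sum>k\<in>UNIV. D$j$k * (S ** D)$k$j)"
    unfolding trace_def matrix_mul_assoc[symmetric] by (simp add: matrix_matrix_mult_def[of D])
  also have "\<dots> = (\<Sum>j\<in>UNIV. hquad S (\<chi> i. D$i$j))"
  proof (intro sum.cong refl)
    fix j
    have "D$j$k = cnj (D$k$j)" for k using assms unfolding hermitian_def by blast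
    then show "(\<Sum>k\<in>UNIV. D$j$k * (S ** D)$k$j) = hquad S (\<chi> i. D$i$j)"
      by (simp add: hquad_def matrix_matrix_mult_def matrix_vector_mult_def)
  qed
  finally show ?thesis .
qed

text \<open>\<open>S\<close> is only semidefinite because \<open>msqrt\<close> quantifies over
  semidefinite roots; definiteness of \<open>T\<close> forces the columns of \<open>S - T\<close> to
  vanish. The trace argument takes the place of a diagonalisation.\<close>

lemma pos_def_sqrt_unique:
  assumes S: "pos_semidef S" and T: "pos_def T" and eq: "S ** S = T ** T"
  shows "S = (T::complex^'n^'n)"
proof -
  define D where "D = S - T"
  have hD: "hermitian D"
    unfolding hermitian_def
  proof (intro allI)
    fix i j
    have "S$i$j = cnj (S$j$i)" "T$i$j = cnj (T$j$i)"
      using S T unfolding pos_semidef_def pos_def_def hermitian_def by blast+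
    then show "D$i$j = cnj (D$j$i)" by (simp add: D_def)
  qed
  \<comment> \<open>\<open>S D + D T = 0\<close>; multiplying by \<open>D\<close> and taking traces leaves a sum of two nonnegative terms.\<close>
  have "S ** D + D ** T = 0"
  proof (rule matrix_eq[THEN iffD2], intro allI)
    fix v
    have "S *v (S *v v) = T *v (T *v v)" by (simp add: matrix_vector_mul_assoc eq)
    then show "(S ** D + D ** T) *v v = 0 *v v"
      by (simp add: D_def matrix_vector_mul_assoc[symmetric] algebra_simps)
  qed
  then have "D ** (S ** D) + D ** (D ** T) = 0"
    unfolding matrix_add_ldistrib[symmetric] by (simp add: matrix_matrix_mult_def vec_eq_iff)
  then have "trace (D ** S ** D) + trace (D ** (D ** T)) = 0"
    by (metis trace_add trace_0 mat_0 matrix_mul_assoc)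
  moreover have "trace (D ** (D ** T)) = trace (D ** T ** D)"
    by (rule trace_mul_sym)
  ultimately have "(\<Sum>j\<in>UNIV. Re (hquad S (\<chi> i. D$i$j))) + (\<Sum>j\<in>UNIV. Re (hquad T (\<chi> i. D$i$j))) = 0"
    by (metis Re_sum plus_complex.simps(1) trace_hermitian_conj[OF hD] zero_complex.simps(1))
  moreover have "0 \<le> (\<Sum>j\<in>UNIV. Re (hquad S (\<chi> i. D$i$j)))"
    using S by (intro sum_nonneg) (simp add: pos_semidef_def)
  moreover have nT: "0 \<le> Re (hquad T v)" for v
    using pos_def_imp_pos_semidef[OF T] by (simp add: pos_semidef_def)
  ultimately have "(\<Sum>j\<in>UNIV. Re (hquad T (\<chi> i. D$i$j))) = 0"
    using sum_nonneg[of UNIV "\<lambda>j. Re (hquad T (\<chi> i. D$i$j))"] by simp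
  then have "\<forall>j. Re (hquad T (\<chi> i. D$i$j)) = 0"
    using nT by (subst (asm) sum_nonneg_eq_0_iff) auto
  then have "\<forall>j. (\<chi> i. D$i$j) = 0"
    using T unfolding pos_def_def by (metis less_irrefl)
  then have "D = 0" by (simp add: vec_eq_iff)
  then show ?thesis by (simp add: D_def)
qed

lemma msqrt_eqI:
  assumes "pos_def S" "S ** S = M"
  shows "msqrt M = S"
  unfolding msqrt_def
  using assms pos_def_imp_pos_semidef pos_def_sqrt_unique by (intro the_equality) auto

lemma msqrt:
  assumes "pos_def M"
  shows "pos_def (msqrt M)" "msqrt M ** msqrt M = M"
  using pos_def_sqrt_exists[OF assms] msqrt_eqI by metis+

lemma pos_def_mult_eq_0:
  assumes "pos_def M" "M *v v = 0"
  shows "v = 0"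
  using assms unfolding pos_def_inner by (metis inner_zero_right less_irrefl)

lemma pos_def_matrix_inv:
  assumes M: "pos_def (M::complex^'n^'n)"
  shows "matrix_inv M ** M = mat 1" "M ** matrix_inv M = mat 1" "pos_def (matrix_inv M)"
proof -
  have "invertible M"
    using pos_def_mult_eq_0[OF M] invertible_left_inverse matrix_left_invertible_ker by blast
  then show inv: "matrix_inv M ** M = mat 1" "M ** matrix_inv M = mat 1"
    unfolding matrix_inv_def invertible_def by (metis (mono_tags, lifting) someI_ex)+
  have MI: "M *v (matrix_inv M *v v) = v" for v
    by (simp add: matrix_vector_mul_assoc inv)
  have adj: "inner (M *v v) w = inner v (M *v w)" for v w
    using M hermitian_selfadjoint by (auto simp: pos_def_inner)
  show "pos_def (matrix_inv M)"
    unfolding pos_def_inner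
  proof (intro conjI allI impI selfadjoint_hermitian)
    show "inner (matrix_inv M *v v) w = inner v (matrix_inv M *v w)" for v w
      using adj[of "matrix_inv M *v v" "matrix_inv M *v w"] by (simp add: MI)
    fix v :: "complex^'n" assume "v \<noteq> 0"
    then have "matrix_inv M *v v \<noteq> 0" using MI[of v] by (metis matrix_vector_mult_0_right)
    then show "0 < inner v (matrix_inv M *v v)"
      using M unfolding pos_def_inner by (metis MI inner_commute)
  qed
qed

lemma msqrt_matrix_inv:
  assumes M: "pos_def M"
  shows "msqrt (matrix_inv M) = matrix_inv (msqrt M)"
proof (rule msqrt_eqI)
  let ?S = "msqrt M" and ?T = "matrix_inv (msqrt M)"
  note S = msqrt[OF M]
  note T = pos_def_matrix_inv[OF S(1)]
  show "pos_def ?T" by (rule T(3))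
  have "(?T ** ?T) ** M = ?T ** ((?T ** ?S) ** ?S)"
    by (metis matrix_mul_assoc S(2))
  then have "(?T ** ?T) ** M = mat 1" by (simp add: T)
  then show "?T ** ?T = matrix_inv M"
    by (metis pos_def_matrix_inv(2)[OF M] matrix_mul_assoc matrix_mul_lid matrix_mul_rid)
qed

lemma pos_def_mat_1: "pos_def (mat 1 :: complex^'n^'n)"
  unfolding pos_def_inner by (auto intro!: selfadjoint_hermitian)

lemma msqrt_mat_1: "msqrt (mat 1 :: complex^'n^'n) = mat 1"
  by (rule msqrt_eqI) (auto simp: pos_def_mat_1)

text \<open>The right-hand side is a finite sum of products of entries, so this identity removes the
  description \<open>msqrt\<close> from questions of measurability.\<close>

lemma norm_msqrt_vec_sq:
  assumes "pos_def M"
  shows "(norm (msqrt M *v v))\<^sup>2 = Re (hquad M v)"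
proof -
  have "inner (msqrt M *v v) (msqrt M *v v) = inner v (msqrt M *v (msqrt M *v v))"
    using hermitian_selfadjoint msqrt(1)[OF assms] by (auto simp: pos_def_inner)
  then show ?thesis
    by (simp add: power2_norm_eq_inner Re_hquad matrix_vector_mul_assoc msqrt(2)[OF assms])
qed

lemma frob_eq_norm: "frob M = norm M"
  by (simp add: frob_def norm_vec_def L2_set_def sum_nonneg)

lemma norm_matrix_sq_columns:
  "(norm (M::complex^'m^'n))\<^sup>2 = (\<Sum>j\<in>UNIV. (norm (\<chi> i. M$i$j))\<^sup>2)"
  by (simp add: norm_vec_def L2_set_def sum_nonneg) (rule sum.swap)

lemma column_matrix_mult: "(\<chi> i. (S ** G)$i$j) = S *v (\<chi> i. (G::complex^'m^'n)$i$j)"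
  by (simp add: vec_eq_iff matrix_matrix_mult_def matrix_vector_mult_def)

lemma norm_msqrt_mat_sq:
  assumes "pos_def M"
  shows "(norm (msqrt M ** G))\<^sup>2 = (\<Sum>j\<in>UNIV. Re (hquad M (\<chi> i. (G::complex^'m^'n)$i$j)))"
  by (simp add: norm_matrix_sq_columns column_matrix_mult norm_msqrt_vec_sq[OF assms])

text \<open>The norm of \<open>A\<^sup>1\<^sup>/\<^sup>2 B\<^sup>-\<^sup>1\<^sup>/\<^sup>2\<close>, the least constant with
  \<open>\<bar>A\<^sup>1\<^sup>/\<^sup>2 w\<bar> \<le> c \<bar>B\<^sup>1\<^sup>/\<^sup>2 w\<bar>\<close>.\<close>

definition sqrt_ratio :: "complex^'n^'n \<Rightarrow> complex^'n^'n \<Rightarrow> real" where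
  "sqrt_ratio A B = mnorm (msqrt A ** msqrt (matrix_inv B))"

lemma msqrt_inv_cancel:
  assumes "pos_def B"
  shows "msqrt (matrix_inv B) *v (msqrt B *v w) = w" "msqrt B *v (msqrt (matrix_inv B) *v w) = w"
  using pos_def_matrix_inv[OF msqrt(1)[OF assms]]
  by (simp_all add: msqrt_matrix_inv[OF assms] matrix_vector_mul_assoc)

lemma sqrt_ratio_nonneg: "0 \<le> sqrt_ratio A B"
  unfolding sqrt_ratio_def mnorm_def by (rule onorm_pos_le[OF bounded_linear_mult_vec])

lemma sqrt_ratio_vec:
  assumes "pos_def B"
  shows "norm (msqrt A *v w) \<le> sqrt_ratio A B * norm (msqrt B *v w)"
  using onorm[OF bounded_linear_mult_vec, of "msqrt A ** msqrt (matrix_inv B)" "msqrt B *v w"]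
  by (simp add: sqrt_ratio_def mnorm_def matrix_vector_mul_assoc[symmetric] msqrt_inv_cancel[OF assms])

lemma sqrt_ratio_leI:
  assumes "pos_def B" "\<And>w. norm (msqrt A *v w) \<le> c * norm (msqrt B *v w)"
  shows "sqrt_ratio A B \<le> c"
  unfolding sqrt_ratio_def mnorm_def
proof (rule onorm_le)
  fix v
  show "norm (msqrt A ** msqrt (matrix_inv B) *v v) \<le> c * norm v"
    using assms(2)[of "msqrt (matrix_inv B) *v v"]
    by (simp add: matrix_vector_mul_assoc[symmetric] msqrt_inv_cancel[OF assms(1)])
qed

lemma sqrt_ratio_mat:
  assumes "pos_def B"
  shows "norm (msqrt A ** (G::complex^'m^'n)) \<le> sqrt_ratio A B * norm (msqrt B ** G)"
proof (rule power2_le_imp_le)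
  have "(norm (msqrt A ** G))\<^sup>2 \<le> (\<Sum>j\<in>UNIV. (sqrt_ratio A B)\<^sup>2 * (norm (msqrt B *v (\<chi> i. G$i$j)))\<^sup>2)"
    unfolding norm_matrix_sq_columns column_matrix_mult power_mult_distrib[symmetric]
    by (intro sum_mono power_mono sqrt_ratio_vec assms) auto
  then show "(norm (msqrt A ** G))\<^sup>2 \<le> (sqrt_ratio A B * norm (msqrt B ** G))\<^sup>2"
    by (simp add: norm_matrix_sq_columns column_matrix_mult power_mult_distrib sum_distrib_left)
qed (simp add: sqrt_ratio_nonneg)

lemma norm_msqrt_pos: "pos_def A \<Longrightarrow> w \<noteq> 0 \<Longrightarrow> 0 < norm (msqrt A *v w)"
  using pos_def_mult_eq_0[OF msqrt(1)] by auto

text \<open>Passing from \<open>A\<close> to \<open>B\<close> and back returns the same nonzero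
  vector. This is the source of the lower bound 1 for the characteristic.\<close>

lemma sqrt_ratio_mult_ge_1:
  assumes "pos_def A" "pos_def B"
  shows "1 \<le> sqrt_ratio A B * sqrt_ratio B A"
proof -
  let ?w = "axis undefined 1 :: complex^'a"
  have w: "0 < norm (msqrt A *v ?w)" by (rule norm_msqrt_pos[OF assms(1)]) (simp add: axis_eq_0_iff)
  have "norm (msqrt A *v ?w) \<le> sqrt_ratio A B * (sqrt_ratio B A * norm (msqrt A *v ?w))"
    using sqrt_ratio_vec[OF assms(2), of A ?w] sqrt_ratio_vec[OF assms(1), of B ?w] sqrt_ratio_nonneg[of A B]
    by (meson mult_left_mono order_trans)
  then show ?thesis using w by (simp add: mult.assoc[symmetric])
qed

lemma sqrt_ratio_trans:
  assumes "pos_def A" "pos_def B"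
  shows "sqrt_ratio C B \<le> sqrt_ratio C A * sqrt_ratio A B"
proof (rule sqrt_ratio_leI[OF assms(2)])
  fix w
  show "norm (msqrt C *v w) \<le> sqrt_ratio C A * sqrt_ratio A B * norm (msqrt B *v w)"
    using sqrt_ratio_vec[OF assms(1), of C w] sqrt_ratio_vec[OF assms(2), of A w] sqrt_ratio_nonneg[of C A]
    by (metis mult.assoc mult_left_mono order_trans)
qed

lemma mnorm_msqrt_inv: "mnorm (msqrt (matrix_inv B)) = sqrt_ratio (mat 1) B"
  by (simp add: sqrt_ratio_def msqrt_mat_1)


section \<open>Measurability of weights and the characteristic\<close>

lemma hquad_eq_sum: "hquad M v = (\<Sum>i\<in>UNIV. \<Sum>j\<in>UNIV. cnj (v$i) * (M$i$j * v$j))"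
  by (simp add: hquad_def matrix_vector_mult_def sum_distrib_left)

lemma borel_measurable_vec_nth [measurable (raw)]:
  fixes f :: "'a \<Rightarrow> ('b::euclidean_space)^'n"
  assumes "f \<in> borel_measurable M"
  shows "(\<lambda>x. f x $ i) \<in> borel_measurable M"
  using assms by (rule borel_measurable_continuous_on[OF continuous_on_component[OF continuous_on_id], unfolded o_def])

lemma borel_measurable_vecI:
  fixes f :: "'a \<Rightarrow> ('b::euclidean_space)^'n"
  assumes "\<And>i. (\<lambda>x. f x $ i) \<in> borel_measurable M"
  shows "f \<in> borel_measurable M"
  unfolding borel_measurable_euclidean_space[of f]
proof
  fix b :: "'b^'n" assume "b \<in> Basis"
  then obtain i c where "b = axis i c" "c \<in> Basis" by (auto simp: Basis_vec_def)
  then show "(\<lambda>x. inner (f x) b) \<in> borel_measurable M"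
    using assms[of i] by (simp add: inner_axis)
qed

lemma borel_measurable_hquad [measurable (raw)]:
  fixes W :: "'a \<Rightarrow> complex^'n^'n"
  assumes "W \<in> borel_measurable M" "f \<in> borel_measurable M"
  shows "(\<lambda>x. Re (hquad (W x) (f x))) \<in> borel_measurable M"
proof -
  have [measurable]: "(\<lambda>x. f x $ i) \<in> borel_measurable M" "(\<lambda>x. W x $ i $ j) \<in> borel_measurable M" for i j
    using assms by (auto intro!: borel_measurable_vec_nth)
  have cnjm: "(\<lambda>x. cnj (f x $ i)) \<in> borel_measurable M" for i
    by (rule borel_measurable_continuous_on[OF _ \<open>(\<lambda>x. f x $ i) \<in> borel_measurable M\<close>]) (intro continuous_intros)
  show ?thesis
    unfolding hquad_eq_sum
    by (intro borel_measurable_continuous_on[where f=Re] borel_measurable_sum borel_measurable_times cnjm)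
      (auto intro!: continuous_intros)
qed

lemma borel_measurable_column:
  fixes G :: "'a \<Rightarrow> complex^'m^'n"
  assumes "G \<in> borel_measurable M"
  shows "(\<lambda>x. \<chi> i. G x $ i $ j) \<in> borel_measurable M"
proof (rule borel_measurable_vecI)
  fix i show "(\<lambda>x. (\<chi> i. G x $ i $ j) $ i) \<in> borel_measurable M"
    using assms by (simp add: borel_measurable_vec_nth)
qed

lemma borel_measurable_norm_msqrt_vec:
  fixes W :: "'a \<Rightarrow> complex^'n^'n"
  assumes "W \<in> borel_measurable M" "f \<in> borel_measurable M" "\<And>x. pos_def (W x)"
  shows "(\<lambda>x. norm (msqrt (W x) *v f x)) \<in> borel_measurable M"
proof -
  have "norm (msqrt (W x) *v f x) = sqrt (Re (hquad (W x) (f x)))" for x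
    by (metis norm_msqrt_vec_sq[OF assms(3)] norm_ge_zero real_sqrt_abs abs_of_nonneg)
  then show ?thesis using assms(1,2) by (simp add: borel_measurable_hquad)
qed

lemma borel_measurable_norm_msqrt_mat:
  fixes W :: "'a \<Rightarrow> complex^'n^'n" and G :: "'a \<Rightarrow> complex^'m^'n"
  assumes "W \<in> borel_measurable M" "G \<in> borel_measurable M" "\<And>x. pos_def (W x)"
  shows "(\<lambda>x. norm (msqrt (W x) ** G x)) \<in> borel_measurable M"
proof -
  have "norm (msqrt (W x) ** G x) = sqrt (\<Sum>j\<in>UNIV. Re (hquad (W x) (\<chi> i. (G x)$i$j)))" for x
    by (metis norm_msqrt_mat_sq[OF assms(3)] norm_ge_zero real_sqrt_abs abs_of_nonneg)
  moreover have "(\<lambda>x. sqrt (\<Sum>j\<in>UNIV. Re (hquad (W x) (\<chi> i. (G x)$i$j)))) \<in> borel_measurable M"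
    by (intro borel_measurable_sqrt[THEN measurable_compose_rev] borel_measurable_sum borel_measurable_hquad
        borel_measurable_column assms)
  ultimately show ?thesis by simp
qed

text \<open>An inequality between the two forms is a closed condition on the vector, so a bound on a
  dense set holds everywhere. With \<open>D\<close> countable this makes the norm measurable jointly
  in both matrices. At the vector 0 the quotient is 0 / 0 = 0, which is harmless.\<close>

lemma sqrt_ratio_SUP:
  fixes A B :: "complex^'n^'n"
  assumes AB: "pos_def A" "pos_def B"
    and D: "\<And>U. open U \<Longrightarrow> U \<noteq> {} \<Longrightarrow> \<exists>d\<in>D. d \<in> (U :: (complex^'n) set)"
  shows "ennreal ((sqrt_ratio A B)\<^sup>2) = (SUP w\<in>D. ennreal (Re (hquad A w) / Re (hquad B w)))"
    (is "_ = ?R")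
proof (rule antisym)
  have nn: "0 \<le> Re (hquad A w)" "0 \<le> Re (hquad B w)" for w
    using AB pos_def_imp_pos_semidef by (auto simp: pos_semidef_def)
  have posB: "0 < Re (hquad B w)" if "w \<noteq> 0" for w
    using AB that by (auto simp: pos_def_def)
  show "?R \<le> ennreal ((sqrt_ratio A B)\<^sup>2)"
  proof (intro SUP_least ennreal_leI)
    fix w
    have "(norm (msqrt A *v w))\<^sup>2 \<le> (sqrt_ratio A B * norm (msqrt B *v w))\<^sup>2"
      by (intro power_mono sqrt_ratio_vec AB) auto
    then have "Re (hquad A w) \<le> (sqrt_ratio A B)\<^sup>2 * Re (hquad B w)"
      by (simp add: power_mult_distrib norm_msqrt_vec_sq AB)
    then show "Re (hquad A w) / Re (hquad B w) \<le> (sqrt_ratio A B)\<^sup>2"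
      using nn(2)[of w] by (cases "Re (hquad B w) = 0") (auto simp: divide_le_eq)
  qed
  show "ennreal ((sqrt_ratio A B)\<^sup>2) \<le> ?R"
  proof (cases ?R)
    case (real s)
    have Dw: "Re (hquad A w) \<le> s * Re (hquad B w)" if "w \<in> D" "w \<noteq> 0" for w
    proof -
      have "ennreal (Re (hquad A w) / Re (hquad B w)) \<le> ennreal s"
        unfolding real(2)[symmetric] using that(1) by (rule SUP_upper)
      then show ?thesis using real(1) posB[OF that(2)] by (simp add: divide_le_eq)
    qed
    have contq: "continuous_on UNIV (\<lambda>w. Re (hquad M w))" for M :: "complex^'n^'n"
      unfolding Re_hquad by (intro continuous_intros linear_continuous_on bounded_linear_mult_vec)
    let ?C = "{w. Re (hquad A w) \<le> s * Re (hquad B w)}"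
    have "closed ?C" by (intro closed_Collect_le continuous_intros contq)
    moreover have "D \<subseteq> ?C"
    proof
      fix w assume "w \<in> D"
      then show "w \<in> ?C" using Dw by (cases "w = 0") (auto simp: hquad_def)
    qed
    ultimately have "?C = UNIV"
      using D[of "- ?C"] by (auto simp: open_Compl)
    then have "Re (hquad A w) \<le> s * Re (hquad B w)" for w by auto
    then have "(norm (msqrt A *v w))\<^sup>2 \<le> (sqrt s * norm (msqrt B *v w))\<^sup>2" for w
      using real(1) by (simp add: power_mult_distrib norm_msqrt_vec_sq AB)
    then have "norm (msqrt A *v w) \<le> sqrt s * norm (msqrt B *v w)" for w
      using real(1) by (meson mult_nonneg_nonneg norm_ge_zero power2_le_imp_le real_sqrt_ge_zero)
    then have "sqrt_ratio A B \<le> sqrt s" by (rule sqrt_ratio_leI[OF AB(2)])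
    then have "(sqrt_ratio A B)\<^sup>2 \<le> s"
      using real(1) sqrt_ratio_nonneg by (metis power_mono real_sqrt_pow2)
    then show ?thesis using real by (simp add: ennreal_leI)
  next
    case top
    show ?thesis unfolding top by simp
  qed
qed

lemma borel_measurable_sqrt_ratio_sq:
  fixes f g :: "'a \<Rightarrow> complex^'n^'n"
  assumes fg: "f \<in> borel_measurable M" "g \<in> borel_measurable M"
    and pd: "\<And>x. pos_def (f x)" "\<And>x. pos_def (g x)"
  shows "(\<lambda>x. ennreal ((sqrt_ratio (f x) (g x))\<^sup>2)) \<in> borel_measurable M"
proof -
  obtain D :: "(complex^'n) set" where D: "countable D" "\<And>U. open U \<Longrightarrow> U \<noteq> {} \<Longrightarrow> \<exists>d\<in>D. d \<in> U"
    using countable_dense_setE by blast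
  have eq: "ennreal ((sqrt_ratio (f x) (g x))\<^sup>2) = (SUP w\<in>D. ennreal (Re (hquad (f x) w) / Re (hquad (g x) w)))" for x
    by (rule sqrt_ratio_SUP) (use pd D in auto)
  show ?thesis
    unfolding eq
    by (intro borel_measurable_SUP D(1) measurable_compose[OF _ measurable_ennreal]
        borel_measurable_divide borel_measurable_hquad fg measurable_const) auto
qed

lemma borel_measurable_sqrt_ratio:
  fixes f g :: "'a \<Rightarrow> complex^'n^'n"
  assumes fg: "f \<in> borel_measurable M" "g \<in> borel_measurable M"
    and pd: "\<And>x. pos_def (f x)" "\<And>x. pos_def (g x)"
  shows "(\<lambda>x. sqrt_ratio (f x) (g x)) \<in> borel_measurable M"
proof -
  have "sqrt_ratio (f x) (g x) = sqrt (enn2real (ennreal ((sqrt_ratio (f x) (g x))\<^sup>2)))" for x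
    by (simp add: sqrt_ratio_nonneg)
  moreover have "(\<lambda>x. sqrt (enn2real (ennreal ((sqrt_ratio (f x) (g x))\<^sup>2)))) \<in> borel_measurable M"
    using borel_measurable_sqrt_ratio_sq[OF assms]
    by (intro borel_measurable_sqrt[THEN measurable_compose] measurable_compose[OF _ borel_measurable_sqrt]) simp
  ultimately show ?thesis by simp
qed

lemma completion_ex_borel_measurable_complex:
  fixes f :: "'a \<Rightarrow> complex"
  assumes "f \<in> borel_measurable (completion M)"
  shows "\<exists>f'\<in>borel_measurable M. AE x in M. f x = f' x"
proof -
  have "(\<lambda>x. Re (f x)) \<in> borel_measurable (completion M)" "(\<lambda>x. Im (f x)) \<in> borel_measurable (completion M)"
    using assms by auto
  then obtain a b where "a \<in> borel_measurable M" "AE x in M. Re (f x) = a x"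
      "b \<in> borel_measurable M" "AE x in M. Im (f x) = b x"
    using completion_ex_borel_measurable_real by metis
  then show ?thesis
    by (intro bexI[of _ "\<lambda>x. Complex (a x) (b x)"]) (auto simp: complex_eq_iff Complex_eq)
qed

lemma locally_integrable_imp_measurable:
  fixes f :: "real^2 \<Rightarrow> complex"
  assumes "\<And>K. compact K \<Longrightarrow> integrable (lebesgue_on K) f"
  shows "f \<in> borel_measurable lebesgue"
proof (rule borel_measurable_LIMSEQ_metric)
  fix n :: nat
  have "f \<in> borel_measurable (lebesgue_on (cball 0 (real n)))"
    using assms by auto
  then show "(\<lambda>x. if x \<in> cball 0 (real n) then f x else 0) \<in> borel_measurable lebesgue"
    by (subst borel_measurable_if) auto
next
  fix x :: "real^2"
  obtain N where N: "norm x \<le> real N" using real_arch_simple by blast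
  show "(\<lambda>n. if x \<in> cball 0 (real n) then f x else 0) \<longlonglongrightarrow> f x"
    by (rule tendsto_eventually, rule eventually_sequentiallyI[of N])
      (use N in \<open>auto intro: order_trans\<close>)
qed

text \<open>On a null set containing all points where \<open>W\<close> differs from its Borel
  coordinates or fails to be positive definite, the identity matrix is substituted. Fubini on
  \<open>lborel\<close> then applies to the kernels built from \<open>V\<close>, and the facts on
  roots hold at every point.\<close>

lemma weight_borel_version:
  fixes W :: "real^2 \<Rightarrow> complex^'n^'n"
  assumes "matrix_A2_weight W"
  obtains V where "V \<in> borel_measurable borel" "\<And>x. pos_def (V x)" "AE x in lborel. W x = V x"
proof -
  have "(\<lambda>x. W x $ i $ j) \<in> borel_measurable lebesgue" for i j
    using assms by (intro locally_integrable_imp_measurable) (auto simp: matrix_A2_weight_def)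
  then have "\<exists>f'\<in>borel_measurable lborel. AE x in lborel. W x $ i $ j = f' x" for i j
    by (rule completion_ex_borel_measurable_complex)
  then have ex: "\<exists>f'. f' \<in> borel_measurable lborel \<and> (AE x in lborel. W x $ i $ j = f' x)" for i j by blast
  define V where "V i j = (SOME f'. f' \<in> borel_measurable lborel \<and> (AE x in lborel. W x $ i $ j = f' x))" for i j
  have V: "V i j \<in> borel_measurable lborel" "AE x in lborel. W x $ i $ j = V i j x" for i j
    using someI_ex[OF ex, of i j] unfolding V_def by auto
  have "AE x in lborel. \<forall>i j. W x $ i $ j = V i j x"
    using V(2) by (simp add: AE_all_countable)
  moreover have "AE x in lborel. pos_def (W x)"
    using assms by (simp add: matrix_A2_weight_def AE_completion_iff)
  ultimately have "AE x in lborel. (\<forall>i j. W x $ i $ j = V i j x) \<and> pos_def (W x)" by eventually_elim simp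
  then obtain N where N: "{x \<in> space lborel. \<not> ((\<forall>i j. W x $ i $ j = V i j x) \<and> pos_def (W x))} \<subseteq> N"
      "N \<in> null_sets lborel"
    by (rule AE_E) (auto simp: null_sets_def)
  define V' :: "real^2 \<Rightarrow> complex^'n^'n" where "V' x = (if x \<in> N then mat 1 else (\<chi> i j. V i j x))" for x
  have eq: "W x = V' x" if "x \<notin> N" for x
    using N(1) that by (auto simp: V'_def vec_eq_iff)
  have "V' \<in> borel_measurable lborel"
    unfolding V'_def using N(2) V(1)
    by (intro measurable_If_set borel_measurable_vecI) (auto simp: borel_measurable_vecI)
  moreover have "pos_def (V' x)" for x
  proof (cases "x \<in> N")
    case True
    then show ?thesis by (simp add: V'_def pos_def_mat_1)
  next
    case False
    then have "pos_def (W x)" using N(1) by auto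
    then show ?thesis using eq[OF False] by simp
  qed
  moreover have "AE x in lborel. W x = V' x"
    using AE_not_in[OF N(2)] by eventually_elim (rule eq)
  ultimately show ?thesis using that by simp
qed

lemma A2_char_cong:
  assumes "AE x in lborel. W x = V x"
  shows "A2_char W = A2_char V"
proof -
  have "(\<integral>\<^sup>+x\<in>Q. (\<integral>\<^sup>+y\<in>Q. ennreal ((mnorm (msqrt (W x) ** msqrt (matrix_inv (W y))))\<^sup>2) \<partial>lebesgue) \<partial>lebesgue)
      = (\<integral>\<^sup>+x\<in>Q. (\<integral>\<^sup>+y\<in>Q. ennreal ((mnorm (msqrt (V x) ** msqrt (matrix_inv (V y))))\<^sup>2) \<partial>lebesgue) \<partial>lebesgue)" for Q
    unfolding nn_integral_completion
  proof (rule nn_integral_cong_AE)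
    show "AE x in lborel. (\<integral>\<^sup>+y\<in>Q. ennreal ((mnorm (msqrt (W x) ** msqrt (matrix_inv (W y))))\<^sup>2) \<partial>lborel) * indicator Q x
       = (\<integral>\<^sup>+y\<in>Q. ennreal ((mnorm (msqrt (V x) ** msqrt (matrix_inv (V y))))\<^sup>2) \<partial>lborel) * indicator Q x"
      using assms
    proof eventually_elim
      case (elim x)
      show ?case
        using assms unfolding elim
        by (intro arg_cong2[where f="(*)"] nn_integral_cong_AE refl) (auto elim: eventually_mono)
    qed
  qed
  then show ?thesis unfolding A2_char_def by simp
qed

section \<open>Cubes given by centre and half-side, and the lower bound for the
  characteristic\<close>

definition kube :: "real^2 \<Rightarrow> real \<Rightarrow> (real^2) set" where
  "kube x r = cbox (x - r *\<^sub>R One) (x + r *\<^sub>R One)"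

lemma mem_kube: "z \<in> kube x r \<longleftrightarrow> (\<forall>i. \<bar>z$i - x$i\<bar> \<le> r)"
proof -
  have "(One::real^2) $ i = 1" for i
    unfolding cart_eq_inner_axis by (rule inner_sum_Basis) (simp add: axis_in_Basis_iff)
  then show ?thesis unfolding kube_def mem_box_cart by (auto simp: abs_le_iff algebra_simps)
qed

lemma kube_sym: "z \<in> kube x r \<longleftrightarrow> x \<in> kube z r"
  unfolding mem_kube by (simp add: abs_minus_commute)

lemma kube_trans: "z \<in> kube y s \<Longrightarrow> y \<in> kube x r \<Longrightarrow> z \<in> kube x (r + s)"
proof -
  assume "z \<in> kube y s" "y \<in> kube x r"
  then have "\<bar>z$i - y$i\<bar> \<le> s" "\<bar>y$i - x$i\<bar> \<le> r" for i by (auto simp: mem_kube)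
  then have "\<bar>(z$i - y$i) + (y$i - x$i)\<bar> \<le> r + s" for i
    by (metis abs_triangle_ineq add.commute add_mono order_trans)
  then show ?thesis by (simp add: mem_kube)
qed

lemma kube_mono: "r \<le> s \<Longrightarrow> kube x r \<subseteq> kube x s"
  unfolding mem_kube subset_iff by (intro impI allI) (rule order_trans, auto)

lemma ball_subset_kube: "ball x r \<subseteq> kube x r"
proof
  fix z assume "z \<in> ball x r"
  then have "norm (z - x) \<le> r" by (simp add: dist_norm norm_minus_commute)
  then have "\<bar>(z - x)$i\<bar> \<le> r" for i using component_le_norm_cart[of "z - x" i] by linarith
  then show "z \<in> kube x r" by (simp add: mem_kube)
qed

lemma kube_subset_cball: "kube x r \<subseteq> cball x (2 * r)"
proof
  fix z assume z: "z \<in> kube x r"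
  have "norm (z - x) \<le> (\<Sum>i\<in>UNIV. \<bar>(z - x)$i\<bar>)" by (rule norm_le_l1_cart)
  also have "\<dots> \<le> 2 * r" using z by (simp add: mem_kube UNIV_2) (metis add_mono mult_2)
  finally show "z \<in> cball x (2 * r)" by (simp add: dist_norm norm_minus_commute)
qed

lemma kube_sets [measurable, simp]: "kube x r \<in> sets borel"
  "kube x r \<in> sets lborel"
  by (simp_all add: kube_def)

lemma compact_kube: "compact (kube x r)" and convex_kube: "convex (kube x r)"
  by (simp_all add: kube_def convex_box)

lemma emeasure_kube: "0 \<le> r \<Longrightarrow> emeasure lborel (kube x r) = ennreal (4 * r\<^sup>2)"
proof -
  assume r: "0 \<le> r"
  have side: "(x + r *\<^sub>R One - (x - r *\<^sub>R One)) \<bullet> b = 2 * r" if "b \<in> Basis" for b :: "real^2"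
    using inner_sum_Basis[OF that] by (simp only: inner_diff_left inner_add_left inner_scaleR_left)
  have le: "(x - r *\<^sub>R One) \<bullet> b \<le> (x + r *\<^sub>R One) \<bullet> b" if "b \<in> Basis" for b :: "real^2"
    using side[OF that] r by (simp only: inner_diff_left)
  have "emeasure lborel (kube x r) = (\<Prod>b\<in>(Basis::(real^2) set). 2 * r)"
    unfolding kube_def
    by (subst emeasure_lborel_cbox[OF le], assumption)
      (intro arg_cong[of _ _ ennreal] prod.cong refl side)
  also have "\<dots> = ennreal (4 * r\<^sup>2)"
    by (simp add: power_mult_distrib)
  finally show ?thesis .
qed

lemma is_cube_kube: "0 < r \<Longrightarrow> is_cube (kube x r)"
  unfolding is_cube_def kube_def
proof (intro exI conjI)
  assume "0 < r"
  then show "0 < 2 * r" by simp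
  have "x - r *\<^sub>R One + (2 * r) *\<^sub>R One = x + r *\<^sub>R One"
    by (simp add: vec_eq_iff)
  then show "cbox (x - r *\<^sub>R One) (x + r *\<^sub>R One) = cbox (x - r *\<^sub>R One) (x - r *\<^sub>R One + (2 * r) *\<^sub>R One)"
    by (simp only:)
qed

text \<open>A cube of half-side \<open>r\<close> has area \<open>4 * r^2\<close>, whose square
  clears the normalisation in \<open>A2_char\<close>.\<close>

lemma A2_kube:
  assumes "0 < r"
  shows "(\<integral>\<^sup>+x\<in>kube a r. (\<integral>\<^sup>+y\<in>kube a r. ennreal ((sqrt_ratio (W x) (W y))\<^sup>2) \<partial>lborel) \<partial>lborel)
     \<le> ennreal (16 * r^4) * A2_char W" (is "?I \<le> _")
proof -
  have m: "measure lebesgue (kube a r) = 4 * r\<^sup>2"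
    using emeasure_kube[of r a] assms by (simp add: measure_def)
  have "ennreal (1 / (measure lebesgue (kube a r))\<^sup>2) *
      (\<integral>\<^sup>+x\<in>kube a r. (\<integral>\<^sup>+y\<in>kube a r. ennreal ((mnorm (msqrt (W x) ** msqrt (matrix_inv (W y))))\<^sup>2) \<partial>lebesgue) \<partial>lebesgue)
      \<le> A2_char W"
    unfolding A2_char_def using is_cube_kube[OF assms] by (intro SUP_upper) auto
  then have "ennreal (1 / (16 * r^4)) * ?I \<le> A2_char W"
    unfolding m nn_integral_completion sqrt_ratio_def by (simp add: power_mult_distrib flip: power_mult)
  then have "ennreal (16 * r^4) * (ennreal (1 / (16 * r^4)) * ?I) \<le> ennreal (16 * r^4) * A2_char W"
    by (rule mult_left_mono) simp
  also have "ennreal (16 * r^4) * (ennreal (1 / (16 * r^4)) * ?I) = ?I"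
    using assms by (simp add: mult.assoc[symmetric] ennreal_mult[symmetric])
  finally show ?thesis .
qed

text \<open>The squares of the norms for (x, y) and for (y, x) add up to at least twice the product
  of the two norms, hence to at least 2, and by Fubini both squares have the same double integral
  over a cube.\<close>

lemma A2_char_ge_1:
  fixes W :: "real^2 \<Rightarrow> complex^'n^'n"
  assumes W [measurable]: "W \<in> borel_measurable borel" and pd: "\<And>x. pos_def (W x)"
  shows "1 \<le> A2_char W"
proof -
  let ?Q = "kube 0 1"
  define k where "k p = ennreal ((sqrt_ratio (W (fst p)) (W (snd p)))\<^sup>2)" for p
  let ?k = "\<lambda>x y. k (x, y)"
  let ?J = "\<integral>\<^sup>+x\<in>?Q. (\<integral>\<^sup>+y\<in>?Q. ?k x y \<partial>lborel) \<partial>lborel"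
  have mk [measurable]: "k \<in> borel_measurable (borel \<Otimes>\<^sub>M borel)"
    unfolding k_def by (intro borel_measurable_sqrt_ratio_sq pd) measurable
  have J1: "?J = (\<integral>\<^sup>+x. \<integral>\<^sup>+y. ?k x y * indicator ?Q y * indicator ?Q x \<partial>lborel \<partial>lborel)"
    by (intro nn_integral_cong nn_integral_multc[symmetric]) measurable
  also have "\<dots> = (\<integral>\<^sup>+y. \<integral>\<^sup>+x. ?k x y * indicator ?Q y * indicator ?Q x \<partial>lborel \<partial>lborel)"
    by (rule lborel_pair.Fubini') measurable
  finally have J2: "?J = (\<integral>\<^sup>+x. \<integral>\<^sup>+y. ?k y x * indicator ?Q x * indicator ?Q y \<partial>lborel \<partial>lborel)" .
  have mk2 [measurable]: "(\<lambda>x. \<integral>\<^sup>+y. ?k x y * indicator ?Q y * indicator ?Q x \<partial>lborel) \<in> borel_measurable lborel"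
     "(\<lambda>x. \<integral>\<^sup>+y. ?k y x * indicator ?Q x * indicator ?Q y \<partial>lborel) \<in> borel_measurable lborel"
    by (intro lborel.borel_measurable_nn_integral; measurable)+
  have mk3 [measurable]: "(\<lambda>y. ?k x y) \<in> borel_measurable borel" "(\<lambda>y. ?k y x) \<in> borel_measurable borel" for x
    by measurable
  \<comment> \<open>The cube has area 4, so the constant 2 integrates to 32, against a bound of 16
    times the characteristic for each of the two double integrals.\<close>
  have "ennreal 2 * ennreal 4 * ennreal 4 = (\<integral>\<^sup>+x. \<integral>\<^sup>+y. ennreal 2 * indicator ?Q y * indicator ?Q x \<partial>lborel \<partial>lborel)"
    using emeasure_kube[of 1 0] by (simp add: nn_integral_cmult nn_integral_multc)
  also have "\<dots> \<le> (\<integral>\<^sup>+x. \<integral>\<^sup>+y. ?k x y * indicator ?Q y * indicator ?Q x + ?k y x * indicator ?Q x * indicator ?Q y \<partial>lborel \<partial>lborel)"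
  proof (intro nn_integral_mono)
    fix x y
    have "0 \<le> (sqrt_ratio (W x) (W y) - sqrt_ratio (W y) (W x))\<^sup>2" by simp
    then have "2 \<le> (sqrt_ratio (W x) (W y))\<^sup>2 + (sqrt_ratio (W y) (W x))\<^sup>2"
      using sqrt_ratio_mult_ge_1[OF pd pd, of x y] unfolding power2_diff by linarith
    then have "ennreal 2 \<le> ?k x y + ?k y x"
      unfolding k_def by (subst ennreal_plus[symmetric]) (auto intro!: ennreal_leI simp del: ennreal_plus ennreal_numeral)
    then show "ennreal 2 * indicator ?Q y * indicator ?Q x
        \<le> ?k x y * indicator ?Q y * indicator ?Q x + ?k y x * indicator ?Q x * indicator ?Q y"
      by (auto simp: indicator_def)
  qed
  also have "\<dots> = ?J + ?J"
    by (subst (2) J2, subst J1) (simp add: nn_integral_add)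
  also have "\<dots> \<le> ennreal 16 * A2_char W + ennreal 16 * A2_char W"
    using A2_kube[of 1 W 0] by (intro add_mono) (auto simp: k_def)
  finally have "ennreal 32 * 1 \<le> ennreal 32 * A2_char W"
    by (simp add: ennreal_mult[symmetric] ennreal_plus[symmetric] distrib_right[symmetric] del: ennreal_plus)
  then show ?thesis
    by (subst (asm) ennreal_mult_le_mult_iff) auto
qed


section \<open>The weighted Poincare inequality\<close>

lemma nn_integral_lborel_affine:
  fixes f :: "'a::euclidean_space \<Rightarrow> ennreal"
  assumes [measurable]: "f \<in> borel_measurable borel" and c: "0 < c"
  shows "(\<integral>\<^sup>+y. f (t + c *\<^sub>R y) \<partial>lborel) = ennreal (1 / c ^ DIM('a)) * (\<integral>\<^sup>+z. f z \<partial>lborel)"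
proof -
  have "(\<integral>\<^sup>+z. f z \<partial>lborel) = ennreal (c ^ DIM('a)) * (\<integral>\<^sup>+y. f (t + c *\<^sub>R y) \<partial>lborel)"
    using c by (subst lborel_affine[of c t]) (auto simp: nn_integral_density nn_integral_distr nn_integral_cmult)
  then show ?thesis
    using c by (simp add: mult.assoc[symmetric] ennreal_mult[symmetric])
qed

lemma norm_linear_le_matrix:
  fixes L :: "real^2 \<Rightarrow> complex^'n"
  assumes "linear L"
  shows "norm (L w) \<le> norm (\<chi> i \<beta>. (L (axis \<beta> 1)) $ i) * norm w"
proof -
  let ?D = "(\<chi> i \<beta>. (L (axis \<beta> 1)) $ i) :: complex^2^'n"
  have "w = (\<Sum>\<beta>\<in>UNIV. w$\<beta> *\<^sub>R axis \<beta> 1)"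
    using basis_expansion[of w] by (simp add: scalar_mult_eq_scaleR)
  then have "L w = (\<Sum>\<beta>\<in>UNIV. w$\<beta> *\<^sub>R L (axis \<beta> 1))"
    using linear_sum[OF assms] linear_scale[OF assms] by (metis (mono_tags, lifting) sum.cong)
  then have Li: "L w $ i = (\<Sum>\<beta>\<in>UNIV. w$\<beta> *\<^sub>R ?D$i$\<beta>)" for i by simp
  have "norm (L w $ i) \<le> norm (?D$i) * norm w" for i
  proof -
    have "norm (L w $ i) \<le> (\<Sum>\<beta>\<in>UNIV. \<bar>norm (?D$i$\<beta>)\<bar> * \<bar>w$\<beta>\<bar>)"
      unfolding Li by (intro order_trans[OF norm_sum] sum_mono) (simp add: mult.commute)
    also have "\<dots> \<le> L2_set (\<lambda>\<beta>. norm (?D$i$\<beta>)) UNIV * L2_set (\<lambda>\<beta>. w$\<beta>) UNIV"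
      by (rule L2_set_mult_ineq)
    also have "\<dots> = norm (?D$i) * norm w" by (simp add: norm_vec_def L2_set_def)
    finally show ?thesis .
  qed
  then have "norm (L w) \<le> L2_set (\<lambda>i. norm (?D$i) * norm w) UNIV"
    unfolding norm_vec_def[of "L w"] by (intro L2_set_mono) auto
  also have "\<dots> = norm ?D * norm w"
    by (simp add: norm_vec_def[of ?D] L2_set_left_distrib)
  finally show ?thesis .
qed

lemma Ck_1D:
  assumes "Ck (Suc 0) S f" "x \<in> S"
  shows "(f has_derivative frechet_derivative f (at x)) (at x)"
proof -
  obtain f' where "(f has_derivative f' x) (at x)" using assms by auto
  then show ?thesis by (metis frechet_derivative_at)
qed

lemma Ck_1_cont:
  assumes "Ck (Suc 0) S f"
  shows "continuous_on S (\<lambda>x. frechet_derivative f (at x) v)"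
proof -
  obtain f' where f': "\<forall>x\<in>S. (f has_derivative f' x) (at x)" "\<forall>v. continuous_on S (\<lambda>x. f' x v)"
    using assms by auto
  then have "\<And>x. x \<in> S \<Longrightarrow> f' x v = frechet_derivative f (at x) v" by (metis frechet_derivative_at)
  then show ?thesis using f'(2) continuous_on_cong by (metis (no_types, lifting))
qed

lemma Ck_1_continuous: "Ck (Suc 0) S f \<Longrightarrow> continuous_on S f"
  by (intro continuous_at_imp_continuous_on ballI has_derivative_continuous[OF Ck_1D])

lemma Ck_1_continuous_Dmat: "Ck (Suc 0) S f \<Longrightarrow> continuous_on S (Dmat f)"
  unfolding Dmat_def by (intro continuous_on_vec_lambda continuous_on_component Ck_1_cont)

lemma continuous_on_indicator_borel:
  fixes f :: "'a::euclidean_space \<Rightarrow> 'b::real_normed_vector"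
  assumes "continuous_on S f" "Q \<subseteq> S" "Q \<in> sets borel"
  shows "(\<lambda>x. indicator Q x *\<^sub>R f x) \<in> borel_measurable borel"
  by (rule borel_measurable_continuous_on_indicator) (use assms continuous_on_subset in auto)

text \<open>The fundamental theorem of calculus along the segment from \<open>p\<close> to
  \<open>q\<close>. The interval is open at 0 because \<open>t\<close> later acts as a dilation
  factor, which has to be positive.\<close>

lemma norm_diff_le_nn_integral_Dmat:
  fixes f :: "real^2 \<Rightarrow> complex^'n"
  assumes f: "Ck (Suc 0) \<Omega> f" and seg: "\<And>t. t \<in> {0..1} \<Longrightarrow> p + t *\<^sub>R (q - p) \<in> \<Omega>"
  shows "ennreal (norm (f q - f p)) \<le>
    (\<integral>\<^sup>+t\<in>{0<..1}. ennreal (norm (Dmat f (p + t *\<^sub>R (q - p))) * norm (q - p)) \<partial>lborel)"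
proof -
  let ?\<gamma> = "\<lambda>t. p + t *\<^sub>R (q - p)"
  let ?\<phi> = "\<lambda>t. frechet_derivative f (at (?\<gamma> t)) (q - p)"
  have cont: "continuous_on {0..1} ?\<phi>"
    by (rule continuous_on_compose2[OF Ck_1_cont[OF f]]) (use seg in \<open>auto intro!: continuous_intros\<close>)
  have der: "((\<lambda>t. f (?\<gamma> t)) has_vector_derivative ?\<phi> t) (at t within {0..1})" if "0 \<le> t" "t \<le> 1" for t
  proof -
    have "(?\<gamma> has_derivative (\<lambda>s. s *\<^sub>R (q - p))) (at t within {0..1})"
      by (auto intro!: derivative_eq_intros)
    then have "((\<lambda>t. f (?\<gamma> t)) has_derivative (\<lambda>s. frechet_derivative f (at (?\<gamma> t)) (s *\<^sub>R (q - p)))) (at t within {0..1})"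
      by (rule has_derivative_compose) (use that in \<open>auto intro!: Ck_1D[OF f seg]\<close>)
    moreover have "linear (frechet_derivative f (at (?\<gamma> t)))"
      using Ck_1D[OF f seg[of t]] that has_derivative_linear by auto
    ultimately show ?thesis by (simp add: has_vector_derivative_def linear_scale)
  qed
  have "(\<integral>t. indicator {0..1} t *\<^sub>R ?\<phi> t \<partial>lborel) = f q - f p"
    using integral_FTC_atLeastAtMost[OF zero_le_one der cont] by simp
  then have "ennreal (norm (f q - f p)) \<le> (\<integral>\<^sup>+t. norm (indicator {0..1} t *\<^sub>R ?\<phi> t) \<partial>lborel)"
    using integral_norm_bound_ennreal[OF borel_integrable_atLeastAtMost'[OF cont, unfolded set_integrable_def]]
    by simp
  also have "\<dots> \<le> (\<integral>\<^sup>+t\<in>{0<..1}. ennreal (norm (Dmat f (?\<gamma> t)) * norm (q - p)) \<partial>lborel)"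
  proof (rule nn_integral_mono_AE)
    show "AE t in lborel. ennreal (norm (indicator {0..1} t *\<^sub>R ?\<phi> t))
       \<le> ennreal (norm (Dmat f (?\<gamma> t)) * norm (q - p)) * indicator {0<..1} t"
      using AE_lborel_singleton[of "0::real"]
    proof eventually_elim
      case (elim t)
      show ?case
      proof (cases "t \<in> {0<..1}")
        case True
        then have "linear (frechet_derivative f (at (?\<gamma> t)))"
          using Ck_1D[OF f seg[of t]] has_derivative_linear by auto
        then show ?thesis using norm_linear_le_matrix True by (simp add: Dmat_def ennreal_leI)
      qed (use elim in auto)
    qed
  qed
  finally show ?thesis .
qed

text \<open>The matrix is constant: in the Poincare inequality it is the root of the weight frozen
  at the point where \<open>v\<close> is compared with its mean.\<close>

lemma Ck_1_matrix_mult: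
  fixes f :: "real^2 \<Rightarrow> complex^'n" and S :: "complex^'n^'n"
  assumes "Ck (Suc 0) \<Omega> f"
  shows "Ck (Suc 0) \<Omega> (\<lambda>x. S *v f x)" and "x \<in> \<Omega> \<Longrightarrow> Dmat (\<lambda>x. S *v f x) x = S ** Dmat f x"
proof -
  have der: "((\<lambda>x. S *v f x) has_derivative (\<lambda>v. S *v frechet_derivative f (at x) v)) (at x)" if "x \<in> \<Omega>" for x
    using bounded_linear.has_derivative[OF bounded_linear_mult_vec Ck_1D[OF assms that]] .
  moreover have "continuous_on \<Omega> (\<lambda>x. S *v frechet_derivative f (at x) v)" for v
    by (rule bounded_linear.continuous_on[OF bounded_linear_mult_vec Ck_1_cont[OF assms]])
  ultimately show "Ck (Suc 0) \<Omega> (\<lambda>x. S *v f x)"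
    by (auto intro!: exI[of _ "\<lambda>x v. S *v frechet_derivative f (at x) v"])
  assume "x \<in> \<Omega>"
  then have "frechet_derivative (\<lambda>x. S *v f x) (at x) = (\<lambda>v. S *v frechet_derivative f (at x) v)"
    using frechet_derivative_at[OF der] by simp
  then show "Dmat (\<lambda>x. S *v f x) x = S ** Dmat f x"
    by (simp add: Dmat_def vec_eq_iff matrix_matrix_mult_def matrix_vector_mult_def)
qed

text \<open>Centre, point and radius may all vary at once, as the applications of Fubini to families
  of cubes require.\<close>

lemma measurable_kube_indicator [measurable]:
  assumes [measurable]: "f \<in> M \<rightarrow>\<^sub>M borel" "g \<in> M \<rightarrow>\<^sub>M borel" "r \<in> borel_measurable M"
  shows "(\<lambda>p. indicator (kube (f p) (r p)) (g p) :: ennreal) \<in> borel_measurable M"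
proof -
  have "Measurable.pred M (\<lambda>p. \<forall>i. \<bar>g p $ i - f p $ i\<bar> \<le> r p)" by measurable
  then have "indicator {p \<in> space M. \<forall>i. \<bar>g p $ i - f p $ i\<bar> \<le> r p} \<in> borel_measurable M"
    by (intro borel_measurable_indicator) (simp add: pred_def)
  moreover have "(\<lambda>p. indicator (kube (f p) (r p)) (g p) :: ennreal) \<in> borel_measurable M \<longleftrightarrow>
      (indicator {p \<in> space M. \<forall>i. \<bar>g p $ i - f p $ i\<bar> \<le> r p} :: _ \<Rightarrow> ennreal) \<in> borel_measurable M"
    by (rule measurable_cong) (simp add: indicator_def mem_kube)
  ultimately show ?thesis by simp
qed

locale A2_kernel =
  fixes V :: "real^2 \<Rightarrow> complex^'n^'n"
  assumes V_meas [measurable]: "V \<in> borel_measurable borel" and pd: "\<And>x. pos_def (V x)"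
begin

text \<open>Up to a factor 4 this is the mean over the cube of side \<open>2 * \<delta>\<close>,
  with the weight frozen at the centre while \<open>G\<close> varies. The characteristic measures
  exactly this mismatch.\<close>

definition kavg :: "(real^2 \<Rightarrow> complex^2^'n) \<Rightarrow> real \<Rightarrow> real^2 \<Rightarrow> ennreal" where
  "kavg G \<delta> x = ennreal (1 / \<delta>\<^sup>2) * (\<integral>\<^sup>+z. ennreal (norm (msqrt (V x) ** G z)) * indicator (kube x \<delta>) z \<partial>lborel)"

lemma measurable_norm_msqrt_Pair [measurable]:
  fixes G :: "real^2 \<Rightarrow> complex^2^'n"
  assumes [measurable]: "G \<in> borel_measurable borel" "f \<in> M \<rightarrow>\<^sub>M borel" "g \<in> M \<rightarrow>\<^sub>M borel"
  shows "(\<lambda>p. ennreal (norm (msqrt (V (f p)) ** G (g p)))) \<in> borel_measurable M"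
  by (intro measurable_compose[OF _ measurable_ennreal] borel_measurable_norm_msqrt_mat pd) measurable

lemma kavg_measurable [measurable]:
  assumes [measurable]: "G \<in> borel_measurable borel"
  shows "kavg G \<delta> \<in> borel_measurable borel"
  unfolding kavg_def by measurable

text \<open>Cauchy--Schwarz on the cube of radius \<open>2\<delta>\<close> around \<open>a\<close>, followed by an average over \<open>a\<close>.\<close>

lemma kavg_L2:
  assumes G [measurable]: "G \<in> borel_measurable borel" and \<delta>: "0 < \<delta>"
  shows "(\<integral>\<^sup>+x. (kavg G \<delta> x)\<^sup>2 \<partial>lborel)
     \<le> ennreal 1024 * A2_char V * (\<integral>\<^sup>+z. (ennreal (norm (msqrt (V z) ** G z)))\<^sup>2 \<partial>lborel)"
proof -
  define g where "g z = ennreal (norm (msqrt (V z) ** G z))" for z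
  define k where "k x z = ennreal (sqrt_ratio (V x) (V z))" for x z
  have [measurable]: "g \<in> borel_measurable borel" unfolding g_def by measurable
  have km [measurable]: "k x \<in> borel_measurable borel" for x
    unfolding k_def by (intro measurable_compose[OF _ measurable_ennreal] borel_measurable_sqrt_ratio pd) measurable
  have kp [measurable]: "(\<lambda>p. k (fst p) (snd p)) \<in> borel_measurable (borel \<Otimes>\<^sub>M borel)"
    unfolding k_def by (intro measurable_compose[OF _ measurable_ennreal] borel_measurable_sqrt_ratio pd) measurable
  let ?I = "\<lambda>a r z. indicator (kube a r) z :: ennreal"
  define \<Gamma> where "\<Gamma> a = (\<integral>\<^sup>+z. (g z)\<^sup>2 * ?I a (2 * \<delta>) z \<partial>lborel)" for a
  define X where "X a x = (\<integral>\<^sup>+z. (k x z)\<^sup>2 * ?I a (2 * \<delta>) z \<partial>lborel) * ?I a (2 * \<delta>) x" for a x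
  have [measurable]: "X a \<in> borel_measurable borel" for a
  proof -
    have [measurable]: "(\<lambda>x. \<integral>\<^sup>+z. (k x z)\<^sup>2 * ?I a (2 * \<delta>) z \<partial>lborel) \<in> borel_measurable borel"
      using lborel.borel_measurable_nn_integral[of "\<lambda>x z. (k x z)\<^sup>2 * ?I a (2 * \<delta>) z" borel]
        kp by (simp add: split_beta' measurable_lborel1)
    show ?thesis unfolding X_def by measurable
  qed
  \<comment> \<open>The cube around \<open>x\<close> lies in the doubled cube around
    \<open>a\<close>, so \<open>x\<close> and \<open>z\<close> range over one common cube and
    \<open>A2_kube\<close> applies there to the kernel.\<close>
  have ptw: "(kavg G \<delta> x)\<^sup>2 * ?I a \<delta> x \<le> ennreal (1 / \<delta>^4) * (X a x * \<Gamma> a)" for a x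
  proof (cases "x \<in> kube a \<delta>")
    case True
    have sub: "kube x \<delta> \<subseteq> kube a (2 * \<delta>)" and x2: "x \<in> kube a (2 * \<delta>)"
      using kube_trans[OF _ True, of _ \<delta>] kube_mono[of \<delta> "2 * \<delta>" a] True \<delta> by auto
    have "(\<integral>\<^sup>+z. ennreal (norm (msqrt (V x) ** G z)) * ?I x \<delta> z \<partial>lborel)
        \<le> (\<integral>\<^sup>+z. (k x z * ?I a (2 * \<delta>) z) * (g z * ?I a (2 * \<delta>) z) \<partial>lborel)"
    proof (rule nn_integral_mono)
      fix z
      have "ennreal (norm (msqrt (V x) ** G z)) \<le> k x z * g z"
        unfolding k_def g_def using sqrt_ratio_mat[OF pd, of "V x" "G z" z]
        by (subst ennreal_mult[symmetric]) (auto intro!: ennreal_leI sqrt_ratio_nonneg)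
      then show "ennreal (norm (msqrt (V x) ** G z)) * ?I x \<delta> z
          \<le> (k x z * ?I a (2 * \<delta>) z) * (g z * ?I a (2 * \<delta>) z)"
        using sub by (auto simp: indicator_def)
    qed
    then have "(\<integral>\<^sup>+z. ennreal (norm (msqrt (V x) ** G z)) * ?I x \<delta> z \<partial>lborel)\<^sup>2
        \<le> (\<integral>\<^sup>+z. (k x z * ?I a (2 * \<delta>) z) * (g z * ?I a (2 * \<delta>) z) \<partial>lborel)\<^sup>2"
      by (rule power_mono) simp
    also have "\<dots> \<le> (\<integral>\<^sup>+z. (k x z * ?I a (2 * \<delta>) z)\<^sup>2 \<partial>lborel) * (\<integral>\<^sup>+z. (g z * ?I a (2 * \<delta>) z)\<^sup>2 \<partial>lborel)"
      by (rule Cauchy_Schwarz_nn_integral) measurable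
    also have "\<dots> = X a x * \<Gamma> a"
    proof -
      have ind2: "(c * ?I a r z)\<^sup>2 = c\<^sup>2 * ?I a r z" for c r z by (simp add: indicator_def)
      show ?thesis using x2 by (simp add: X_def \<Gamma>_def ind2)
    qed
    finally have "(\<integral>\<^sup>+z. ennreal (norm (msqrt (V x) ** G z)) * ?I x \<delta> z \<partial>lborel)\<^sup>2 \<le> X a x * \<Gamma> a" .
    then have "(ennreal (1 / \<delta>\<^sup>2))\<^sup>2 * (\<integral>\<^sup>+z. ennreal (norm (msqrt (V x) ** G z)) * ?I x \<delta> z \<partial>lborel)\<^sup>2
        \<le> (ennreal (1 / \<delta>\<^sup>2))\<^sup>2 * (X a x * \<Gamma> a)"
      by (rule mult_left_mono) simp
    then show ?thesis using True
      by (simp add: kavg_def power_mult_distrib ennreal_power power_divide flip: power_mult)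
  qed simp
  have int_x: "(\<integral>\<^sup>+x. (kavg G \<delta> x)\<^sup>2 * ?I a \<delta> x \<partial>lborel) \<le> ennreal 256 * A2_char V * \<Gamma> a" for a
  proof -
    have k2: "(k x z)\<^sup>2 = ennreal ((sqrt_ratio (V x) (V z))\<^sup>2)" for x z
      by (simp add: k_def ennreal_power sqrt_ratio_nonneg)
    have "(\<integral>\<^sup>+x. (kavg G \<delta> x)\<^sup>2 * ?I a \<delta> x \<partial>lborel) \<le> (\<integral>\<^sup>+x. ennreal (1 / \<delta>^4) * (X a x * \<Gamma> a) \<partial>lborel)"
      by (rule nn_integral_mono) (rule ptw)
    also have "\<dots> = ennreal (1 / \<delta>^4) * ((\<integral>\<^sup>+x. X a x \<partial>lborel) * \<Gamma> a)"
      by (simp add: nn_integral_cmult nn_integral_multc)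
    also have "\<dots> \<le> ennreal (1 / \<delta>^4) * ((ennreal (16 * (2 * \<delta>)^4) * A2_char V) * \<Gamma> a)"
      using A2_kube[of "2 * \<delta>" V a] \<delta> unfolding X_def k2
      by (intro mult_left_mono mult_right_mono) auto
    also have "\<dots> = ennreal (1 / \<delta>^4 * (16 * (2 * \<delta>)^4)) * A2_char V * \<Gamma> a"
      using \<delta> by (subst ennreal_mult) (auto simp: mult_ac)
    also have "1 / \<delta>^4 * (16 * (2 * \<delta>)^4) = 256" using \<delta> by (simp add: power_mult_distrib)
    finally show ?thesis .
  qed
  have swap: "(\<integral>\<^sup>+a. \<integral>\<^sup>+x. F x * ?I a r x \<partial>lborel \<partial>lborel) = ennreal (4 * r\<^sup>2) * (\<integral>\<^sup>+x. F x \<partial>lborel)"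
    if r: "0 \<le> r" and [measurable]: "F \<in> borel_measurable borel" for r and F :: "real^2 \<Rightarrow> ennreal"
  proof -
    have "(\<integral>\<^sup>+a. \<integral>\<^sup>+x. F x * ?I a r x \<partial>lborel \<partial>lborel) = (\<integral>\<^sup>+x. \<integral>\<^sup>+a. F x * ?I a r x \<partial>lborel \<partial>lborel)"
      by (rule lborel_pair.Fubini') measurable
    also have "\<dots> = (\<integral>\<^sup>+x. F x * (\<integral>\<^sup>+a. ?I x r a \<partial>lborel) \<partial>lborel)"
    proof (rule nn_integral_cong)
      fix x
      have "?I a r x = ?I x r a" for a by (simp add: indicator_def kube_sym[of x])
      then show "(\<integral>\<^sup>+a. F x * ?I a r x \<partial>lborel) = F x * (\<integral>\<^sup>+a. ?I x r a \<partial>lborel)"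
        by (simp add: nn_integral_cmult)
    qed
    also have "\<dots> = ennreal (4 * r\<^sup>2) * (\<integral>\<^sup>+x. F x \<partial>lborel)"
      using emeasure_kube[OF r] by (simp add: nn_integral_multc mult.commute)
    finally show ?thesis .
  qed
  \<comment> \<open>Averaging over the centre \<open>a\<close> gives each point the weight
    \<open>4 * \<delta>^2\<close> on the left and \<open>16 * \<delta>^2\<close> on the right; their
    quotient 4 times 256 is the constant 1024.\<close>
  have "ennreal (4 * \<delta>\<^sup>2) * (\<integral>\<^sup>+x. (kavg G \<delta> x)\<^sup>2 \<partial>lborel)
      = (\<integral>\<^sup>+a. \<integral>\<^sup>+x. (kavg G \<delta> x)\<^sup>2 * ?I a \<delta> x \<partial>lborel \<partial>lborel)"
    using \<delta> by (subst swap) auto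
  also have "\<dots> \<le> (\<integral>\<^sup>+a. ennreal 256 * A2_char V * \<Gamma> a \<partial>lborel)"
    by (rule nn_integral_mono) (rule int_x)
  also have "\<dots> = ennreal 256 * A2_char V * (\<integral>\<^sup>+a. \<Gamma> a \<partial>lborel)"
    unfolding \<Gamma>_def by (rule nn_integral_cmult) measurable
  also have "(\<integral>\<^sup>+a. \<Gamma> a \<partial>lborel) = ennreal (4 * (2 * \<delta>)\<^sup>2) * (\<integral>\<^sup>+z. (g z)\<^sup>2 \<partial>lborel)"
    unfolding \<Gamma>_def using \<delta> by (subst swap) auto
  also have "ennreal 256 * A2_char V * (ennreal (4 * (2 * \<delta>)\<^sup>2) * (\<integral>\<^sup>+z. (g z)\<^sup>2 \<partial>lborel))
      = ennreal (4 * \<delta>\<^sup>2) * (ennreal 1024 * A2_char V * (\<integral>\<^sup>+z. (g z)\<^sup>2 \<partial>lborel))"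
  proof -
    have "ennreal 256 * ennreal (4 * (2 * \<delta>)\<^sup>2) = ennreal (4 * \<delta>\<^sup>2) * ennreal 1024"
      by (subst (1 2) ennreal_mult[symmetric]) (auto simp: power_mult_distrib)
    then have "(ennreal 256 * ennreal (4 * (2 * \<delta>)\<^sup>2)) * (A2_char V * (\<integral>\<^sup>+z. (g z)\<^sup>2 \<partial>lborel))
      = (ennreal (4 * \<delta>\<^sup>2) * ennreal 1024) * (A2_char V * (\<integral>\<^sup>+z. (g z)\<^sup>2 \<partial>lborel))" by (simp only:)
    then show ?thesis by (simp only: mult_ac)
  qed
  finally show ?thesis
    using \<delta> by (subst (asm) ennreal_mult_le_mult_iff) (auto simp: g_def)
qed

end


lemma nn_integral_Ioc_sq:
  fixes f :: "real \<Rightarrow> ennreal"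
  assumes [measurable]: "f \<in> borel_measurable borel"
  shows "(\<integral>\<^sup>+t. f t * indicator {0<..1} t \<partial>lborel)\<^sup>2 \<le> (\<integral>\<^sup>+t. (f t)\<^sup>2 * indicator {0<..1} t \<partial>lborel)"
proof -
  have eqs: "f t * indicator {0<..1} t = (f t * indicator {0<..1} t) * indicator {0<..1} t"
     "(f t * indicator {0<..1} t)\<^sup>2 = (f t)\<^sup>2 * indicator {0<..1} t"
     "(indicator {0<..1} t)\<^sup>2 = (indicator {0<..1} t :: ennreal)" for t
    by (auto simp: indicator_def)
  have "(\<integral>\<^sup>+t. (f t * indicator {0<..1} t) * indicator {0<..1} t \<partial>lborel)\<^sup>2
      \<le> (\<integral>\<^sup>+t. (f t * indicator {0<..1} t)\<^sup>2 \<partial>lborel) * (\<integral>\<^sup>+t. (indicator {0<..1::real} t)\<^sup>2 \<partial>lborel)"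
    by (rule Cauchy_Schwarz_nn_integral) measurable
  then show ?thesis unfolding eqs(2,3) eqs(1)[symmetric] by simp
qed

lemma dist_kube_le:
  assumes "x \<in> kube a r" "y \<in> kube a r"
  shows "norm (y - x) \<le> 4 * r"
proof -
  have "y \<in> kube x (r + r)" using kube_trans[of y a r x r] assms by (simp add: kube_sym[of a])
  then show ?thesis using kube_subset_cball[of x "r + r"] by (auto simp: dist_norm norm_minus_commute)
qed

context A2_kernel
begin

text \<open>The integral of the gradient over segments stays split by the dilation factor
  \<open>t\<close> and is not collapsed into a Riesz potential. At scale
  \<open>2 * \<rho> * t\<close> the bound of \<open>kavg_L2\<close> does not depend on
  \<open>t\<close>, so Cauchy--Schwarz over the unit interval loses nothing and the characteristic
  enters to the first power.\<close>

lemma poincare: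
  fixes v :: "real^2 \<Rightarrow> complex^'n"
  assumes v: "Ck (Suc 0) \<Omega> v" and Q: "kube a \<rho> \<subseteq> \<Omega>" and \<rho>: "0 < \<rho>"
  defines "c \<equiv> (1 / (4 * \<rho>\<^sup>2)) *\<^sub>R (\<integral>y. indicator (kube a \<rho>) y *\<^sub>R v y \<partial>lborel)"
  shows "(\<integral>\<^sup>+x. ennreal ((norm (msqrt (V x) *v (v x - c)))\<^sup>2) * indicator (kube a \<rho>) x \<partial>lborel)
     \<le> ennreal (16384 * \<rho>\<^sup>2) * A2_char V *
       (\<integral>\<^sup>+z. ennreal ((norm (msqrt (V z) ** Dmat v z))\<^sup>2) * indicator (kube a \<rho>) z \<partial>lborel)"
proof -
  let ?Q = "kube a \<rho>"
  let ?J = "\<lambda>t. indicator {0<..1::real} t :: ennreal"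
  \<comment> \<open>Cutting off outside the cube keeps the right-hand side on the same cube,
    although the averages around its points reach beyond it. By convexity the segments never see the
    cut.\<close>
  define G where "G z = indicator ?Q z *\<^sub>R Dmat v z" for z
  have G [measurable]: "G \<in> borel_measurable borel"
    unfolding G_def using continuous_on_indicator_borel[OF Ck_1_continuous_Dmat[OF v] Q] by simp
  have vc: "continuous_on ?Q v" using Ck_1_continuous[OF v] Q continuous_on_subset by blast
  have vint: "integrable lborel (\<lambda>y. indicator ?Q y *\<^sub>R v y)"
    by (rule borel_integrable_compact[OF compact_kube vc])
  have cint: "integrable lborel (\<lambda>y. indicator ?Q y *\<^sub>R (w::complex^'n))" for w
    by (rule borel_integrable_compact[OF compact_kube]) simp
  have mQ: "measure lborel ?Q = 4 * \<rho>\<^sup>2" using emeasure_kube[of \<rho> a] \<rho> by (simp add: measure_def)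
  have ptw: "ennreal (norm (msqrt (V x) *v (v x - c))) \<le> ennreal (4 * \<rho>) * (\<integral>\<^sup>+t. kavg G (2 * \<rho> * t) x * ?J t \<partial>lborel)"
    if x: "x \<in> ?Q" for x
  proof -
    let ?S = "msqrt (V x)"
    define H where "H z = ennreal (norm (?S ** G z))" for z
    have [measurable]: "H \<in> borel_measurable borel" unfolding H_def by measurable
    let ?h = "\<lambda>y t. ennreal (4 * \<rho>) * (indicator ?Q y * (H (x + t *\<^sub>R (y - x)) * ?J t))"
    have "(\<integral>y. indicator ?Q y *\<^sub>R (v x - v y) \<partial>lborel) = (4 * \<rho>\<^sup>2) *\<^sub>R (v x - c)"
    proof -
      have "(\<integral>y. indicator ?Q y *\<^sub>R (v x - v y) \<partial>lborel)
          = (\<integral>y. indicator ?Q y *\<^sub>R v x \<partial>lborel) - (\<integral>y. indicator ?Q y *\<^sub>R v y \<partial>lborel)"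
        using Bochner_Integration.integral_diff[OF cint vint] by (simp add: scaleR_diff_right)
      also have "(\<integral>y. indicator ?Q y *\<^sub>R v x \<partial>lborel) = (4 * \<rho>\<^sup>2) *\<^sub>R v x"
        using mQ emeasure_kube[of \<rho> a] \<rho> by simp
      also have "(\<integral>y. indicator ?Q y *\<^sub>R v y \<partial>lborel) = (4 * \<rho>\<^sup>2) *\<^sub>R c"
        using \<rho> by (simp add: c_def)
      finally show ?thesis by (simp add: scaleR_diff_right)
    qed
    moreover have vint2: "integrable lborel (\<lambda>y. indicator ?Q y *\<^sub>R (v x - v y))"
      by (rule borel_integrable_compact[OF compact_kube]) (intro continuous_intros vc)
    ultimately have "(4 * \<rho>\<^sup>2) *\<^sub>R (?S *v (v x - c)) = (\<integral>y. ?S *v (indicator ?Q y *\<^sub>R (v x - v y)) \<partial>lborel)"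
      using integral_bounded_linear[OF bounded_linear_mult_vec[of ?S] vint2]
        linear_scale[OF matrix_vector_mul_linear[of ?S]] by simp
    then have "ennreal (norm ((4 * \<rho>\<^sup>2) *\<^sub>R (?S *v (v x - c))))
        \<le> (\<integral>\<^sup>+y. ennreal (norm (?S *v (indicator ?Q y *\<^sub>R (v x - v y)))) \<partial>lborel)"
      by (simp only:) (rule integral_norm_bound_ennreal integrable_bounded_linear[OF bounded_linear_mult_vec vint2])+
    also have "\<dots> \<le> (\<integral>\<^sup>+y. \<integral>\<^sup>+t. ?h y t \<partial>lborel \<partial>lborel)"
    proof (rule nn_integral_mono)
      fix y
      show "ennreal (norm (?S *v (indicator ?Q y *\<^sub>R (v x - v y))))
         \<le> (\<integral>\<^sup>+t. ?h y t \<partial>lborel)"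
      proof (cases "y \<in> ?Q")
        case True
        have seg: "x + t *\<^sub>R (y - x) \<in> ?Q" if "t \<in> {0..1}" for t
          using convexD_alt[OF convex_kube x True, of t] that by (simp add: algebra_simps)
        have "ennreal (norm (?S *v (v x - v y))) = ennreal (norm ((\<lambda>x. ?S *v v x) y - (\<lambda>x. ?S *v v x) x))"
          by (simp add: matrix_vector_mult_diff_distrib norm_minus_commute)
        also have "\<dots> \<le> (\<integral>\<^sup>+t\<in>{0<..1}. ennreal (norm (Dmat (\<lambda>x. ?S *v v x) (x + t *\<^sub>R (y - x))) * norm (y - x)) \<partial>lborel)"
          using seg Q by (intro norm_diff_le_nn_integral_Dmat[OF Ck_1_matrix_mult(1)[OF v]]) auto
        also have "\<dots> \<le> (\<integral>\<^sup>+t. ?h y t \<partial>lborel)"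
        proof (rule nn_integral_mono)
          fix t :: real
          show "ennreal (norm (Dmat (\<lambda>x. ?S *v v x) (x + t *\<^sub>R (y - x))) * norm (y - x)) * ?J t
             \<le> ?h y t"
          proof (cases "t \<in> {0<..1}")
            case t: True
            then have z: "x + t *\<^sub>R (y - x) \<in> ?Q" using seg by auto
            then have "Dmat (\<lambda>x. ?S *v v x) (x + t *\<^sub>R (y - x)) = ?S ** G (x + t *\<^sub>R (y - x))"
              using Ck_1_matrix_mult(2)[OF v] Q by (auto simp: G_def)
            then have "ennreal (norm (Dmat (\<lambda>x. ?S *v v x) (x + t *\<^sub>R (y - x))) * norm (y - x))
               \<le> ennreal (4 * \<rho> * norm (?S ** G (x + t *\<^sub>R (y - x))))"
              using dist_kube_le[OF x True] by (intro ennreal_leI) (simp add: mult.commute mult_right_mono)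
            then show ?thesis using t True \<rho> by (simp add: H_def ennreal_mult)
          qed simp
        qed
        finally show ?thesis using True by simp
      qed simp
    qed
    also have "\<dots> = (\<integral>\<^sup>+t. \<integral>\<^sup>+y. ?h y t \<partial>lborel \<partial>lborel)"
      by (rule lborel_pair.Fubini') measurable
    also have "\<dots> = ennreal (4 * \<rho>) * (\<integral>\<^sup>+t. (\<integral>\<^sup>+y. indicator ?Q y * H (x + t *\<^sub>R (y - x)) \<partial>lborel) * ?J t \<partial>lborel)"
    proof -
      have "(\<integral>\<^sup>+y. ?h y t \<partial>lborel)
          = ennreal (4 * \<rho>) * ((\<integral>\<^sup>+y. indicator ?Q y * H (x + t *\<^sub>R (y - x)) \<partial>lborel) * ?J t)" for t
        by (simp add: nn_integral_cmult) (simp add: nn_integral_multc mult.assoc[symmetric])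
      then show ?thesis by (simp add: nn_integral_cmult)
    qed
    also have "\<dots> \<le> ennreal (4 * \<rho>) * (\<integral>\<^sup>+t. (ennreal (4 * \<rho>\<^sup>2) * kavg G (2 * \<rho> * t) x) * ?J t \<partial>lborel)"
    proof (intro mult_left_mono nn_integral_mono)
      fix t :: real
      show "(\<integral>\<^sup>+y. indicator ?Q y * H (x + t *\<^sub>R (y - x)) \<partial>lborel) * ?J t
          \<le> (ennreal (4 * \<rho>\<^sup>2) * kavg G (2 * \<rho> * t) x) * ?J t"
      proof (cases "t \<in> {0<..1}")
        case t: True
        \<comment> \<open>For fixed \<open>t\<close> the substitution z = (1 - t) x + t y has
          Jacobian \<open>t^2\<close> and maps the cube into the cube of half-side
          \<open>2 * \<rho> * t\<close> around \<open>x\<close>. Up to \<open>4 * \<rho>^2\<close>,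
          the factor \<open>1 / t^2\<close> is the normalisation of \<open>kavg\<close>.\<close>
        let ?K = "\<lambda>z. H z * indicator (kube x (2 * \<rho> * t)) z"
        have "(\<integral>\<^sup>+y. indicator ?Q y * H (x + t *\<^sub>R (y - x)) \<partial>lborel) \<le> (\<integral>\<^sup>+y. ?K ((1 - t) *\<^sub>R x + t *\<^sub>R y) \<partial>lborel)"
        proof (rule nn_integral_mono)
          fix y
          have e: "(1 - t) *\<^sub>R x + t *\<^sub>R y = x + t *\<^sub>R (y - x)" by (simp add: algebra_simps)
          have "x + t *\<^sub>R (y - x) \<in> kube x (2 * \<rho> * t)" if "y \<in> ?Q"
          proof -
            have "y \<in> kube x (\<rho> + \<rho>)" using kube_trans[of y a \<rho> x \<rho>] that x by (simp add: kube_sym[of a])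
            then show ?thesis using t by (simp add: mem_kube abs_mult)
          qed
          then show "indicator ?Q y * H (x + t *\<^sub>R (y - x)) \<le> ?K ((1 - t) *\<^sub>R x + t *\<^sub>R y)"
            unfolding e by (auto simp: indicator_def)
        qed
        also have "\<dots> = ennreal (1 / t\<^sup>2) * (\<integral>\<^sup>+z. ?K z \<partial>lborel)"
          using t by (subst nn_integral_lborel_affine) auto
        also have "1 / t\<^sup>2 = (4 * \<rho>\<^sup>2) * (1 / (2 * \<rho> * t)\<^sup>2)"
          using \<rho> t by (simp add: power_mult_distrib)
        also have "ennreal \<dots> * (\<integral>\<^sup>+z. ?K z \<partial>lborel) = ennreal (4 * \<rho>\<^sup>2) * kavg G (2 * \<rho> * t) x"
          unfolding kavg_def H_def by (subst ennreal_mult) (auto simp: mult.assoc)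
        finally show ?thesis using t by simp
      qed simp
    qed simp
    also have "\<dots> = ennreal (4 * \<rho>\<^sup>2) * (ennreal (4 * \<rho>) * (\<integral>\<^sup>+t. kavg G (2 * \<rho> * t) x * ?J t \<partial>lborel))"
    proof -
      have [measurable]: "(\<lambda>t. kavg G (2 * \<rho> * t) x) \<in> borel_measurable borel"
        unfolding kavg_def by measurable
      have "(\<integral>\<^sup>+t. ennreal (4 * \<rho>\<^sup>2) * (kavg G (2 * \<rho> * t) x * ?J t) \<partial>lborel)
          = ennreal (4 * \<rho>\<^sup>2) * (\<integral>\<^sup>+t. kavg G (2 * \<rho> * t) x * ?J t \<partial>lborel)"
        by (rule nn_integral_cmult) measurable
      then show ?thesis by (simp only: mult.assoc mult.left_commute[of "ennreal (4 * \<rho>)"])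
    qed
    finally have "ennreal (4 * \<rho>\<^sup>2) * ennreal (norm (?S *v (v x - c)))
        \<le> ennreal (4 * \<rho>\<^sup>2) * (ennreal (4 * \<rho>) * (\<integral>\<^sup>+t. kavg G (2 * \<rho> * t) x * ?J t \<partial>lborel))"
      by (simp add: ennreal_mult)
    then show ?thesis using \<rho> by (subst (asm) ennreal_mult_le_mult_iff) auto
  qed
  have km [measurable]: "(\<lambda>p. kavg G (2 * \<rho> * snd p) (fst p)) \<in> borel_measurable (borel \<Otimes>\<^sub>M borel)"
    unfolding kavg_def by measurable
  have km1 [measurable]: "(\<lambda>t. kavg G (2 * \<rho> * t) x) \<in> borel_measurable borel" for x
    unfolding kavg_def by measurable
  define g where "g = (\<integral>\<^sup>+z. (ennreal (norm (msqrt (V z) ** G z)))\<^sup>2 \<partial>lborel)"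
  have "(\<integral>\<^sup>+x. ennreal ((norm (msqrt (V x) *v (v x - c)))\<^sup>2) * indicator ?Q x \<partial>lborel)
     \<le> (\<integral>\<^sup>+x. ennreal (16 * \<rho>\<^sup>2) * (\<integral>\<^sup>+t. (kavg G (2 * \<rho> * t) x)\<^sup>2 * ?J t \<partial>lborel) \<partial>lborel)"
  proof (rule nn_integral_mono)
    fix x
    show "ennreal ((norm (msqrt (V x) *v (v x - c)))\<^sup>2) * indicator ?Q x
       \<le> ennreal (16 * \<rho>\<^sup>2) * (\<integral>\<^sup>+t. (kavg G (2 * \<rho> * t) x)\<^sup>2 * ?J t \<partial>lborel)"
    proof (cases "x \<in> ?Q")
      case True
      have "ennreal ((norm (msqrt (V x) *v (v x - c)))\<^sup>2) = (ennreal (norm (msqrt (V x) *v (v x - c))))\<^sup>2"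
        by (simp add: ennreal_power)
      also have "\<dots> \<le> (ennreal (4 * \<rho>) * (\<integral>\<^sup>+t. kavg G (2 * \<rho> * t) x * ?J t \<partial>lborel))\<^sup>2"
        by (intro power_mono ptw True) simp
      also have "\<dots> = ennreal (16 * \<rho>\<^sup>2) * (\<integral>\<^sup>+t. kavg G (2 * \<rho> * t) x * ?J t \<partial>lborel)\<^sup>2"
        using \<rho> by (simp add: power_mult_distrib ennreal_power)
      also have "\<dots> \<le> ennreal (16 * \<rho>\<^sup>2) * (\<integral>\<^sup>+t. (kavg G (2 * \<rho> * t) x)\<^sup>2 * ?J t \<partial>lborel)"
        by (intro mult_left_mono nn_integral_Ioc_sq) auto
      finally show ?thesis using True by simp
    qed simp
  qed
  also have "\<dots> = ennreal (16 * \<rho>\<^sup>2) * (\<integral>\<^sup>+x. \<integral>\<^sup>+t. (kavg G (2 * \<rho> * t) x)\<^sup>2 * ?J t \<partial>lborel \<partial>lborel)"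
    by (rule nn_integral_cmult) measurable
  also have "(\<integral>\<^sup>+x. \<integral>\<^sup>+t. (kavg G (2 * \<rho> * t) x)\<^sup>2 * ?J t \<partial>lborel \<partial>lborel)
      = (\<integral>\<^sup>+t. \<integral>\<^sup>+x. (kavg G (2 * \<rho> * t) x)\<^sup>2 * ?J t \<partial>lborel \<partial>lborel)"
    by (rule lborel_pair.Fubini'[symmetric]) measurable
  also have "\<dots> = (\<integral>\<^sup>+t. (\<integral>\<^sup>+x. (kavg G (2 * \<rho> * t) x)\<^sup>2 \<partial>lborel) * ?J t \<partial>lborel)"
    by (intro nn_integral_cong nn_integral_multc) measurable
  also have "\<dots> \<le> (\<integral>\<^sup>+t. (ennreal 1024 * A2_char V * g) * ?J t \<partial>lborel)"
  proof (rule nn_integral_mono)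
    fix t :: real
    show "(\<integral>\<^sup>+x. (kavg G (2 * \<rho> * t) x)\<^sup>2 \<partial>lborel) * ?J t \<le> (ennreal 1024 * A2_char V * g) * ?J t"
      using kavg_L2[OF G, of "2 * \<rho> * t"] \<rho> unfolding g_def by (cases "t \<in> {0<..1}") auto
  qed
  also have "\<dots> = ennreal 1024 * A2_char V * g" by (simp add: nn_integral_cmult)
  also have "g = (\<integral>\<^sup>+z. ennreal ((norm (msqrt (V z) ** Dmat v z))\<^sup>2) * indicator ?Q z \<partial>lborel)"
    unfolding g_def G_def
    by (intro nn_integral_cong) (auto simp: indicator_def ennreal_power matrix_matrix_mult_def vec_eq_iff[symmetric] zero_vec_def[symmetric])
  finally have le: "(\<integral>\<^sup>+x. ennreal ((norm (msqrt (V x) *v (v x - c)))\<^sup>2) * indicator ?Q x \<partial>lborel)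
    \<le> ennreal (16 * \<rho>\<^sup>2) * (ennreal 1024 * A2_char V *
       (\<integral>\<^sup>+z. ennreal ((norm (msqrt (V z) ** Dmat v z))\<^sup>2) * indicator ?Q z \<partial>lborel))"
    by (simp only: mult_left_mono zero_le)
  \<comment> \<open>\<open>16 * \<rho>^2\<close> is the square of the bound
    \<open>4 * \<rho>\<close> for the length of the segments, and 1024 comes from
    \<open>kavg_L2\<close>.\<close>
  have "ennreal (16384 * \<rho>\<^sup>2) = ennreal (16 * \<rho>\<^sup>2) * ennreal 1024"
    by (subst ennreal_mult[symmetric]) auto
  then show ?thesis using le by (simp only: mult.assoc)
qed

end

section \<open>Averages over balls\<close>

lemma integral_lborel_affine:
  fixes f :: "'a::euclidean_space \<Rightarrow> 'b::{banach, second_countable_topology}"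
  assumes [measurable]: "f \<in> borel_measurable borel" and c: "0 < c"
  shows "(\<integral>y. f (t + c *\<^sub>R y) \<partial>lborel) = (1 / c ^ DIM('a)) *\<^sub>R (\<integral>z. f z \<partial>lborel)"
proof -
  have "(\<integral>z. f z \<partial>lborel) = (c ^ DIM('a)) *\<^sub>R (\<integral>y. f (t + c *\<^sub>R y) \<partial>lborel)"
    using c by (subst lborel_affine[of c t]) (auto simp: integral_density integral_distr)
  then show ?thesis using c by simp
qed

lemma integral_lebesgue_on_eq_lborel:
  fixes f :: "'a::euclidean_space \<Rightarrow> 'b::{banach, second_countable_topology}"
  assumes "B \<in> sets borel" "(\<lambda>x. indicator B x *\<^sub>R f x) \<in> borel_measurable borel"
  shows "(\<integral>x. f x \<partial>lebesgue_on B) = (\<integral>x. indicator B x *\<^sub>R f x \<partial>lborel)"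
proof -
  have "(\<integral>x. f x \<partial>lebesgue_on B) = (\<integral>x. indicator B x *\<^sub>R f x \<partial>lebesgue)"
    by (rule integral_restrict_space) (use assms in auto)
  also have "\<dots> = (\<integral>x. indicator B x *\<^sub>R f x \<partial>lborel)"
    using assms(2) by (intro integral_completion) simp
  finally show ?thesis .
qed

text \<open>The expression under the limit in \<open>rep\<close>, named so that centre and radius
  can vary.\<close>

definition bavg :: "(real^2 \<Rightarrow> complex^'n) \<Rightarrow> real^2 \<Rightarrow> real \<Rightarrow> complex^'n" where
  "bavg u a r = (1 / measure lebesgue (ball a r)) *\<^sub>R (\<integral>z. u z \<partial>lebesgue_on (ball a r))"

lemma measure_ball_2: "0 \<le> r \<Longrightarrow> measure lebesgue (ball (a::real^2) r) = pi * r\<^sup>2"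
  using content_ball[of r a] by (simp add: unit_ball_vol_2)

lemma bavg_unit_ball:
  fixes v :: "real^2 \<Rightarrow> complex^'n"
  assumes v: "continuous_on (ball a r) v" and r: "0 < r"
  shows "bavg v a r = (1 / pi) *\<^sub>R (\<integral>w. indicator (ball 0 1) w *\<^sub>R v (a + r *\<^sub>R w) \<partial>lborel)"
proof -
  let ?f = "\<lambda>z. indicator (ball a r) z *\<^sub>R v z"
  have [measurable]: "?f \<in> borel_measurable borel"
    by (rule continuous_on_indicator_borel[OF v]) auto
  have mem: "a + r *\<^sub>R w \<in> ball a r \<longleftrightarrow> w \<in> ball 0 1" for w
    using r by (simp add: dist_norm)
  have "(\<integral>w. ?f (a + r *\<^sub>R w) \<partial>lborel) = (1 / r\<^sup>2) *\<^sub>R (\<integral>z. ?f z \<partial>lborel)"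
    using integral_lborel_affine[of ?f r a] r by simp
  moreover have "?f (a + r *\<^sub>R w) = indicator (ball 0 1) w *\<^sub>R v (a + r *\<^sub>R w)" for w
    unfolding indicator_def mem by simp
  ultimately show ?thesis
    using r measure_ball_2[of r a] by (simp add: bavg_def integral_lebesgue_on_eq_lborel)
qed

text \<open>Both means are pulled back to the unit ball, and corresponding points are joined by
  segments. At time \<open>t\<close> these points fill a ball inside \<open>ball c \<sigma>\<close>
  with interpolated centre and radius. Its radius is at least \<open>\<sigma> / 2\<close>, so the
  Jacobian costs at most \<open>4 / \<sigma>^2\<close>. One estimate thus covers a change of radius
  and a change of centre.\<close>

lemma bavg_diff_smooth:
  fixes v :: "real^2 \<Rightarrow> complex^'n"
  assumes v: "Ck (Suc 0) \<Omega> v" and B: "cball c \<sigma> \<subseteq> \<Omega>" and \<sigma>: "0 < \<sigma>"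
    and r: "\<sigma> / 2 \<le> r" "dist a c + r \<le> \<sigma>" and r': "\<sigma> / 2 \<le> r'" "dist a' c + r' \<le> \<sigma>"
  shows "ennreal (norm (bavg v a r - bavg v a' r'))
    \<le> ennreal ((dist a a' + \<bar>r - r'\<bar>) * (4 / (pi * \<sigma>\<^sup>2))) * (\<integral>\<^sup>+z\<in>ball c \<sigma>. ennreal (norm (Dmat v z)) \<partial>lborel)"
proof -
  let ?D = "dist a a' + \<bar>r - r'\<bar>"
  let ?U = "ball 0 1 :: (real^2) set"
  let ?z = "\<lambda>t w. (a' + t *\<^sub>R (a - a')) + (r' + t * (r - r')) *\<^sub>R w"
  let ?f = "\<lambda>w. indicator ?U w *\<^sub>R v (a + r *\<^sub>R w) - indicator ?U w *\<^sub>R v (a' + r' *\<^sub>R w)"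
  let ?J = "\<lambda>t. indicator {0<..1::real} t :: ennreal"
  define H where "H z = ennreal (norm (indicator (ball c \<sigma>) z *\<^sub>R Dmat v z))" for z
  have sub: "ball c \<sigma> \<subseteq> \<Omega>" using B ball_subset_cball by blast
  have "(\<lambda>z. indicator (ball c \<sigma>) z *\<^sub>R Dmat v z) \<in> borel_measurable borel"
    by (rule continuous_on_indicator_borel[OF Ck_1_continuous_Dmat[OF v] sub]) simp
  then have [measurable]: "H \<in> borel_measurable borel" unfolding H_def by measurable
  have pos: "0 < r" "0 < r'" using r r' \<sigma> by auto
  have cb: "p + s *\<^sub>R w \<in> cball c \<sigma>" "w \<in> ?U \<Longrightarrow> p + s *\<^sub>R w \<in> ball c \<sigma>"
    if "dist p c + s \<le> \<sigma>" "0 < s" "w \<in> cball 0 1" for p s w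
  proof -
    have "dist c (p + s *\<^sub>R w) \<le> dist p c + s * norm w"
      using norm_triangle_ineq4[of "c - p" "s *\<^sub>R w"] that(2) by (simp add: dist_norm norm_minus_commute algebra_simps)
    moreover have "s * norm w \<le> s * 1" using that by (intro mult_left_mono) auto
    moreover have "w \<in> ?U \<Longrightarrow> s * norm w < s * 1" using that by (intro mult_strict_left_mono) auto
    ultimately show "p + s *\<^sub>R w \<in> cball c \<sigma>" "w \<in> ?U \<Longrightarrow> p + s *\<^sub>R w \<in> ball c \<sigma>"
      using that(1) by auto
  qed
  have integ: "integrable lborel (\<lambda>w. indicator ?U w *\<^sub>R v (p + s *\<^sub>R w))" if "dist p c + s \<le> \<sigma>" "0 < s" for p s
  proof -
    have "continuous_on (cball 0 1) (\<lambda>w. v (p + s *\<^sub>R w))"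
      by (rule continuous_on_compose2[OF Ck_1_continuous[OF v]])
        (use cb(1)[OF that] B in \<open>auto intro!: continuous_intros\<close>)
    then have "integrable lborel (\<lambda>w. indicator (cball 0 1) w *\<^sub>R v (p + s *\<^sub>R w))"
      by (intro borel_integrable_compact) auto
    then have "integrable lborel (\<lambda>w. indicator ?U w *\<^sub>R (indicator (cball 0 1) w *\<^sub>R v (p + s *\<^sub>R w)))"
      by (rule integrable_mult_indicator[rotated]) simp
    moreover have "indicator ?U w *\<^sub>R (indicator (cball 0 1) w *\<^sub>R v (p + s *\<^sub>R w))
        = indicator ?U w *\<^sub>R v (p + s *\<^sub>R w)" for w
      by (auto simp: indicator_def)
    ultimately show ?thesis by (simp only:)
  qed
  have bv: "bavg v p s = (1 / pi) *\<^sub>R (\<integral>w. indicator ?U w *\<^sub>R v (p + s *\<^sub>R w) \<partial>lborel)" if "dist p c + s \<le> \<sigma>" "0 < s" for p s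
  proof (rule bavg_unit_ball[OF continuous_on_subset[OF Ck_1_continuous[OF v]] that(2)])
    show "ball p s \<subseteq> \<Omega>"
    proof
      fix z assume "z \<in> ball p s"
      then have "z \<in> ball c \<sigma>" using dist_triangle[of c z p] that(1) by (auto simp: dist_commute)
      then show "z \<in> \<Omega>" using sub by blast
    qed
  qed
  have "bavg v a r - bavg v a' r' = (1 / pi) *\<^sub>R (\<integral>w. ?f w \<partial>lborel)"
    using integ[OF r(2) pos(1)] integ[OF r'(2) pos(2)]
    by (simp add: bv[OF r(2) pos(1)] bv[OF r'(2) pos(2)] scaleR_diff_right)
  then have "ennreal (norm (bavg v a r - bavg v a' r'))
     = ennreal (1 / pi) * ennreal (norm (\<integral>w. ?f w \<partial>lborel))"
    by (simp add: ennreal_mult[symmetric])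
  also have "\<dots> \<le> ennreal (1 / pi) * (\<integral>\<^sup>+w. ennreal (norm (?f w)) \<partial>lborel)"
    by (intro mult_left_mono integral_norm_bound_ennreal Bochner_Integration.integrable_diff
        integ[OF r(2) pos(1)] integ[OF r'(2) pos(2)]) simp
  also have "(\<integral>\<^sup>+w. ennreal (norm (?f w)) \<partial>lborel)
     \<le> (\<integral>\<^sup>+w. \<integral>\<^sup>+t. ennreal ?D * (H (?z t w) * ?J t) \<partial>lborel \<partial>lborel)"
  proof (rule nn_integral_mono)
    fix w
    let ?p = "a' + r' *\<^sub>R w" and ?q = "a + r *\<^sub>R w"
    have pt: "?p + t *\<^sub>R (?q - ?p) = ?z t w" for t
      by (simp add: algebra_simps)
    show "ennreal (norm (indicator ?U w *\<^sub>R v ?q - indicator ?U w *\<^sub>R v ?p))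
       \<le> (\<integral>\<^sup>+t. ennreal ?D * (H (?z t w) * ?J t) \<partial>lborel)"
    proof (cases "w \<in> ?U")
      case True
      have "?p \<in> ball c \<sigma>" "?q \<in> ball c \<sigma>"
        using cb(2)[OF r(2) pos(1) _ True] cb(2)[OF r'(2) pos(2) _ True] True by auto
      then have seg: "?p + t *\<^sub>R (?q - ?p) \<in> ball c \<sigma>" if "t \<in> {0..1}" for t
        using convexD_alt[OF convex_ball, of ?p c \<sigma> ?q t] that by (simp add: algebra_simps)
      have "norm (?q - ?p) \<le> norm (a - a') + norm ((r - r') *\<^sub>R w)"
        using norm_triangle_ineq[of "a - a'" "(r - r') *\<^sub>R w"] by (simp add: algebra_simps)
      also have "\<dots> \<le> ?D" using True mult_left_mono[of "norm w" 1 "\<bar>r - r'\<bar>"] by (simp add: dist_norm)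
      finally have nD: "norm (?q - ?p) \<le> ?D" .
      have "ennreal (norm (v ?q - v ?p)) \<le> (\<integral>\<^sup>+t\<in>{0<..1}. ennreal (norm (Dmat v (?p + t *\<^sub>R (?q - ?p))) * norm (?q - ?p)) \<partial>lborel)"
        using seg sub by (intro norm_diff_le_nn_integral_Dmat[OF v]) auto
      also have "\<dots> \<le> (\<integral>\<^sup>+t. ennreal ?D * (H (?p + t *\<^sub>R (?q - ?p)) * ?J t) \<partial>lborel)"
      proof (rule nn_integral_mono)
        fix t
        show "ennreal (norm (Dmat v (?p + t *\<^sub>R (?q - ?p))) * norm (?q - ?p)) * ?J t
           \<le> ennreal ?D * (H (?p + t *\<^sub>R (?q - ?p)) * ?J t)"
        proof (cases "t \<in> {0<..1}")
          case t: True
          then have "H (?p + t *\<^sub>R (?q - ?p)) = ennreal (norm (Dmat v (?p + t *\<^sub>R (?q - ?p))))"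
            using seg[of t] by (simp add: H_def)
          moreover have "ennreal (norm (Dmat v (?p + t *\<^sub>R (?q - ?p))) * norm (?q - ?p))
              \<le> ennreal (?D * norm (Dmat v (?p + t *\<^sub>R (?q - ?p))))"
            using nD by (intro ennreal_leI) (simp add: mult.commute mult_right_mono)
          ultimately show ?thesis using t by (simp add: ennreal_mult)
        qed simp
      qed
      finally show ?thesis unfolding pt using True by simp
    qed simp
  qed
  also have "\<dots> = (\<integral>\<^sup>+t. \<integral>\<^sup>+w. ennreal ?D * (H (?z t w) * ?J t) \<partial>lborel \<partial>lborel)"
    by (rule lborel_pair.Fubini') measurable
  also have "\<dots> \<le> (\<integral>\<^sup>+t. (ennreal (?D * (4 / \<sigma>\<^sup>2)) * (\<integral>\<^sup>+z. H z \<partial>lborel)) * ?J t \<partial>lborel)"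
  proof (rule nn_integral_mono)
    fix t :: real
    show "(\<integral>\<^sup>+w. ennreal ?D * (H (?z t w) * ?J t) \<partial>lborel)
      \<le> (ennreal (?D * (4 / \<sigma>\<^sup>2)) * (\<integral>\<^sup>+z. H z \<partial>lborel)) * ?J t"
    proof (cases "t \<in> {0<..1}")
      case t: True
      define s where "s = r' + t * (r - r')"
      have "(1 - t) * (\<sigma> / 2) + t * (\<sigma> / 2) \<le> (1 - t) * r' + t * r"
        using r r' t by (intro add_mono mult_left_mono) auto
      then have s: "\<sigma> / 2 \<le> s" by (simp add: s_def field_simps)
      then have s0: "0 < s" using \<sigma> by simp
      have "(\<integral>\<^sup>+w. H ((a' + t *\<^sub>R (a - a')) + s *\<^sub>R w) \<partial>lborel) = ennreal (1 / s\<^sup>2) * (\<integral>\<^sup>+z. H z \<partial>lborel)"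
        using nn_integral_lborel_affine[of H s] s0 by simp
      also have "\<dots> \<le> ennreal (4 / \<sigma>\<^sup>2) * (\<integral>\<^sup>+z. H z \<partial>lborel)"
      proof (intro mult_right_mono ennreal_leI)
        have "(\<sigma> / 2)\<^sup>2 \<le> s\<^sup>2" using s \<sigma> by (intro power_mono) auto
        then have "1 / s\<^sup>2 \<le> 1 / (\<sigma> / 2)\<^sup>2" using \<sigma> s0 by (intro divide_left_mono) auto
        then show "1 / s\<^sup>2 \<le> 4 / \<sigma>\<^sup>2" by (simp add: power_divide)
      qed simp
      finally have "ennreal ?D * (\<integral>\<^sup>+w. H ((a' + t *\<^sub>R (a - a')) + s *\<^sub>R w) \<partial>lborel)
          \<le> ennreal ?D * (ennreal (4 / \<sigma>\<^sup>2) * (\<integral>\<^sup>+z. H z \<partial>lborel))"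
        by (rule mult_left_mono) simp
      then show ?thesis using t \<sigma> unfolding s_def[symmetric]
        by (subst ennreal_mult) (simp_all add: nn_integral_cmult mult.assoc)
    qed simp
  qed
  also have "\<dots> = ennreal (?D * (4 / \<sigma>\<^sup>2)) * (\<integral>\<^sup>+z. H z \<partial>lborel)"
    by (simp add: nn_integral_cmult)
  also have "(\<integral>\<^sup>+z. H z \<partial>lborel) = (\<integral>\<^sup>+z\<in>ball c \<sigma>. ennreal (norm (Dmat v z)) \<partial>lborel)"
    by (intro nn_integral_cong) (auto simp: H_def indicator_def)
  finally have le: "ennreal (norm (bavg v a r - bavg v a' r')) \<le> ennreal (1 / pi) *
      (ennreal (?D * (4 / \<sigma>\<^sup>2)) * (\<integral>\<^sup>+z\<in>ball c \<sigma>. ennreal (norm (Dmat v z)) \<partial>lborel))"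
    by (simp only: mult_left_mono zero_le)
  have "ennreal (?D * (4 / (pi * \<sigma>\<^sup>2))) = ennreal (1 / pi) * ennreal (?D * (4 / \<sigma>\<^sup>2))"
    by (subst ennreal_mult[symmetric]) auto
  then show ?thesis using le by (simp only: mult.assoc)
qed


section \<open>Smooth cutoffs\<close>

lemma Ck_cong:
  assumes "open S" "\<And>x. x \<in> S \<Longrightarrow> f x = g x" "Ck k S f"
  shows "Ck k S g"
proof (cases k)
  case 0
  then show ?thesis using assms by (simp cong: continuous_on_cong)
next
  case (Suc k')
  then obtain f' where f': "\<forall>x\<in>S. (f has_derivative f' x) (at x)" "\<forall>v. Ck k' S (\<lambda>x. f' x v)"
    using assms(3) by auto
  have "(g has_derivative f' x) (at x)" if "x \<in> S" for x
    using has_derivative_transform_within_open[OF bspec[OF f'(1) that] assms(1) that] assms(2) by auto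
  then show ?thesis using f'(2) Suc by auto
qed

lemma Ck_SucD: "Ck (Suc k) S f \<Longrightarrow> Ck k S f"
proof (induction k arbitrary: f)
  case 0
  then show ?case using Ck_1_continuous by simp
next
  case (Suc k)
  then obtain f' where "\<forall>x\<in>S. (f has_derivative f' x) (at x)" "\<forall>v. Ck (Suc k) S (\<lambda>x. f' x v)" by auto
  then show ?case using Suc.IH by auto
qed

lemma Ck_subset: "Ck k S f \<Longrightarrow> T \<subseteq> S \<Longrightarrow> Ck k T f"
proof (induction k arbitrary: f)
  case (Suc k)
  then obtain f' where "\<forall>x\<in>S. (f has_derivative f' x) (at x)" "\<forall>v. Ck k S (\<lambda>x. f' x v)" by auto
  then show ?case using Suc by (auto intro!: exI[of _ f'])
qed (auto intro: continuous_on_subset)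

lemma Ck_const: "Ck k S (\<lambda>x. c)"
proof (induction k arbitrary: c)
  case (Suc k)
  then show ?case by (auto intro!: exI[of _ "\<lambda>x v. 0"])
qed simp

lemma Ck_add: "Ck k S f \<Longrightarrow> Ck k S g \<Longrightarrow> Ck k S (\<lambda>x. f x + g x)"
proof (induction k arbitrary: f g)
  case (Suc k)
  then obtain f' g' where
    "\<forall>x\<in>S. (f has_derivative f' x) (at x)" "\<forall>v. Ck k S (\<lambda>x. f' x v)"
    "\<forall>x\<in>S. (g has_derivative g' x) (at x)" "\<forall>v. Ck k S (\<lambda>x. g' x v)" by auto
  then show ?case using Suc.IH
    by (auto intro!: exI[of _ "\<lambda>x v. f' x v + g' x v"] has_derivative_add)
qed (auto intro: continuous_on_add)

lemma Ck_scaleR: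
  fixes f :: "'a::real_normed_vector \<Rightarrow> real"
  shows "Ck k S f \<Longrightarrow> Ck k S g \<Longrightarrow> Ck k S (\<lambda>x. f x *\<^sub>R g x)"
proof (induction k arbitrary: f g)
  case (Suc k)
  then obtain f' g' where fg:
    "\<forall>x\<in>S. (f has_derivative f' x) (at x)" "\<forall>v. Ck k S (\<lambda>x. f' x v)"
    "\<forall>x\<in>S. (g has_derivative g' x) (at x)" "\<forall>v. Ck k S (\<lambda>x. g' x v)" by auto
  have "Ck k S f" "Ck k S g" using Suc.prems Ck_SucD by blast+
  then have "Ck k S (\<lambda>x. f x *\<^sub>R g' x v + f' x v *\<^sub>R g x)" for v
    using fg Suc.IH by (intro Ck_add) auto
  then show ?case using fg
    by (auto intro!: exI[of _ "\<lambda>x v. f x *\<^sub>R g' x v + f' x v *\<^sub>R g x"] has_derivative_scaleR)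
qed (auto intro: continuous_on_scaleR)

lemma Ck_mult:
  fixes f g :: "'a::real_normed_vector \<Rightarrow> real"
  shows "Ck k S f \<Longrightarrow> Ck k S g \<Longrightarrow> Ck k S (\<lambda>x. f x * g x)"
  using Ck_scaleR[of k S f g] by simp

lemma Ck_inverse:
  fixes f :: "'a::real_normed_vector \<Rightarrow> real"
  assumes "\<And>x. x \<in> S \<Longrightarrow> f x \<noteq> 0"
  shows "Ck k S f \<Longrightarrow> Ck k S (\<lambda>x. inverse (f x))"
proof (induction k)
  case 0
  then show ?case using assms by (auto intro: continuous_on_inverse)
next
  case (Suc k)
  then obtain f' where f': "\<forall>x\<in>S. (f has_derivative f' x) (at x)" "\<forall>v. Ck k S (\<lambda>x. f' x v)" by auto
  have "Ck k S (\<lambda>x. inverse (f x))" using Suc Ck_SucD by blast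
  then have "Ck k S (\<lambda>x. (-1) * (inverse (f x) * f' x v * inverse (f x)))" for v
    using f' by (intro Ck_mult Ck_const) auto
  moreover have "((\<lambda>x. inverse (f x)) has_derivative (\<lambda>v. (-1) * (inverse (f x) * f' x v * inverse (f x)))) (at x)"
    if "x \<in> S" for x
    using Deriv.has_derivative_inverse[OF assms[OF that] bspec[OF f'(1) that]] by simp
  ultimately show ?case
    by (auto intro!: exI[of _ "\<lambda>x v. (-1) * (inverse (f x) * f' x v * inverse (f x))"])
qed

lemma has_derivative_affine_comp:
  assumes "bounded_linear L" "(f has_derivative f') (at (a + L x))"
  shows "((\<lambda>x. f (a + L x)) has_derivative (\<lambda>v. f' (L v))) (at x)"
proof -
  have "((\<lambda>x. a + L x) has_derivative L) (at x)"
    using has_derivative_add[OF has_derivative_const bounded_linear_imp_has_derivative[OF assms(1)], of a "at x"] by simp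
  then show ?thesis using has_derivative_compose[of "\<lambda>x. a + L x" L x UNIV f f'] assms(2) by simp
qed

lemma Ck_affine_comp:
  assumes "bounded_linear L"
  shows "Ck k UNIV f \<Longrightarrow> Ck k UNIV (\<lambda>x. f (a + L x))"
proof (induction k arbitrary: f)
  case 0
  then show ?case using linear_continuous_on[OF assms, of UNIV]
    by (auto intro!: continuous_on_compose2[of UNIV f] continuous_intros)
next
  case (Suc k)
  then obtain f' where f': "\<forall>x. (f has_derivative f' x) (at x)" "\<forall>v. Ck k UNIV (\<lambda>x. f' x v)" by auto
  have "((\<lambda>x. f (a + L x)) has_derivative (\<lambda>v. f' (a + L x) (L v))) (at x)" for x
    by (rule has_derivative_affine_comp[OF assms]) (use f'(1) in simp)
  moreover have "Ck k UNIV (\<lambda>x. f' (a + L x) (L v))" for v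
    using Suc.IH[of "\<lambda>x. f' x (L v)"] f'(2) by simp
  ultimately show ?case by (auto intro!: exI[of _ "\<lambda>x v. f' (a + L x) (L v)"])
qed

text \<open>On the overlap the two derivatives agree by uniqueness, so they glue to a single one, to
  which the induction applies. This is how a function vanishing outside a cube inside the domain is
  extended by zero.\<close>

lemma Ck_Un:
  assumes "open S" "open T"
  shows "Ck k S f \<Longrightarrow> Ck k T f \<Longrightarrow> Ck k (S \<union> T) f"
proof (induction k arbitrary: f)
  case 0
  then show ?case using assms by (simp add: continuous_on_open_Un)
next
  case (Suc k)
  then obtain f' g' where fg:
    "\<forall>x\<in>S. (f has_derivative f' x) (at x)" "\<forall>v. Ck k S (\<lambda>x. f' x v)"
    "\<forall>x\<in>T. (f has_derivative g' x) (at x)" "\<forall>v. Ck k T (\<lambda>x. g' x v)" by auto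
  define h where "h x = (if x \<in> S then f' x else g' x)" for x
  have hT: "h x = g' x" if "x \<in> T" for x
    using has_derivative_unique[OF bspec[OF fg(1)] bspec[OF fg(3) that]] by (auto simp: h_def)
  have "Ck k S (\<lambda>x. h x v)" "Ck k T (\<lambda>x. h x v)" for v
    using Ck_cong[OF assms(1) _ spec[OF fg(2), of v], of "\<lambda>x. h x v"]
      Ck_cong[OF assms(2) _ spec[OF fg(4), of v], of "\<lambda>x. h x v"] hT by (auto simp: h_def)
  then have "Ck k (S \<union> T) (\<lambda>x. h x v)" for v using Suc.IH by blast
  moreover have "\<forall>x\<in>S \<union> T. (f has_derivative h x) (at x)"
    using fg(1,3) hT by (auto simp: h_def)
  ultimately show ?case by auto
qed

text \<open>The span of these functions is closed under differentiation, hence they are all smooth at 0.\<close>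

definition flat :: "nat \<Rightarrow> real \<Rightarrow> real" where
  "flat k t = (if 0 < t then (1 / t) ^ k * exp (- (1 / t)) else 0)"

lemma flat_DERIV: "(flat k has_real_derivative (flat (k + 2) t - real k * flat (k + 1) t)) (at t)"
proof -
  consider "0 < t" | "t < 0" | "t = 0" by linarith
  then show ?thesis
  proof cases
    case 1
    have d1: "((\<lambda>t. 1 / t) has_real_derivative - ((1 / t)\<^sup>2)) (at t)"
      using 1 by (auto intro!: derivative_eq_intros simp: power2_eq_square)
    have "((\<lambda>t. (1 / t) ^ k) has_real_derivative - (real k * (1 / t) ^ (k + 1))) (at t)"
      using DERIV_power[OF d1, of k] by (cases k) (auto simp: power2_eq_square mult_ac)
    moreover have "((\<lambda>t. exp (- (1 / t))) has_real_derivative exp (- (1 / t)) * (1 / t)\<^sup>2) (at t)"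
      using DERIV_fun_exp[OF DERIV_minus[OF d1]] by simp
    ultimately have "((\<lambda>t. (1 / t) ^ k * exp (- (1 / t))) has_real_derivative
        - (real k * (1 / t) ^ (k + 1)) * exp (- (1 / t)) + exp (- (1 / t)) * (1 / t)\<^sup>2 * (1 / t) ^ k) (at t)"
      by (rule DERIV_mult)
    also have "- (real k * (1 / t) ^ (k + 1)) * exp (- (1 / t)) + exp (- (1 / t)) * (1 / t)\<^sup>2 * (1 / t) ^ k
        = flat (k + 2) t - real k * flat (k + 1) t"
      using 1 by (simp add: flat_def power_add power2_eq_square mult_ac)
    finally show ?thesis
      by (rule has_field_derivative_transform_within_open[of _ _ _ "{0<..}"]) (use 1 in \<open>auto simp: flat_def\<close>)
  next
    case 2
    have "((\<lambda>t. 0) has_real_derivative (flat (k + 2) t - real k * flat (k + 1) t)) (at t)"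
      using 2 by (auto simp: flat_def)
    then show ?thesis
      by (rule has_field_derivative_transform_within_open[of _ _ _ "{..<0}"]) (use 2 in \<open>auto simp: flat_def\<close>)
  next
    case 3
    \<comment> \<open>The right difference quotient of \<open>flat k\<close> at 0 is
      \<open>flat (k + 1)\<close>; in the variable y = 1 / h it is y^(k + 1) / exp y, which tends to
      0 at infinity.\<close>
    have lim: "((\<lambda>h. (1 / h) ^ (k + 1) * exp (- (1 / h))) \<longlongrightarrow> 0) (at_right (0::real))"
    proof -
      have "((\<lambda>y::real. y ^ (k + 1) / exp y) \<longlongrightarrow> 0) at_top" by (rule tendsto_power_div_exp_0)
      then have "((\<lambda>h::real. (inverse h) ^ (k + 1) / exp (inverse h)) \<longlongrightarrow> 0) (at_right 0)"
        by (rule filterlim_compose) (rule filterlim_inverse_at_top_right)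
      then show ?thesis by (simp add: exp_minus divide_inverse)
    qed
    have R: "((\<lambda>h. flat k h / h) \<longlongrightarrow> 0) (at_right 0)"
      by (rule Lim_transform_eventually[OF lim])
        (auto simp: eventually_at_right_field flat_def intro!: exI[of _ 1])
    have L: "((\<lambda>h. flat k h / h) \<longlongrightarrow> 0) (at_left 0)"
      by (rule tendsto_eventually) (auto simp: eventually_at_left_field flat_def intro!: exI[of _ "-1"])
    have "((\<lambda>h. flat k h / h) \<longlongrightarrow> 0) (at 0)" using L R by (rule filterlim_split_at_real)
    then show ?thesis using 3 by (simp add: DERIV_def flat_def)
  qed
qed

lemma Ck_flat: "Ck n UNIV (flat k)"
proof (induction n arbitrary: k)
  case 0
  have "isCont (flat k) x" for x using DERIV_isCont[OF flat_DERIV] .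
  then show ?case by (simp add: continuous_at_imp_continuous_on)
next
  case (Suc n)
  have "Ck n UNIV (\<lambda>t. (flat (k + 2) t + (- real k) * flat (k + 1) t) * v)" for v
    by (intro Ck_add Ck_mult Ck_const Suc)
  moreover have "(flat k has_derivative (\<lambda>v. (flat (k + 2) t + (- real k) * flat (k + 1) t) * v)) (at t)" for t
    using flat_DERIV[of k t] by (simp add: has_field_derivative_def)
  ultimately show ?case
    by (auto intro!: exI[of _ "\<lambda>t v. (flat (k + 2) t + (- real k) * flat (k + 1) t) * v"])
qed

text \<open>The transition runs between 5/4 and 7/4. The margin at 1 makes the cutoff constant on a
  neighbourhood of the closed inner cube, so its gradient vanishes there up to the boundary.\<close>

definition sstep :: "real \<Rightarrow> real" where
  "sstep t = flat 0 (7/4 - t) * inverse (flat 0 (7/4 - t) + flat 0 (t - 5/4))"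

lemma flat_0_nonneg: "0 \<le> flat 0 t" by (simp add: flat_def)

lemma sstep_denom: "0 < flat 0 (7/4 - t) + flat 0 (t - 5/4)"
proof -
  have "0 < 7/4 - t \<or> 0 < t - 5/4" by linarith
  then show ?thesis by (auto simp: flat_def add_pos_nonneg add_nonneg_pos)
qed

lemma sstep_bounds: "0 \<le> sstep t" "sstep t \<le> 1"
  using sstep_denom[of t] flat_0_nonneg[of "7/4 - t"] flat_0_nonneg[of "t - 5/4"]
  by (auto simp: sstep_def divide_inverse[symmetric] divide_le_eq)

lemma sstep_1: "t \<le> 5/4 \<Longrightarrow> sstep t = 1"
  by (simp add: sstep_def flat_def)

lemma sstep_0: "7/4 \<le> t \<Longrightarrow> sstep t = 0"
  by (simp add: sstep_def flat_def)

lemma Ck_sstep: "Ck k UNIV sstep"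
proof -
  have a: "Ck k UNIV (\<lambda>t. flat 0 (7/4 - t))"
    using Ck_affine_comp[OF bounded_linear_minus[OF bounded_linear_ident] Ck_flat[of k 0], of "7/4"] by simp
  have b: "Ck k UNIV (\<lambda>t. flat 0 (t - 5/4))"
    using Ck_affine_comp[OF bounded_linear_ident Ck_flat[of k 0], of "- (5/4)"] by (simp add: add.commute)
  have "Ck k UNIV (\<lambda>t. flat 0 (7/4 - t) * inverse (flat 0 (7/4 - t) + flat 0 (t - 5/4)))"
  proof (intro Ck_mult Ck_inverse Ck_add a b)
    show "flat 0 (7/4 - t) + flat 0 (t - 5/4) \<noteq> 0" for t using sstep_denom[of t] by simp
  qed
  then show ?thesis unfolding sstep_def .
qed

section \<open>Cutoffs adapted to cubes\<close>

definition cutoff0 :: "real^2 \<Rightarrow> real" where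
  "cutoff0 x = (sstep (x$1) * sstep (- x$1)) * (sstep (x$2) * sstep (- x$2))"

lemma Ck_cutoff0: "Ck k UNIV cutoff0"
proof -
  have "Ck k UNIV (\<lambda>x::real^2. sstep (x$i))" "Ck k UNIV (\<lambda>x::real^2. sstep (- x$i))" for i
    using Ck_affine_comp[OF bounded_linear_vec_nth Ck_sstep, of k 0 i]
      Ck_affine_comp[OF bounded_linear_minus[OF bounded_linear_vec_nth] Ck_sstep, of k 0 i] by simp_all
  then show ?thesis unfolding cutoff0_def by (intro Ck_mult)
qed

lemma cutoff0_bounds: "0 \<le> cutoff0 x" "cutoff0 x \<le> 1"
  unfolding cutoff0_def using sstep_bounds by (auto intro!: mult_nonneg_nonneg mult_le_one)

lemma cutoff0_1: "x \<in> kube 0 (5/4) \<Longrightarrow> cutoff0 x = 1"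
proof -
  assume "x \<in> kube 0 (5/4)"
  then have "\<bar>x$1\<bar> \<le> 5/4" "\<bar>x$2\<bar> \<le> 5/4" by (auto simp: mem_kube)
  then show ?thesis by (simp add: cutoff0_def sstep_1)
qed

lemma cutoff0_0: "x \<notin> kube 0 (7/4) \<Longrightarrow> cutoff0 x = 0"
proof -
  assume "x \<notin> kube 0 (7/4)"
  then obtain i where "7/4 < \<bar>x$i\<bar>" by (auto simp: mem_kube not_le)
  moreover have "i = 1 \<or> i = 2" using exhaust_2 by blast
  ultimately have "7/4 \<le> x$1 \<or> 7/4 \<le> - x$1 \<or> 7/4 \<le> x$2 \<or> 7/4 \<le> - x$2" by auto
  then show ?thesis by (auto simp: cutoff0_def sstep_0)
qed

lemma frechet_derivative_locally_const:
  assumes "open S" "x \<in> S" "\<And>y. y \<in> S \<Longrightarrow> f y = c"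
  shows "frechet_derivative f (at x) = (\<lambda>v. 0)"
proof -
  have "(f has_derivative (\<lambda>v. 0)) (at x)"
    by (rule has_derivative_transform_within_open[OF has_derivative_const[of c] assms(1,2)]) (use assms(3) in auto)
  then show ?thesis by (rule frechet_derivative_at[symmetric])
qed

lemma cutoff0_deriv_0:
  "x \<in> kube 0 1 \<Longrightarrow> frechet_derivative cutoff0 (at x) = (\<lambda>v. 0)"
  "x \<notin> kube 0 2 \<Longrightarrow> frechet_derivative cutoff0 (at x) = (\<lambda>v. 0)"
proof -
  assume x: "x \<in> kube 0 1"
  show "frechet_derivative cutoff0 (at x) = (\<lambda>v. 0)"
  proof (rule frechet_derivative_locally_const[of "ball x (1/4)"])
    fix y assume "y \<in> ball x (1/4)"
    then have "y \<in> kube x (1/4)" using ball_subset_kube by blast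
    then have "y \<in> kube 0 (1 + 1/4)" using kube_trans x by blast
    then show "cutoff0 y = 1" using cutoff0_1 by simp
  qed auto
next
  assume x: "x \<notin> kube 0 2"
  have sub: "kube 0 (7/4) \<subseteq> kube 0 2" by (rule kube_mono) simp
  show "frechet_derivative cutoff0 (at x) = (\<lambda>v. 0)"
  proof (rule frechet_derivative_locally_const[of "- kube 0 2"])
    show "open (- kube 0 2)" using compact_kube compact_imp_closed by blast
    show "cutoff0 y = 0" if "y \<in> - kube 0 2" for y using that sub cutoff0_0 by blast
  qed (use x in simp)
qed

lemma cutoff0_deriv_bounded:
  obtains C where "0 < C" "\<And>x \<beta>. \<bar>frechet_derivative cutoff0 (at x) (axis \<beta> 1)\<bar> \<le> C"
proof -
  have "\<exists>C. \<forall>x\<in>kube 0 2. \<bar>frechet_derivative cutoff0 (at x) (axis \<beta> 1)\<bar> \<le> C" for \<beta>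
  proof -
    have "continuous_on (kube 0 2) (\<lambda>x. frechet_derivative cutoff0 (at x) (axis \<beta> 1))"
      using Ck_1_cont[OF Ck_cutoff0] continuous_on_subset by blast
    then have "compact ((\<lambda>x. frechet_derivative cutoff0 (at x) (axis \<beta> 1)) ` kube 0 2)"
      using compact_kube compact_continuous_image by blast
    then have "bounded ((\<lambda>x. frechet_derivative cutoff0 (at x) (axis \<beta> 1)) ` kube 0 2)"
      by (rule compact_imp_bounded)
    then show ?thesis by (simp add: bounded_real)
  qed
  then have "\<forall>\<beta>. \<exists>C. \<forall>x\<in>kube 0 2. \<bar>frechet_derivative cutoff0 (at x) (axis \<beta> 1)\<bar> \<le> C" by blast
  from choice[OF this] obtain C where
    C: "\<And>\<beta> x. x \<in> kube 0 2 \<Longrightarrow> \<bar>frechet_derivative cutoff0 (at x) (axis \<beta> 1)\<bar> \<le> C \<beta>"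
    by blast
  show ?thesis
  proof
    show "0 < 1 + (\<Sum>\<beta>\<in>UNIV. \<bar>C \<beta>\<bar>)" by (simp add: add_pos_nonneg sum_nonneg)
    fix x \<beta>
    have "\<bar>C \<beta>\<bar> \<le> (\<Sum>\<beta>\<in>UNIV. \<bar>C \<beta>\<bar>)" by (rule member_le_sum) auto
    then show "\<bar>frechet_derivative cutoff0 (at x) (axis \<beta> 1)\<bar> \<le> 1 + (\<Sum>\<beta>\<in>UNIV. \<bar>C \<beta>\<bar>)"
      using C[of x \<beta>] cutoff0_deriv_0(2)[of x] by (cases "x \<in> kube 0 2") auto
  qed
qed

text \<open>The argument is written as a constant plus a linear map to match
  \<open>Ck_affine_comp\<close>. The result is 1 on \<open>kube a r\<close> and 0 off
  \<open>kube a (2 * r)\<close>, with gradient of order \<open>1 / r\<close>.\<close>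

definition cutoff :: "real^2 \<Rightarrow> real \<Rightarrow> real^2 \<Rightarrow> real" where
  "cutoff a r x = cutoff0 (- (1 / r) *\<^sub>R a + (1 / r) *\<^sub>R x)"

lemma kube_scale: "0 < r \<Longrightarrow> - (1 / r) *\<^sub>R a + (1 / r) *\<^sub>R x \<in> kube 0 s \<longleftrightarrow> x \<in> kube a (s * r)"
proof -
  assume r: "0 < r"
  have "(- (1 / r) *\<^sub>R a + (1 / r) *\<^sub>R x) $ i = (x$i - a$i) / r" for i
    by (simp add: diff_divide_distrib)
  then show ?thesis using r by (simp add: mem_kube pos_divide_le_eq)
qed

lemma Ck_cutoff: "Ck k UNIV (cutoff a r)"
  unfolding cutoff_def by (rule Ck_affine_comp[OF bounded_linear_scaleR_right Ck_cutoff0])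

lemma cutoff_bounds: "0 \<le> cutoff a r x" "cutoff a r x \<le> 1"
  by (simp_all add: cutoff_def cutoff0_bounds)

lemma cutoff_1: "0 < r \<Longrightarrow> x \<in> kube a r \<Longrightarrow> cutoff a r x = 1"
  unfolding cutoff_def
  by (rule cutoff0_1, rule subsetD[OF kube_mono[of 1]]) (simp_all only: kube_scale, simp_all)

lemma cutoff_0: "0 < r \<Longrightarrow> x \<notin> kube a (2 * r) \<Longrightarrow> cutoff a r x = 0"
  unfolding cutoff_def
  using kube_scale[of r a x 2] subsetD[OF kube_mono[of "7/4" 2 0]] cutoff0_0 by fastforce

lemma cutoff_deriv:
  "frechet_derivative (cutoff a r) (at x) v = (1 / r) * frechet_derivative cutoff0 (at (- (1 / r) *\<^sub>R a + (1 / r) *\<^sub>R x)) v"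
proof -
  let ?y = "- (1 / r) *\<^sub>R a + (1 / r) *\<^sub>R x"
  have d: "(cutoff0 has_derivative frechet_derivative cutoff0 (at ?y)) (at ?y)"
    by (rule Ck_1D[OF Ck_cutoff0]) simp
  have "(cutoff a r has_derivative (\<lambda>v. frechet_derivative cutoff0 (at ?y) ((1 / r) *\<^sub>R v))) (at x)"
    unfolding cutoff_def by (rule has_derivative_affine_comp[OF bounded_linear_scaleR_right d])
  then have "frechet_derivative (cutoff a r) (at x) = (\<lambda>v. frechet_derivative cutoff0 (at ?y) ((1 / r) *\<^sub>R v))"
    by (rule frechet_derivative_at[symmetric])
  then show ?thesis using linear_scale[OF has_derivative_linear[OF d]] by simp
qed

lemma cutoff_deriv_0:
  "0 < r \<Longrightarrow> x \<in> kube a r \<Longrightarrow> frechet_derivative (cutoff a r) (at x) v = 0"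
  "0 < r \<Longrightarrow> x \<notin> kube a (2 * r) \<Longrightarrow> frechet_derivative (cutoff a r) (at x) v = 0"
  using kube_scale[of r a x 1] kube_scale[of r a x 2] by (simp_all add: cutoff_deriv cutoff0_deriv_0)

lemma Dmat_product:
  fixes f :: "real^2 \<Rightarrow> complex^'n"
  assumes "Ck (Suc 0) S \<eta>" "Ck (Suc 0) S f" "x \<in> S"
  shows "Dmat (\<lambda>x. \<eta> x *\<^sub>R (f x - c)) x =
    \<eta> x *\<^sub>R Dmat f x + (\<chi> i \<beta>. frechet_derivative \<eta> (at x) (axis \<beta> 1) *\<^sub>R (f x - c) $ i)"
proof -
  have "((\<lambda>x. f x - c) has_derivative (\<lambda>v. frechet_derivative f (at x) v - 0)) (at x)"
    by (rule has_derivative_diff[OF Ck_1D[OF assms(2,3)] has_derivative_const])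
  from frechet_derivative_at[OF has_derivative_scaleR[OF Ck_1D[OF assms(1,3)] this]]
  have "frechet_derivative (\<lambda>x. \<eta> x *\<^sub>R (f x - c)) (at x) =
     (\<lambda>v. \<eta> x *\<^sub>R (frechet_derivative f (at x) v - 0) + frechet_derivative \<eta> (at x) v *\<^sub>R (f x - c))"
    by (rule sym)
  then show ?thesis by (simp add: Dmat_def vec_eq_iff)
qed

text \<open>\<open>f\<close> is known to be smooth on \<Omega> only. The product is smooth there and
  identically 0 on the complement of the outer cube, and these two open sets cover the
  plane.\<close>

lemma test_function:
  fixes f :: "real^2 \<Rightarrow> complex^'n" and c :: "complex^'n"
  assumes f: "smooth_on \<Omega> f" and \<Omega>: "open \<Omega>" "kube a (2 * r) \<subseteq> \<Omega>" and r: "0 < r"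
  defines "\<psi> \<equiv> \<lambda>x. cutoff a r x *\<^sub>R (f x - c)"
  shows "smooth_on UNIV \<psi>" "compact (tsupp \<psi>)" "tsupp \<psi> \<subseteq> \<Omega>"
proof -
  have cl: "closed (kube a (2 * r))" using compact_kube compact_imp_closed by blast
  have "{x. \<psi> x \<noteq> 0} \<subseteq> kube a (2 * r)" using cutoff_0[OF r] by (auto simp: \<psi>_def)
  then have sub: "tsupp \<psi> \<subseteq> kube a (2 * r)" unfolding tsupp_def using cl closure_minimal by blast
  then show "tsupp \<psi> \<subseteq> \<Omega>" using \<Omega> by blast
  have "closed (tsupp \<psi>)" by (simp add: tsupp_def)
  then show "compact (tsupp \<psi>)" using sub compact_kube
    by (metis closed_Int_compact inf.absorb1)
  show "smooth_on UNIV \<psi>"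
    unfolding smooth_on_def
  proof
    fix k
    have "Ck k \<Omega> (\<lambda>x. f x + (- c))"
      using f by (intro Ck_add Ck_const) (simp add: smooth_on_def)
    then have "Ck k \<Omega> \<psi>"
      unfolding \<psi>_def using Ck_scaleR[OF Ck_subset[OF Ck_cutoff, of \<Omega>]] by auto
    moreover have "Ck k (- kube a (2 * r)) \<psi>"
      by (rule Ck_cong[OF _ _ Ck_const[of _ _ 0]]) (use cl cutoff_0[OF r] in \<open>auto simp: \<psi>_def\<close>)
    ultimately have "Ck k (\<Omega> \<union> - kube a (2 * r)) \<psi>" using \<Omega>(1) cl by (intro Ck_Un) auto
    moreover have "\<Omega> \<union> - kube a (2 * r) = UNIV" using \<Omega>(2) by blast
    ultimately show "Ck k UNIV \<psi>" by simp
  qed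
qed


section \<open>Hole filling\<close>

lemma nn_integral_lebesgue_on:
  assumes "\<Omega> \<in> sets lebesgue"
  shows "(\<integral>\<^sup>+x. f x \<partial>lebesgue_on \<Omega>) = (\<integral>\<^sup>+x\<in>\<Omega>. f x \<partial>lborel)"
  using assms by (simp add: nn_integral_restrict_space nn_integral_completion)

lemma wL2grad_eq:
  assumes "\<Omega> \<in> sets lebesgue"
  shows "wL2grad V \<Omega> G = (\<integral>\<^sup>+x. ennreal ((norm (msqrt (V x) ** G x))\<^sup>2) \<partial>lebesgue_on \<Omega>)"
  using assms by (simp add: wL2grad_def frob_eq_norm nn_integral_restrict_space)

lemma wL2_eq:
  assumes "\<Omega> \<in> sets lebesgue"
  shows "wL2 V \<Omega> f = (\<integral>\<^sup>+x. ennreal ((norm (msqrt (V x) *v f x))\<^sup>2) \<partial>lebesgue_on \<Omega>)"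
  using assms by (simp add: wL2_def nn_integral_restrict_space)

lemma form_add_right: "form A x \<nu> (\<eta> + \<eta>') = form A x \<nu> \<eta> + form A x \<nu> \<eta>'"
  by (simp add: form_def sum.distrib distrib_left)

lemma form_scaleR_right: "form A x \<nu> (a *\<^sub>R \<eta>) = a *\<^sub>R form A x \<nu> \<eta>"
  by (simp add: form_def scaleR_sum_right)

lemma norm_sq_add_le:
  fixes a b :: "'a::real_normed_vector"
  shows "(norm (a + b))\<^sup>2 \<le> 2 * (norm a)\<^sup>2 + 2 * (norm b)\<^sup>2"
proof -
  have "(norm (a + b))\<^sup>2 \<le> (norm a + norm b)\<^sup>2" by (intro power_mono norm_triangle_ineq) simp
  also have "\<dots> \<le> 2 * (norm a)\<^sup>2 + 2 * (norm b)\<^sup>2"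
    using sum_squares_bound[of "norm a" "norm b"] by (simp add: power2_sum)
  finally show ?thesis .
qed

lemma young_ineq:
  assumes "0 < (s::real)" "0 < L"
  shows "L * x * y \<le> s * x\<^sup>2 + L\<^sup>2 / (4 * s) * y\<^sup>2"
proof -
  have "0 \<le> (2 * s * x - L * y)\<^sup>2 / (4 * s)" using assms by simp
  also have "\<dots> = s * x\<^sup>2 + L\<^sup>2 / (4 * s) * y\<^sup>2 - L * x * y"
    using assms by (simp add: power2_diff field_simps power2_eq_square)
  finally show ?thesis by simp
qed

lemma matrix_mult_diff_right: "(S::complex^'n^'n) ** (A - B) = S ** A - S ** (B::complex^2^'n)"
  by (simp add: matrix_matrix_mult_def vec_eq_iff right_diff_distrib sum_subtractf)

lemma matrix_mult_scaleR_right: "(S::complex^'n^'n) ** (a *\<^sub>R B) = a *\<^sub>R (S ** (B::complex^2^'n))"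
  by (simp add: matrix_matrix_mult_def vec_eq_iff scaleR_sum_right)

text \<open>The matrix is the product of a gradient \<open>b\<close> and a vector \<open>w\<close>,
  the term that arises when the cutoff is differentiated; each of its columns becomes a multiple of
  \<open>S *v w\<close>.\<close>

lemma norm_rank_one:
  "norm ((S::complex^'n^'n) ** ((\<chi> i \<beta>. b \<beta> *\<^sub>R w $ i) :: complex^2^'n)) \<le> (\<Sum>\<beta>\<in>UNIV. \<bar>b \<beta>\<bar>) * norm (S *v w)"
proof -
  let ?M = "S ** ((\<chi> i \<beta>. b \<beta> *\<^sub>R w $ i) :: complex^2^'n)"
  have col: "(\<chi> i. ?M $ i $ \<beta>) = b \<beta> *\<^sub>R (S *v w)" for \<beta>
    by (simp add: vec_eq_iff matrix_matrix_mult_def matrix_vector_mult_def scaleR_sum_right)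
  have "(norm ?M)\<^sup>2 = (\<Sum>\<beta>\<in>UNIV. \<bar>b \<beta>\<bar>\<^sup>2) * (norm (S *v w))\<^sup>2"
    unfolding norm_matrix_sq_columns[of ?M] col by (simp add: power_mult_distrib sum_distrib_right)
  also have "\<dots> \<le> ((\<Sum>\<beta>\<in>UNIV. \<bar>b \<beta>\<bar>) * norm (S *v w))\<^sup>2"
    unfolding power_mult_distrib by (intro mult_right_mono) (simp_all add: UNIV_2 power2_sum)
  finally show ?thesis by (rule power2_le_imp_le) (simp add: sum_nonneg)
qed

text \<open>A fixed choice makes the bound for the cutoff an absolute constant, so that
  \<open>hole_const\<close> depends on \<open>lam\<close> and \<open>Lam\<close> only.\<close>

definition cutC :: real where
  "cutC = (SOME C. 0 < C \<and> (\<forall>x \<beta>. \<bar>frechet_derivative cutoff0 (at x) (axis \<beta> 1)\<bar> \<le> C))"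

lemma cutC: "0 < cutC" "\<bar>frechet_derivative cutoff0 (at x) (axis \<beta> 1)\<bar> \<le> cutC"
proof -
  have "\<exists>C. 0 < C \<and> (\<forall>x \<beta>. \<bar>frechet_derivative cutoff0 (at x) (axis \<beta> 1)\<bar> \<le> C)"
    by (rule cutoff0_deriv_bounded) (intro exI conjI allI, assumption+)
  then have "0 < cutC \<and> (\<forall>x \<beta>. \<bar>frechet_derivative cutoff0 (at x) (axis \<beta> 1)\<bar> \<le> cutC)"
    unfolding cutC_def by (rule someI_ex)
  then show "0 < cutC" "\<bar>frechet_derivative cutoff0 (at x) (axis \<beta> 1)\<bar> \<le> cutC" by simp_all
qed

text \<open>The value for which Young's inequality in the hole-filling estimate leaves \<open>lam / 2\<close>.\<close>

definition hole_const :: "real \<Rightarrow> real \<Rightarrow> real" where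
  "hole_const lam Lam = 524288 * Lam\<^sup>2 * cutC\<^sup>2 / lam"

lemma hole_const_pos: "0 < lam \<Longrightarrow> 0 < Lam \<Longrightarrow> 0 < hole_const lam Lam"
  using cutC(1) by (simp add: hole_const_def)

lemma borel_measurable_lebesgue_on:
  assumes "f \<in> borel_measurable borel"
  shows "f \<in> borel_measurable (lebesgue_on \<Omega>)"
  using assms by (intro measurable_restrict_space1 measurable_completion) simp

text \<open>\<open>V\<close> stands for the Borel version of the weight and \<open>w\<close> for its
  characteristic as a real number. One approximating sequence is fixed, since the estimates for
  \<open>u\<close> pass through it.\<close>

locale A2_solution = A2_kernel V for V :: "real^2 \<Rightarrow> complex^'n^'n" +
  fixes lam Lam w :: real and \<Omega> :: "(real^2) set" and A u Du and \<phi> :: "nat \<Rightarrow> real^2 \<Rightarrow> complex^'n"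
  assumes lam: "0 < lam" and Lam: "0 < Lam" and \<Omega>: "open \<Omega>"
    and ell: "elliptic lam Lam V \<Omega> A"
    and u_meas: "u \<in> borel_measurable (lebesgue_on \<Omega>)"
    and Du_meas: "Du \<in> borel_measurable (lebesgue_on \<Omega>)"
    and \<phi>_smooth: "\<And>k. smooth_on \<Omega> (\<phi> k)"
    and \<phi>_grad: "\<And>k. wL2grad V \<Omega> (Dmat (\<phi> k)) < (top::ennreal)"
    and \<phi>_u: "(\<lambda>k. wL2 V \<Omega> (\<lambda>x. u x - \<phi> k x)) \<longlonglongrightarrow> 0"
    and \<phi>_Du: "(\<lambda>k. wL2grad V \<Omega> (\<lambda>x. Du x - Dmat (\<phi> k) x)) \<longlonglongrightarrow> 0"
    and sol: "weak_solution \<Omega> A Du"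
    and w: "A2_char V = ennreal w" "1 \<le> w"
begin

abbreviation "M \<equiv> lebesgue_on \<Omega>"

lemma \<Omega>_sets: "\<Omega> \<in> sets lebesgue" "\<Omega> \<in> sets borel"
  using \<Omega> by auto

lemma V_M: "V \<in> borel_measurable M"
  by (rule borel_measurable_lebesgue_on[OF V_meas])

lemma \<phi>_Ck: "Ck j \<Omega> (\<phi> k)"
  using \<phi>_smooth by (simp add: smooth_on_def)

lemma continuous_M:
  fixes f :: "real^2 \<Rightarrow> 'b::euclidean_space"
  shows "continuous_on \<Omega> f \<Longrightarrow> f \<in> borel_measurable M"
  by (rule continuous_imp_measurable_on_sets_lebesgue[OF _ \<Omega>_sets(1)])

lemma \<phi>_M: "\<phi> k \<in> borel_measurable M" "Dmat (\<phi> k) \<in> borel_measurable M"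
  by (intro continuous_M Ck_1_continuous[OF \<phi>_Ck] Ck_1_continuous_Dmat[OF \<phi>_Ck])+

text \<open>With \<open>h2\<close> and \<open>e2\<close> below: the energy densities of the
  solution, of its approximant and of the error.\<close>

definition g2 :: "real^2 \<Rightarrow> real" where
  "g2 x = (norm (msqrt (V x) ** Du x))\<^sup>2"

definition h2 :: "nat \<Rightarrow> real^2 \<Rightarrow> real" where
  "h2 k x = (norm (msqrt (V x) ** Dmat (\<phi> k) x))\<^sup>2"

definition e2 :: "nat \<Rightarrow> real^2 \<Rightarrow> real" where
  "e2 k x = (norm (msqrt (V x) ** (Du x - Dmat (\<phi> k) x)))\<^sup>2"

lemma meas_2 [measurable]: "g2 \<in> borel_measurable M" "h2 k \<in> borel_measurable M" "e2 k \<in> borel_measurable M"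
  unfolding g2_def h2_def e2_def
  by (intro borel_measurable_power borel_measurable_norm_msqrt_mat V_M Du_meas \<phi>_M pd borel_measurable_diff)+

lemma nonneg_2: "0 \<le> g2 x" "0 \<le> h2 k x" "0 \<le> e2 k x"
  by (simp_all add: g2_def h2_def e2_def)

lemma ineq_2: "g2 x \<le> 2 * h2 k x + 2 * e2 k x" "h2 k x \<le> 2 * g2 x + 2 * e2 k x" "e2 k x \<le> 2 * g2 x + 2 * h2 k x"
proof -
  let ?S = "msqrt (V x)"
  show "g2 x \<le> 2 * h2 k x + 2 * e2 k x"
    using norm_sq_add_le[of "?S ** Dmat (\<phi> k) x" "?S ** (Du x - Dmat (\<phi> k) x)"]
    by (simp add: g2_def h2_def e2_def matrix_mult_diff_right)
  show "h2 k x \<le> 2 * g2 x + 2 * e2 k x"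
    using norm_sq_add_le[of "?S ** Du x" "- (?S ** (Du x - Dmat (\<phi> k) x))"]
    by (simp add: g2_def h2_def e2_def matrix_mult_diff_right norm_minus_commute)
  show "e2 k x \<le> 2 * g2 x + 2 * h2 k x"
    using norm_sq_add_le[of "?S ** Du x" "- (?S ** Dmat (\<phi> k) x)"]
    by (simp add: g2_def h2_def e2_def matrix_mult_diff_right)
qed

lemma h2_integrable: "integrable M (h2 k)"
  using \<phi>_grad[of k] unfolding wL2grad_eq[OF \<Omega>_sets(1)]
  by (intro integrableI_nonneg) (auto simp: nonneg_2 h2_def[symmetric])

text \<open>Finite energy of the solution is not a clause of \<open>in_H12\<close>; it follows from
  one approximant of finite energy at squared distance less than 1.\<close>

lemma g2_integrable: "integrable M g2"
proof -
  have "eventually (\<lambda>k. wL2grad V \<Omega> (\<lambda>x. Du x - Dmat (\<phi> k) x) < 1) sequentially"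
    using \<phi>_Du by (rule order_tendstoD) simp
  then obtain k where "wL2grad V \<Omega> (\<lambda>x. Du x - Dmat (\<phi> k) x) < 1"
    using eventually_happens by force
  then have "(\<integral>\<^sup>+x. ennreal (e2 k x) \<partial>M) < \<infinity>"
    unfolding wL2grad_eq[OF \<Omega>_sets(1)] e2_def by (simp add: less_trans[OF _ ennreal_one_less_top])
  then have "integrable M (e2 k)"
    by (intro integrableI_nonneg) (auto simp: nonneg_2)
  then have "integrable M (\<lambda>x. 2 * h2 k x + 2 * e2 k x)"
    using h2_integrable by (intro Bochner_Integration.integrable_add integrable_mult_right) auto
  then show ?thesis
    by (rule Bochner_Integration.integrable_bound) (use ineq_2(1) nonneg_2 in \<open>auto simp: abs_of_nonneg add_nonneg_nonneg\<close>)
qed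

lemma e2_integrable: "integrable M (e2 k)"
proof -
  have "integrable M (\<lambda>x. 2 * g2 x + 2 * h2 k x)"
    using h2_integrable g2_integrable by (intro Bochner_Integration.integrable_add integrable_mult_right) auto
  then show ?thesis
    by (rule Bochner_Integration.integrable_bound) (use ineq_2(3) nonneg_2 in \<open>auto simp: abs_of_nonneg add_nonneg_nonneg\<close>)
qed

lemma e2_tendsto: "(\<lambda>k. \<integral>x. e2 k x \<partial>M) \<longlonglongrightarrow> 0"
proof -
  have "wL2grad V \<Omega> (\<lambda>x. Du x - Dmat (\<phi> k) x) = ennreal (\<integral>x. e2 k x \<partial>M)" for k
    unfolding wL2grad_eq[OF \<Omega>_sets(1)] e2_def[symmetric]
    by (rule nn_integral_eq_integral[OF e2_integrable]) (simp add: nonneg_2)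
  then have "(\<lambda>k. ennreal (\<integral>x. e2 k x \<partial>M)) \<longlonglongrightarrow> ennreal 0" using \<phi>_Du by simp
  then show ?thesis
    by (subst (asm) tendsto_ennreal_iff) (auto simp: nonneg_2)
qed

abbreviation "err k \<equiv> \<integral>x. e2 k x \<partial>M"

definition E :: "real^2 \<Rightarrow> real \<Rightarrow> real" where
  "E a r = (\<integral>x. indicator (kube a r) x * g2 x \<partial>M)"

lemma indicator_M [measurable]: "(indicator (kube a r) :: _ \<Rightarrow> real) \<in> borel_measurable M"
  by (intro borel_measurable_lebesgue_on borel_measurable_indicator) simp

lemma integrable_indicator_mult:
  fixes f :: "real^2 \<Rightarrow> real"
  assumes "integrable M f"
  shows "integrable M (\<lambda>x. indicator (kube a r) x * f x)"
  using assms
proof (rule Bochner_Integration.integrable_bound)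
  show "(\<lambda>x. indicator (kube a r) x * f x) \<in> borel_measurable M"
    using assms by measurable
qed (auto simp: indicator_def)

lemma E_nonneg: "0 \<le> E a r"
  unfolding E_def by (rule Bochner_Integration.integral_nonneg) (simp add: nonneg_2)

lemma E_le_total: "E a r \<le> (\<integral>x. g2 x \<partial>M)"
  unfolding E_def
  by (intro integral_mono integrable_indicator_mult g2_integrable) (auto simp: indicator_def nonneg_2)

abbreviation "B0 \<equiv> hole_const lam Lam"

lemma B0_pos: "0 < B0"
  using lam Lam by (rule hole_const_pos)

definition av :: "nat \<Rightarrow> real^2 \<Rightarrow> real \<Rightarrow> complex^'n" where
  "av k a r = (1 / (4 * r\<^sup>2)) *\<^sub>R (\<integral>y. indicator (kube a r) y *\<^sub>R \<phi> k y \<partial>lborel)"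

definition p2 :: "nat \<Rightarrow> real^2 \<Rightarrow> real \<Rightarrow> real^2 \<Rightarrow> real" where
  "p2 k a r x = indicator (kube a r) x * (norm (msqrt (V x) *v (\<phi> k x - av k a r)))\<^sup>2"

lemma p2_bound:
  assumes r: "0 < r" and sub: "kube a r \<subseteq> \<Omega>"
  shows "integrable M (p2 k a r)" "(\<integral>x. p2 k a r x \<partial>M) \<le> 16384 * r\<^sup>2 * w * (\<integral>x. indicator (kube a r) x * h2 k x \<partial>M)"
proof -
  have [measurable]: "p2 k a r \<in> borel_measurable M"
    unfolding p2_def
    by (intro borel_measurable_times indicator_M borel_measurable_power borel_measurable_norm_msqrt_vec V_M pd
        borel_measurable_diff \<phi>_M borel_measurable_const)
  have conv: "(\<integral>\<^sup>+x. ennreal (f x) * indicator (kube a r) x \<partial>lborel) = (\<integral>\<^sup>+x. ennreal (indicator (kube a r) x * f x) \<partial>M)"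
    for f :: "real^2 \<Rightarrow> real"
    unfolding nn_integral_lebesgue_on[OF \<Omega>_sets(1)] using sub
    by (intro nn_integral_cong) (auto simp: indicator_def)
  have hint: "integrable M (\<lambda>x. indicator (kube a r) x * h2 k x)"
    by (rule integrable_indicator_mult[OF h2_integrable])
  have hnn: "0 \<le> (\<integral>x. indicator (kube a r) x * h2 k x \<partial>M)"
    by (rule Bochner_Integration.integral_nonneg) (simp add: nonneg_2)
  have "(\<integral>\<^sup>+x. ennreal (p2 k a r x) \<partial>M) \<le> ennreal (16384 * r\<^sup>2) * ennreal w * (\<integral>\<^sup>+x. ennreal (indicator (kube a r) x * h2 k x) \<partial>M)"
    using poincare[OF \<phi>_Ck sub r, of k] unfolding conv w(1) p2_def h2_def av_def .
  also have "(\<integral>\<^sup>+x. ennreal (indicator (kube a r) x * h2 k x) \<partial>M) = ennreal (\<integral>x. indicator (kube a r) x * h2 k x \<partial>M)"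
    by (rule nn_integral_eq_integral[OF hint]) (simp add: nonneg_2)
  also have "ennreal (16384 * r\<^sup>2) * ennreal w * ennreal (\<integral>x. indicator (kube a r) x * h2 k x \<partial>M)
     = ennreal (16384 * r\<^sup>2 * w * (\<integral>x. indicator (kube a r) x * h2 k x \<partial>M))"
    using w(2) hnn by (simp add: ennreal_mult)
  finally have le: "(\<integral>\<^sup>+x. ennreal (p2 k a r x) \<partial>M) \<le> ennreal (16384 * r\<^sup>2 * w * (\<integral>x. indicator (kube a r) x * h2 k x \<partial>M))" .
  have p2nn: "0 \<le> p2 k a r x" for x by (simp add: p2_def)
  show int: "integrable M (p2 k a r)"
    using le by (intro integrableI_nonneg) (auto simp: p2nn intro: le_less_trans)
  have "(\<integral>\<^sup>+x. ennreal (p2 k a r x) \<partial>M) = ennreal (\<integral>x. p2 k a r x \<partial>M)"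
    by (rule nn_integral_eq_integral[OF int]) (simp add: p2nn)
  then show "(\<integral>x. p2 k a r x \<partial>M) \<le> 16384 * r\<^sup>2 * w * (\<integral>x. indicator (kube a r) x * h2 k x \<partial>M)"
    using le hnn w(2) by (simp add: ennreal_le_iff)
qed

lemma form_measurable:
  assumes "\<eta> \<in> borel_measurable M"
  shows "(\<lambda>x. form A x (Du x) (\<eta> x)) \<in> borel_measurable M"
proof -
  have [measurable]: "(\<lambda>x. A x i j \<alpha> \<beta>) \<in> borel_measurable M" for i j \<alpha> \<beta>
    using ell by (simp add: elliptic_def)
  have [measurable]: "(\<lambda>x. Du x $ j $ \<beta>) \<in> borel_measurable M" "(\<lambda>x. \<eta> x $ j $ \<beta>) \<in> borel_measurable M" for j \<beta>
    using Du_meas assms by (auto intro!: borel_measurable_vec_nth)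
  have [measurable]: "(\<lambda>x. cnj (\<eta> x $ j $ \<beta>)) \<in> borel_measurable M" for j \<beta>
    by (rule borel_measurable_continuous_on[of cnj]) (auto intro!: continuous_intros)
  show ?thesis unfolding form_def by measurable
qed

text \<open>The test function is built from \<open>\<phi> k\<close>, while \<open>Du\<close> stays
  in the other slot of the form; the mismatch costs the \<open>err k\<close> term. The gradient of
  the cutoff lives on the annulus between the cubes. There Young's inequality puts the large weight
  \<open>B0 * w\<close> on the annular energy, and its reciprocal absorbs the factor
  \<open>w\<close> of the Poincare inequality on the outer cube.\<close>

lemma hole_filling_k:
  assumes r: "0 < r" and sub: "kube a (2 * r) \<subseteq> \<Omega>"
  shows "lam * E a r \<le> lam / 2 * E a (2 * r) + B0 * w * (E a (2 * r) - E a r)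
     + (Lam\<^sup>2 / lam + lam / 4) * err k"
proof -
  let ?K1 = "kube a r" and ?K2 = "kube a (2 * r)"
  define c where "c = av k a (2 * r)"
  define \<eta> where "\<eta> = cutoff a r"
  define T where "T x = (\<chi> i \<beta>. frechet_derivative \<eta> (at x) (axis \<beta> 1) *\<^sub>R (\<phi> k x - c) $ i :: complex^2^'n)" for x
  define \<psi> where "\<psi> x = \<eta> x *\<^sub>R (\<phi> k x - c)" for x
  let ?p = "p2 k a (2 * r)"
  define s where "s = B0 * w"
  define b where "b = Lam\<^sup>2 * (2 * cutC / r)\<^sup>2 / (4 * s)"
  \<comment> \<open>The sum of all error terms: Young's inequality with weight
    \<open>lam / 4\<close> for the approximation error and with weight \<open>s\<close> for the
    annular term, where \<open>b\<close> is the coefficient then left on the Poincare term.\<close>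
  define R where "R x = lam / 4 * (indicator ?K2 x * g2 x) + Lam\<^sup>2 / lam * e2 k x
     + s * (indicator ?K2 x * g2 x - indicator ?K1 x * g2 x) + b * ?p x" for x
  have s: "0 < s" using B0_pos w(2) by (simp add: s_def)
  have K12: "?K1 \<subseteq> ?K2" using r by (intro kube_mono) simp
  have \<psi>_test: "smooth_on UNIV \<psi>" "compact (tsupp \<psi>)" "tsupp \<psi> \<subseteq> \<Omega>"
    using test_function[OF \<phi>_smooth \<Omega> sub r, of k c] unfolding \<psi>_def \<eta>_def by auto
  have F0: "(\<integral>x. form A x (Du x) (Dmat \<psi> x) \<partial>M) = 0"
    using sol \<psi>_test unfolding weak_solution_def by blast
  have D\<psi>: "Dmat \<psi> x = \<eta> x *\<^sub>R Dmat (\<phi> k) x + T x" if "x \<in> \<Omega>" for x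
    using Dmat_product[OF Ck_subset[OF Ck_cutoff] \<phi>_Ck that, of a r k c] unfolding \<psi>_def \<eta>_def T_def by simp
  have \<eta>: "0 \<le> \<eta> x" "\<eta> x \<le> 1" "x \<in> ?K1 \<Longrightarrow> \<eta> x = 1" "x \<notin> ?K2 \<Longrightarrow> \<eta> x = 0" for x
    using cutoff_bounds cutoff_1[OF r] cutoff_0[OF r] by (auto simp: \<eta>_def)
  have T: "norm (msqrt (V x) ** T x) \<le> 2 * cutC / r * norm (msqrt (V x) *v (\<phi> k x - c))"
     "x \<in> ?K1 \<Longrightarrow> T x = 0" "x \<notin> ?K2 \<Longrightarrow> T x = 0" for x
  proof -
    have "\<bar>frechet_derivative \<eta> (at x) (axis \<beta> 1)\<bar> \<le> cutC / r" for \<beta>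
      using cutC(2) r by (simp add: \<eta>_def cutoff_deriv abs_mult divide_right_mono)
    then have "(\<Sum>\<beta>\<in>UNIV. \<bar>frechet_derivative \<eta> (at x) (axis \<beta> 1)\<bar>) \<le> of_nat (card (UNIV::2 set)) * (cutC / r)"
      by (intro sum_bounded_above) auto
    then show "norm (msqrt (V x) ** T x) \<le> 2 * cutC / r * norm (msqrt (V x) *v (\<phi> k x - c))"
      unfolding T_def by (intro order_trans[OF norm_rank_one] mult_right_mono) auto
    show "x \<in> ?K1 \<Longrightarrow> T x = 0" "x \<notin> ?K2 \<Longrightarrow> T x = 0"
      using cutoff_deriv_0[OF r] by (simp_all add: T_def \<eta>_def vec_eq_iff)
  qed
  \<comment> \<open>The first bound is the one to integrate. The second yields integrability of the
    form, without which a vanishing integral would carry no information, as the Bochner integral of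
    a nonintegrable function is 0.\<close>
  have ptw: "AE x in M. lam * (indicator ?K1 x * g2 x) \<le> Re (form A x (Du x) (Dmat \<psi> x)) + R x
      \<and> cmod (form A x (Du x) (Dmat \<psi> x)) \<le> Lam * g2 x + R x"
  proof -
    have "AE x in M. (\<forall>\<eta>. lam * (frob (msqrt (V x) ** \<eta>))\<^sup>2 \<le> Re (form A x \<eta> \<eta>)) \<and>
        (\<forall>\<eta> \<nu>. cmod (form A x \<nu> \<eta>) \<le> Lam * frob (msqrt (V x) ** \<eta>) * frob (msqrt (V x) ** \<nu>))"
      using ell \<Omega>_sets(1) unfolding elliptic_def by (subst AE_restrict_space_iff) auto
    moreover have "AE x in M. x \<in> \<Omega>" by (rule AE_I2) (simp add: space_restrict_space)
    ultimately show ?thesis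
    proof eventually_elim
      case (elim x)
      let ?S = "msqrt (V x)"
      let ?P = "Dmat (\<phi> k) x"
      let ?f = "form A x (Du x)"
      have E1: "lam * (norm (?S ** \<eta>))\<^sup>2 \<le> Re (form A x \<eta> \<eta>)" for \<eta> using elim by (simp add: frob_eq_norm)
      have E2: "cmod (?f \<eta>) \<le> Lam * norm (?S ** Du x) * norm (?S ** \<eta>)" for \<eta>
        using elim(1) by (simp add: frob_eq_norm mult_ac)
      \<comment> \<open>Ellipticity controls the form at \<open>\<eta> x *\<^sub>R Du x\<close> and
        the equation controls it at \<open>Dmat \<psi> x\<close>; the two differ by the
        approximation error and the cutoff term.\<close>
      have eq: "?f (\<eta> x *\<^sub>R Du x) = ?f (Dmat \<psi> x) + ?f (\<eta> x *\<^sub>R (Du x - ?P)) - ?f (T x)"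
        unfolding D\<psi>[OF elim(2)] by (simp add: form_add_right[symmetric] algebra_simps)
      have b1: "cmod (?f (\<eta> x *\<^sub>R (Du x - ?P))) \<le> lam / 4 * (indicator ?K2 x * g2 x) + Lam\<^sup>2 / lam * e2 k x"
      proof (cases "x \<in> ?K2")
        case True
        have "cmod (?f (\<eta> x *\<^sub>R (Du x - ?P))) \<le> Lam * norm (?S ** Du x) * norm (?S ** (\<eta> x *\<^sub>R (Du x - ?P)))" by (rule E2)
        also have "\<dots> \<le> Lam * norm (?S ** Du x) * norm (?S ** (Du x - ?P))"
          using \<eta>[of x] Lam by (intro mult_left_mono) (auto simp: matrix_mult_scaleR_right mult_left_le_one_le)
        also have "\<dots> \<le> lam / 4 * g2 x + Lam\<^sup>2 / (4 * (lam / 4)) * e2 k x"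
          unfolding g2_def e2_def using lam Lam by (intro young_ineq) auto
        finally show ?thesis using True by simp
      next
        case False
        then have "?f (\<eta> x *\<^sub>R (Du x - ?P)) = 0" using \<eta>(4)[OF False] by (simp add: form_scaleR_right del: scale_zero_left)
        then show ?thesis using False lam nonneg_2(3)[of k x] by simp
      qed
      have b2: "cmod (?f (T x)) \<le> s * (indicator ?K2 x * g2 x - indicator ?K1 x * g2 x) + b * ?p x"
      proof (cases "x \<in> ?K2 - ?K1")
        case True
        have "cmod (?f (T x)) \<le> Lam * norm (?S ** Du x) * norm (?S ** T x)" by (rule E2)
        also have "\<dots> \<le> Lam * norm (?S ** Du x) * (2 * cutC / r * norm (?S *v (\<phi> k x - c)))"
          using T(1)[of x] Lam by (intro mult_left_mono) auto
        also have "\<dots> \<le> s * g2 x + Lam\<^sup>2 / (4 * s) * (2 * cutC / r * norm (?S *v (\<phi> k x - c)))\<^sup>2"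
          unfolding g2_def using s Lam by (intro young_ineq) auto
        also have "Lam\<^sup>2 / (4 * s) * (2 * cutC / r * norm (?S *v (\<phi> k x - c)))\<^sup>2 = b * ?p x"
          using True by (simp add: b_def p2_def c_def power_mult_distrib power_divide mult_ac)
        finally show ?thesis using True by simp
      next
        case False
        then have "T x = 0" using T(2,3) by blast
        then have "?f (T x) = 0" by (simp add: form_def)
        moreover have "indicator ?K2 x * g2 x - indicator ?K1 x * g2 x = 0"
          using False K12 by (auto simp: indicator_def)
        moreover have "0 \<le> b * ?p x" using s by (simp add: b_def p2_def)
        ultimately show ?thesis by (simp only: norm_zero mult_zero_right add_0_left)
      qed
      have "lam * (indicator ?K1 x * g2 x) \<le> \<eta> x * (lam * (norm (?S ** Du x))\<^sup>2)"
        using \<eta>[of x] lam by (cases "x \<in> ?K1") (auto simp: g2_def)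
      also have "\<dots> \<le> \<eta> x * Re (?f (Du x))" using E1 \<eta>(1) by (rule mult_left_mono)
      also have "\<dots> = Re (?f (\<eta> x *\<^sub>R Du x))" by (simp add: form_scaleR_right)
      also have "\<dots> \<le> Re (?f (Dmat \<psi> x)) + cmod (?f (\<eta> x *\<^sub>R (Du x - ?P))) + cmod (?f (T x))"
        unfolding eq using abs_Re_le_cmod[of "?f (\<eta> x *\<^sub>R (Du x - ?P))"] abs_Re_le_cmod[of "?f (T x)"] by simp
      also have "\<dots> \<le> Re (?f (Dmat \<psi> x)) + R x" using b1 b2 by (simp add: R_def)
      finally have one: "lam * (indicator ?K1 x * g2 x) \<le> Re (?f (Dmat \<psi> x)) + R x" .
      have "?f (Dmat \<psi> x) = ?f (\<eta> x *\<^sub>R Du x) - ?f (\<eta> x *\<^sub>R (Du x - ?P)) + ?f (T x)" using eq by simp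
      then have "cmod (?f (Dmat \<psi> x)) \<le> cmod (?f (\<eta> x *\<^sub>R Du x)) + cmod (?f (\<eta> x *\<^sub>R (Du x - ?P))) + cmod (?f (T x))"
        using norm_triangle_ineq[of "?f (\<eta> x *\<^sub>R Du x) - ?f (\<eta> x *\<^sub>R (Du x - ?P))" "?f (T x)"]
          norm_triangle_ineq4[of "?f (\<eta> x *\<^sub>R Du x)" "?f (\<eta> x *\<^sub>R (Du x - ?P))"] by simp
      moreover have "cmod (?f (\<eta> x *\<^sub>R Du x)) \<le> Lam * g2 x"
      proof -
        have "cmod (?f (\<eta> x *\<^sub>R Du x)) = \<eta> x * cmod (?f (Du x))" using \<eta>(1) by (simp add: form_scaleR_right)
        also have "\<dots> \<le> 1 * (Lam * norm (?S ** Du x) * norm (?S ** Du x))"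
          using \<eta> E2 by (intro mult_mono) auto
        finally show ?thesis by (simp add: g2_def power2_eq_square mult.assoc)
      qed
      ultimately have "cmod (?f (Dmat \<psi> x)) \<le> Lam * g2 x + R x" using b1 b2 by (simp add: R_def)
      with one show ?case by simp
    qed
  qed
  note intK = integrable_indicator_mult[OF g2_integrable]
  note p2b = p2_bound[OF _ sub, of k]
  have r2: "0 < 2 * r" using r by simp
  have intR: "integrable M R"
    unfolding R_def
    by (intro Bochner_Integration.integrable_add Bochner_Integration.integrable_diff integrable_mult_right intK
        e2_integrable p2b(1)[OF r2])
  have D\<psi>_meas: "Dmat \<psi> \<in> borel_measurable M"
    by (rule continuous_M[OF Ck_1_continuous_Dmat[OF Ck_subset[OF spec[OF \<psi>_test(1)[unfolded smooth_on_def]]]]]) simp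
  have intF: "integrable M (\<lambda>x. form A x (Du x) (Dmat \<psi> x))"
  proof (rule Bochner_Integration.integrable_bound)
    show "integrable M (\<lambda>x. Lam * g2 x + R x)" using intR g2_integrable by simp
    show "AE x in M. norm (form A x (Du x) (Dmat \<psi> x)) \<le> norm (Lam * g2 x + R x)"
      using ptw by eventually_elim auto
  qed (rule form_measurable[OF D\<psi>_meas])
  have "lam * E a r = (\<integral>x. lam * (indicator ?K1 x * g2 x) \<partial>M)" by (simp add: E_def)
  also have "\<dots> \<le> (\<integral>x. Re (form A x (Du x) (Dmat \<psi> x)) + R x \<partial>M)"
    using ptw intR intF
    by (intro integral_mono_AE) (auto intro: integrable_mult_right intK elim: eventually_mono)
  also have "\<dots> = (\<integral>x. R x \<partial>M)"
    using intR intF F0 by (subst Bochner_Integration.integral_add) (auto simp: integral_Re)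
  also have "\<dots> = lam / 4 * E a (2 * r) + Lam\<^sup>2 / lam * err k
      + s * (E a (2 * r) - E a r) + b * (\<integral>x. ?p x \<partial>M)"
    unfolding R_def E_def using intK e2_integrable p2b(1)[OF r2]
    by simp
  also have "b * (\<integral>x. ?p x \<partial>M) \<le> lam / 4 * E a (2 * r) + lam / 4 * err k"
  proof -
    have "(\<integral>x. indicator ?K2 x * h2 k x \<partial>M) \<le> (\<integral>x. 2 * (indicator ?K2 x * g2 x) + 2 * e2 k x \<partial>M)"
      using ineq_2(2)[of k] nonneg_2
      by (intro integral_mono integrable_indicator_mult h2_integrable Bochner_Integration.integrable_add
          integrable_mult_right intK e2_integrable) (auto simp: indicator_def)
    also have "\<dots> = 2 * E a (2 * r) + 2 * err k"
      using intK e2_integrable by (simp add: E_def)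
    finally have hh: "(\<integral>x. indicator ?K2 x * h2 k x \<partial>M) \<le> 2 * E a (2 * r) + 2 * err k" .
    have "(\<integral>x. ?p x \<partial>M) \<le> 16384 * (2 * r)\<^sup>2 * w * (\<integral>x. indicator ?K2 x * h2 k x \<partial>M)"
      by (rule p2b(2)[OF r2])
    also have "\<dots> \<le> 16384 * (2 * r)\<^sup>2 * w * (2 * E a (2 * r) + 2 * err k)"
      using hh w(2) by (intro mult_left_mono) auto
    finally have "b * (\<integral>x. ?p x \<partial>M) \<le> b * (16384 * (2 * r)\<^sup>2 * w * (2 * E a (2 * r) + 2 * err k))"
      using s by (intro mult_left_mono) (auto simp: b_def)
    also have "\<dots> = (b * (16384 * (2 * r)\<^sup>2 * w) * 2) * (E a (2 * r) + err k)"
      by (simp add: algebra_simps)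
    \<comment> \<open>With \<open>s = B0 * w\<close> the powers of \<open>r\<close> and
      \<open>w\<close> cancel. The left side equals \<open>131072 * Lam^2 * cutC^2 / B0\<close>, and
      \<open>hole_const\<close> is chosen to make this \<open>lam / 4\<close>.\<close>
    also have "b * (16384 * (2 * r)\<^sup>2 * w) * 2 = lam / 4"
      using lam Lam cutC(1) w(2) r by (simp add: b_def s_def hole_const_def power_mult_distrib power_divide field_simps)
    finally show ?thesis by (simp add: algebra_simps)
  qed
  finally show ?thesis by (simp add: s_def algebra_simps)
qed

text \<open>Only the error depends on \<open>k\<close>, so the limit removes it, and moving the
  inner energy to the left fills the hole. The quotient of the two coefficients lies below 1 by an
  amount of order \<open>1 / w\<close>.\<close>

lemma hole_filling:
  assumes r: "0 < r" and sub: "kube a (2 * r) \<subseteq> \<Omega>"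
  shows "(lam + B0 * w) * E a r \<le> (lam / 2 + B0 * w) * E a (2 * r)"
proof -
  have "lam * E a r \<le> lam / 2 * E a (2 * r) + B0 * w * (E a (2 * r) - E a r) + (Lam\<^sup>2 / lam + lam / 4) * 0"
    by (rule LIMSEQ_le_const[OF tendsto_add[OF tendsto_const tendsto_mult[OF tendsto_const e2_tendsto]]])
      (use hole_filling_k[OF assms] in auto)
  then show ?thesis by (simp add: algebra_simps)
qed

end


section \<open>Energy decay and Morrey's estimate\<close>

lemma ennreal_le_sqrtI:
  assumes "(x::ennreal)\<^sup>2 \<le> ennreal y"
  shows "x \<le> ennreal (sqrt y)"
proof (cases "0 \<le> y")
  case True
  show ?thesis
  proof (cases x)
    case (real r)
    then have "r\<^sup>2 \<le> y" using assms True by (simp add: ennreal_power ennreal_le_iff)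
    then show ?thesis using real by (simp add: ennreal_leI real_le_rsqrt)
  next
    case top
    then show ?thesis using assms by (simp add: ennreal_top_mult power2_eq_square top_unique)
  qed
next
  case False
  then have "ennreal y = 0" by (simp add: ennreal_neg)
  then have "x = 0" using assms by simp
  then show ?thesis by simp
qed

text \<open>The step is required for all radii between \<open>\<rho> / 2\<close> and
  \<open>\<rho>\<close> and not only for halves, so the geometric series controls a limit over all
  radii, as \<open>rep\<close> demands, and not just along one sequence.\<close>

lemma dyadic_limit:
  fixes f :: "real \<Rightarrow> 'a::banach"
  assumes \<rho>0: "0 < \<rho>0" and \<epsilon>: "0 < \<epsilon>" and Q: "0 \<le> Q"
    and step: "\<And>\<rho> \<rho>'. 0 < \<rho> \<Longrightarrow> \<rho> \<le> \<rho>0 \<Longrightarrow> \<rho> / 2 \<le> \<rho>' \<Longrightarrow> \<rho>' \<le> \<rho> \<Longrightarrow> norm (f \<rho>' - f \<rho>) \<le> Q * \<rho> powr \<epsilon>"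
  obtains l where "(f \<longlongrightarrow> l) (at_right 0)" "norm (l - f \<rho>0) \<le> Q / (1 - 2 powr - \<epsilon>) * \<rho>0 powr \<epsilon>"
proof -
  \<comment> \<open>\<open>T\<close> is the sum of the geometric series, the solution of
    \<open>Q + T * 2 powr - \<epsilon> = T\<close>; this identity closes the induction in
    \<open>claim\<close>.\<close>
  define T where "T = Q / (1 - 2 powr - \<epsilon>)"
  have p2: "2 powr - \<epsilon> < 1" using \<epsilon> by (simp add: powr_less_one)
  have "T * (1 - 2 powr - \<epsilon>) = Q" using p2 \<epsilon> by (simp add: T_def)
  then have T: "0 \<le> T" "Q + T * 2 powr - \<epsilon> = T"
    using p2 Q by (auto simp: T_def right_diff_distrib)
  have QT: "Q \<le> T" using T by (metis add_increasing2 mult_nonneg_nonneg order_refl powr_ge_zero)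
  have claim: "norm (f \<rho>' - f \<rho>) \<le> T * \<rho> powr \<epsilon>"
    if "0 < \<rho>'" "\<rho>' \<le> \<rho>" "\<rho> \<le> \<rho>0" "\<rho> \<le> 2 ^ Suc n * \<rho>'" for \<rho> \<rho>' n
    using that
  proof (induction n arbitrary: \<rho>)
    case 0
    then have "norm (f \<rho>' - f \<rho>) \<le> Q * \<rho> powr \<epsilon>" by (intro step) auto
    then show ?case using QT by (meson mult_right_mono order_trans powr_ge_zero)
  next
    case (Suc n)
    show ?case
    proof (cases "\<rho> / 2 \<le> \<rho>'")
      case True
      then have "norm (f \<rho>' - f \<rho>) \<le> Q * \<rho> powr \<epsilon>" using Suc.prems by (intro step) auto
      then show ?thesis using QT by (meson mult_right_mono order_trans powr_ge_zero)
    next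
      case False
      have \<rho>: "0 < \<rho>" using Suc.prems by linarith
      have "norm (f \<rho>' - f \<rho>) \<le> norm (f \<rho>' - f (\<rho> / 2)) + norm (f (\<rho> / 2) - f \<rho>)"
        using norm_triangle_ineq[of "f \<rho>' - f (\<rho> / 2)" "f (\<rho> / 2) - f \<rho>"] by simp
      also have "\<dots> \<le> T * (\<rho> / 2) powr \<epsilon> + Q * \<rho> powr \<epsilon>"
        using Suc.prems False \<rho> by (intro add_mono Suc.IH step) auto
      also have "(\<rho> / 2) powr \<epsilon> = 2 powr - \<epsilon> * \<rho> powr \<epsilon>"
        using \<rho> by (simp add: powr_divide powr_minus_divide)
      also have "T * (2 powr - \<epsilon> * \<rho> powr \<epsilon>) + Q * \<rho> powr \<epsilon> = (Q + T * 2 powr - \<epsilon>) * \<rho> powr \<epsilon>"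
        by (simp add: algebra_simps)
      finally show ?thesis by (simp only: T(2))
    qed
  qed
  have all: "norm (f \<rho>' - f \<rho>) \<le> T * \<rho> powr \<epsilon>" if h: "0 < \<rho>'" "\<rho>' \<le> \<rho>" "\<rho> \<le> \<rho>0" for \<rho> \<rho>'
  proof -
    obtain n where "\<rho> / \<rho>' < 2 ^ n" using real_arch_pow[of 2 "\<rho> / \<rho>'"] by auto
    then have "\<rho> < 2 ^ n * \<rho>'" using h by (simp add: divide_less_eq)
    also have "\<dots> \<le> 2 ^ Suc n * \<rho>'" using h by simp
    finally have "\<rho> \<le> 2 ^ Suc n * \<rho>'" by simp
    from claim[OF h this] show ?thesis .
  qed
  have pow0: "((\<lambda>\<rho>. T * \<rho> powr \<epsilon>) \<longlongrightarrow> 0) (at_right 0)"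
  proof -
    have "((\<lambda>\<rho>::real. \<rho> powr \<epsilon>) \<longlongrightarrow> 0 powr \<epsilon>) (at_right 0)"
      using \<epsilon> by (intro tendsto_powr') (auto simp: eventually_at_right_field intro!: tendsto_ident_at exI[of _ 1])
    then show ?thesis using tendsto_mult[OF tendsto_const[of T], of "\<lambda>\<rho>. \<rho> powr \<epsilon>" "0 powr \<epsilon>"] by simp
  qed
  define X where "X n = f (\<rho>0 / 2 ^ n)" for n
  have seq: "filterlim (\<lambda>n. \<rho>0 / 2 ^ n) (at_right 0) sequentially"
  proof -
    have "(\<lambda>n. \<rho>0 * (1 / 2) ^ n) \<longlonglongrightarrow> \<rho>0 * 0"
      by (intro tendsto_mult tendsto_const LIMSEQ_realpow_zero) auto
    then have "(\<lambda>n. \<rho>0 / 2 ^ n) \<longlonglongrightarrow> 0" by (simp add: power_one_over)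
    then show ?thesis using \<rho>0 by (simp add: filterlim_at eventually_sequentially)
  qed
  have "Cauchy X"
  proof (rule metric_CauchyI)
    fix e :: real assume e: "0 < e"
    have "eventually (\<lambda>n. T * (\<rho>0 / 2 ^ n) powr \<epsilon> < e / 2) sequentially"
      by (rule order_tendstoD(2)[OF filterlim_compose[OF pow0 seq]]) (use e in simp)
    then obtain N where N: "T * (\<rho>0 / 2 ^ N) powr \<epsilon> < e / 2" by (auto simp: eventually_sequentially)
    have d: "dist (X n) (X N) < e / 2" if "N \<le> n" for n
    proof -
      have "norm (X n - X N) \<le> T * (\<rho>0 / 2 ^ N) powr \<epsilon>"
        unfolding X_def using \<rho>0 that by (intro all) (auto simp: divide_simps power_increasing)
      then show ?thesis using N by (simp add: dist_norm)
    qed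
    have "dist (X m) (X n) < e" if "N \<le> m" "N \<le> n" for m n
      using dist_triangle2[of "X m" "X n" "X N"] d[OF that(1)] d[OF that(2)] by simp
    then show "\<exists>M. \<forall>m\<ge>M. \<forall>n\<ge>M. dist (X m) (X n) < e" by blast
  qed
  then obtain l where l: "X \<longlonglongrightarrow> l" using Cauchy_convergent_iff convergent_def by blast
  have lb: "norm (l - f \<rho>) \<le> T * \<rho> powr \<epsilon>" if \<rho>: "0 < \<rho>" "\<rho> \<le> \<rho>0" for \<rho>
  proof (rule LIMSEQ_le_const2)
    show "(\<lambda>n. norm (X n - f \<rho>)) \<longlonglongrightarrow> norm (l - f \<rho>)" by (intro tendsto_intros l)
    have "eventually (\<lambda>n. \<rho>0 / 2 ^ n < \<rho>) sequentially"
      using seq \<rho>(1) by (auto simp: filterlim_at intro: order_tendstoD)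
    then obtain N where "\<And>n. N \<le> n \<Longrightarrow> \<rho>0 / 2 ^ n < \<rho>" by (auto simp: eventually_sequentially)
    then show "\<exists>N. \<forall>n\<ge>N. norm (X n - f \<rho>) \<le> T * \<rho> powr \<epsilon>"
      unfolding X_def using \<rho> \<rho>0 by (intro exI[of _ N] allI impI all) (auto intro: less_imp_le)
  qed
  have "(f \<longlongrightarrow> l) (at_right 0)"
  proof -
    have "eventually (\<lambda>\<rho>. norm (f \<rho> - l) \<le> T * \<rho> powr \<epsilon>) (at_right 0)"
      using \<rho>0 lb by (auto simp: eventually_at_right_field norm_minus_commute intro!: exI[of _ \<rho>0])
    from Lim_null_comparison[OF this pow0] show ?thesis by (rule LIM_zero_cancel)
  qed
  then show ?thesis using that lb[OF \<rho>0] unfolding T_def by blast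
qed

section \<open>The norm of the inverse root and its local square integrability\<close>

context A2_kernel
begin

text \<open>By \<open>mnorm_msqrt_inv\<close> this is the function whose square is integrated in
  \<open>Cxy\<close>. As a ratio against the identity it inherits the measurability and the bounds
  of \<open>sqrt_ratio\<close>.\<close>

definition invw :: "real^2 \<Rightarrow> real" where
  "invw x = sqrt_ratio (mat 1) (V x)"

lemma invw_meas: "invw \<in> borel_measurable borel"
  unfolding invw_def by (intro borel_measurable_sqrt_ratio pd pos_def_mat_1) measurable

lemma invw_nonneg: "0 \<le> invw x"
  by (simp add: invw_def sqrt_ratio_nonneg)

lemma norm_le_invw_vec: "norm v \<le> invw x * norm (msqrt (V x) *v v)"
  using sqrt_ratio_vec[OF pd, of "mat 1" v x] by (simp add: invw_def msqrt_mat_1)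

lemma norm_le_invw_mat: "norm (G::complex^2^'n) \<le> invw x * norm (msqrt (V x) ** G)"
  using sqrt_ratio_mat[OF pd, of "mat 1" G x] by (simp add: invw_def msqrt_mat_1)

text \<open>Since the double integral over the cube is finite, the inner integral is finite for some
  single \<open>x\<close>. With that \<open>x\<close> frozen, \<open>sqrt_ratio_trans\<close> bounds
  \<open>invw y\<close> by a constant times the kernel at (x, y).\<close>

lemma invw_locally_finite:
  assumes fin: "A2_char V < top" and r: "0 < r"
  shows "(\<integral>\<^sup>+x. ennreal ((invw x)\<^sup>2) * indicator (kube a r) x \<partial>lborel) < top"
proof -
  let ?I = "\<lambda>x. indicator (kube a r) x :: ennreal"
  define k where "k x y = ennreal ((sqrt_ratio (V x) (V y))\<^sup>2)" for x y
  have kp [measurable]: "(\<lambda>p. k (fst p) (snd p)) \<in> borel_measurable (borel \<Otimes>\<^sub>M borel)"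
    unfolding k_def by (intro borel_measurable_sqrt_ratio_sq pd) measurable
  have km [measurable]: "k x \<in> borel_measurable borel" for x
    unfolding k_def by (intro borel_measurable_sqrt_ratio_sq pd) measurable
  define F where "F x = (\<integral>\<^sup>+y. k x y * ?I y \<partial>lborel)" for x
  have [measurable]: "F \<in> borel_measurable borel"
    unfolding F_def
    using lborel.borel_measurable_nn_integral[of "\<lambda>x y. k x y * ?I y" borel] kp
    by (simp add: split_beta' measurable_lborel1)
  have "(\<integral>\<^sup>+x. F x * ?I x \<partial>lborel) \<le> ennreal (16 * r^4) * A2_char V"
    using A2_kube[OF r, of V a] unfolding F_def k_def .
  also have "\<dots> < top" using fin by (simp add: ennreal_mult_less_top)
  finally have "(\<integral>\<^sup>+x. F x * ?I x \<partial>lborel) \<noteq> \<infinity>" by simp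
  then have ae: "AE x in lborel. F x * ?I x \<noteq> \<infinity>"
    by (intro nn_integral_noteq_infinite) measurable
  have "\<exists>x\<in>kube a r. F x \<noteq> \<infinity>"
  proof (rule ccontr)
    assume "\<not> ?thesis"
    then have "AE x in lborel. x \<notin> kube a r" using ae by (auto elim!: eventually_mono)
    then have "emeasure lborel (kube a r) = 0"
      by (subst (asm) AE_iff_measurable[of "kube a r"]) auto
    then show False using emeasure_kube[of r a] r by simp
  qed
  then obtain x where x: "F x \<noteq> \<infinity>" by blast
  have "(\<integral>\<^sup>+y. ennreal ((invw y)\<^sup>2) * ?I y \<partial>lborel) \<le> (\<integral>\<^sup>+y. ennreal ((invw x)\<^sup>2) * (k x y * ?I y) \<partial>lborel)"
  proof (rule nn_integral_mono)
    fix y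
    have "(invw y)\<^sup>2 \<le> (invw x * sqrt_ratio (V x) (V y))\<^sup>2"
      unfolding invw_def by (intro power_mono sqrt_ratio_trans pd sqrt_ratio_nonneg)
    then have "ennreal ((invw y)\<^sup>2) \<le> ennreal ((invw x)\<^sup>2) * k x y"
      unfolding k_def by (subst ennreal_mult[symmetric]) (auto simp: power_mult_distrib intro!: ennreal_leI)
    then show "ennreal ((invw y)\<^sup>2) * ?I y \<le> ennreal ((invw x)\<^sup>2) * (k x y * ?I y)"
      by (auto simp: indicator_def)
  qed
  also have "\<dots> = ennreal ((invw x)\<^sup>2) * F x" unfolding F_def by (rule nn_integral_cmult) measurable
  also have "\<dots> < top" using x by (simp add: ennreal_mult_less_top less_top)
  finally show ?thesis .
qed

end

section \<open>Decay of the energy and convergence of the means\<close>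

context A2_solution
begin

text \<open>Each doubling of the cube inside the domain gains the factor of
  \<open>hole_filling\<close>. The process stops once \<open>2 * s\<close> reaches \<open>R\<close>,
  where the total energy is the bound; the 2 in \<open>2 * s / R\<close> pays for the last,
  incomplete doubling.\<close>

lemma E_decay:
  assumes R: "0 < R" and sub: "kube x R \<subseteq> \<Omega>" and \<kappa>: "0 \<le> \<kappa>"
    and q: "(lam / 2 + B0 * w) / (lam + B0 * w) \<le> 2 powr - \<kappa>" and s: "0 < s"
  shows "E x s \<le> (2 * s / R) powr \<kappa> * (\<integral>x. g2 x \<partial>M)"
proof -
  let ?E0 = "\<integral>x. g2 x \<partial>M"
  have E0: "0 \<le> ?E0" by (rule Bochner_Integration.integral_nonneg) (simp add: nonneg_2)
  have den: "0 < lam + B0 * w" using lam B0_pos w(2) by (simp add: add_pos_pos)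
  have big: "E x s \<le> (2 * s / R) powr \<kappa> * ?E0" if "R \<le> 2 * s" for s
  proof -
    have "1 \<le> (2 * s / R) powr \<kappa>" using R \<kappa> that by (intro ge_one_powr_ge_zero) auto
    then have "1 * ?E0 \<le> (2 * s / R) powr \<kappa> * ?E0" using E0 by (rule mult_right_mono)
    then show ?thesis using E_le_total[of x s] by simp
  qed
  have "R \<le> 2 ^ Suc n * s \<Longrightarrow> 0 < s \<Longrightarrow> E x s \<le> (2 * s / R) powr \<kappa> * ?E0" for n s
  proof (induction n arbitrary: s)
    case 0
    then show ?case using big by simp
  next
    case (Suc n)
    show ?case
    proof (cases "R \<le> 2 * s")
      case False
      then have "kube x (2 * s) \<subseteq> \<Omega>" using sub kube_mono[of "2 * s" R x] by auto
      then have "(lam + B0 * w) * E x s \<le> (lam / 2 + B0 * w) * E x (2 * s)"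
        using Suc.prems by (intro hole_filling)
      then have "E x s \<le> (lam / 2 + B0 * w) / (lam + B0 * w) * E x (2 * s)"
        using den by (simp add: field_simps)
      also have "\<dots> \<le> 2 powr - \<kappa> * ((2 * (2 * s) / R) powr \<kappa> * ?E0)"
        using q Suc E_nonneg by (intro mult_mono Suc.IH) auto
      also have "(2 * (2 * s) / R) powr \<kappa> = 2 powr \<kappa> * (2 * s / R) powr \<kappa>"
        using Suc.prems R by (simp add: powr_mult[symmetric])
      finally show ?thesis by (simp add: powr_minus mult.assoc[symmetric])
    qed (rule big)
  qed
  moreover obtain n where "R / s < 2 ^ n" using real_arch_pow[of 2 "R / s"] by auto
  moreover have "R \<le> 2 ^ Suc n * s" if "R / s < 2 ^ n" for n
  proof -
    have "R < 2 ^ n * s" using that s by (simp add: divide_less_eq)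
    also have "\<dots> \<le> 2 ^ Suc n * s" using s by simp
    finally show ?thesis by simp
  qed
  ultimately show ?thesis using s by blast
qed

lemma invw_M: "invw \<in> borel_measurable M"
  by (rule borel_measurable_lebesgue_on[OF invw_meas])

text \<open>The factor \<open>invw\<close> trades an unweighted integral for a weighted energy. It
  is used for gradients in \<open>bavg_phi_diff\<close> and for function values in
  \<open>bavg_tendsto\<close>.\<close>

lemma CS_weight:
  assumes B: "B \<in> sets borel" "B \<subseteq> \<Omega>" and f: "f \<in> borel_measurable M" and g: "g \<in> borel_measurable M"
    and fg: "\<And>x. f x \<le> invw x * g x" "\<And>x. 0 \<le> g x"
    and N: "(\<integral>\<^sup>+x\<in>B. ennreal ((invw x)\<^sup>2) \<partial>lborel) \<le> ennreal N" and N0: "0 \<le> N"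
    and G: "(\<integral>\<^sup>+x. ennreal ((g x)\<^sup>2) * indicator B x \<partial>M) \<le> ennreal G" "0 \<le> G"
  shows "(\<integral>\<^sup>+x. ennreal (f x) * indicator B x \<partial>M) \<le> ennreal (sqrt (N * G))"
proof (rule ennreal_le_sqrtI)
  note [measurable] = invw_M f g
  have [measurable]: "(indicator B :: _ \<Rightarrow> ennreal) \<in> borel_measurable M"
    using B(1) by (intro borel_measurable_lebesgue_on borel_measurable_indicator)
  have "(\<integral>\<^sup>+x. ennreal (f x) * indicator B x \<partial>M) \<le> (\<integral>\<^sup>+x. (ennreal (invw x) * indicator B x) * (ennreal (g x) * indicator B x) \<partial>M)"
    using fg invw_nonneg
    by (intro nn_integral_mono) (auto simp: indicator_def ennreal_mult[symmetric] intro!: ennreal_leI)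
  then have "(\<integral>\<^sup>+x. ennreal (f x) * indicator B x \<partial>M)\<^sup>2
      \<le> (\<integral>\<^sup>+x. (ennreal (invw x) * indicator B x) * (ennreal (g x) * indicator B x) \<partial>M)\<^sup>2"
    by (rule power_mono) simp
  also have "\<dots> \<le> (\<integral>\<^sup>+x. (ennreal (invw x) * indicator B x)\<^sup>2 \<partial>M) * (\<integral>\<^sup>+x. (ennreal (g x) * indicator B x)\<^sup>2 \<partial>M)"
    by (rule Cauchy_Schwarz_nn_integral) measurable
  also have "(\<integral>\<^sup>+x. (ennreal (g x) * indicator B x)\<^sup>2 \<partial>M) = (\<integral>\<^sup>+x. ennreal ((g x)\<^sup>2) * indicator B x \<partial>M)"
    using fg(2) by (intro nn_integral_cong) (simp add: indicator_def ennreal_power)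
  also have "(\<integral>\<^sup>+x. (ennreal (invw x) * indicator B x)\<^sup>2 \<partial>M) = (\<integral>\<^sup>+x\<in>B. ennreal ((invw x)\<^sup>2) \<partial>lborel)"
    unfolding nn_integral_lebesgue_on[OF \<Omega>_sets(1)] using B(2) invw_nonneg
    by (intro nn_integral_cong) (auto simp: indicator_def ennreal_power)
  also have "\<dots> * (\<integral>\<^sup>+x. ennreal ((g x)\<^sup>2) * indicator B x \<partial>M) \<le> ennreal N * ennreal G"
    by (intro mult_mono N G) auto
  also have "\<dots> = ennreal (N * G)" using N0 G(2) by (simp add: ennreal_mult)
  finally show "(\<integral>\<^sup>+x. ennreal (f x) * indicator B x \<partial>M)\<^sup>2 \<le> ennreal (N * G)" .
qed

lemma bavg_phi_diff:
  assumes B: "cball c \<sigma> \<subseteq> \<Omega>" and \<sigma>: "0 < \<sigma>"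
    and r: "\<sigma> / 2 \<le> r" "dist a c + r \<le> \<sigma>" and r': "\<sigma> / 2 \<le> r'" "dist a' c + r' \<le> \<sigma>"
    and N: "(\<integral>\<^sup>+x\<in>ball c \<sigma>. ennreal ((invw x)\<^sup>2) \<partial>lborel) \<le> ennreal N" "0 \<le> N"
  shows "norm (bavg (\<phi> k) a r - bavg (\<phi> k) a' r')
    \<le> (dist a a' + \<bar>r - r'\<bar>) * (4 / (pi * \<sigma>\<^sup>2)) * sqrt (N * (2 * E c \<sigma> + 2 * err k))"
proof -
  let ?D = "(dist a a' + \<bar>r - r'\<bar>) * (4 / (pi * \<sigma>\<^sup>2))"
  let ?B = "ball c \<sigma>"
  let ?H = "2 * E c \<sigma> + 2 * err k"
  have sub: "?B \<subseteq> \<Omega>" using B ball_subset_cball by blast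
  have e0: "0 \<le> err k" by (rule Bochner_Integration.integral_nonneg) (simp add: nonneg_2)
  have H0: "0 \<le> ?H" using e0 E_nonneg[of c \<sigma>] by simp
  have D0: "0 \<le> ?D" using \<sigma> by simp
  note intK = integrable_indicator_mult[OF g2_integrable]
  have int2: "integrable M (\<lambda>x. 2 * (indicator (kube c \<sigma>) x * g2 x) + 2 * e2 k x)"
    by (intro Bochner_Integration.integrable_add integrable_mult_right intK e2_integrable)
  have "(\<integral>\<^sup>+x. ennreal ((norm (msqrt (V x) ** Dmat (\<phi> k) x))\<^sup>2) * indicator ?B x \<partial>M)
      \<le> (\<integral>\<^sup>+x. ennreal (2 * (indicator (kube c \<sigma>) x * g2 x) + 2 * e2 k x) \<partial>M)"
    using ineq_2(2)[of k] nonneg_2 ball_subset_kube[of c \<sigma>]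
    by (intro nn_integral_mono) (auto simp: indicator_def h2_def[symmetric] simp del: ennreal_plus intro!: ennreal_leI)
  also have "\<dots> = ennreal (\<integral>x. 2 * (indicator (kube c \<sigma>) x * g2 x) + 2 * e2 k x \<partial>M)"
    by (rule nn_integral_eq_integral[OF int2]) (simp add: nonneg_2)
  also have "(\<integral>x. 2 * (indicator (kube c \<sigma>) x * g2 x) + 2 * e2 k x \<partial>M) = ?H"
    using intK e2_integrable by (simp add: E_def)
  finally have G: "(\<integral>\<^sup>+x. ennreal ((norm (msqrt (V x) ** Dmat (\<phi> k) x))\<^sup>2) * indicator ?B x \<partial>M) \<le> ennreal ?H" .
  have "(\<integral>\<^sup>+z\<in>?B. ennreal (norm (Dmat (\<phi> k) z)) \<partial>lborel) = (\<integral>\<^sup>+z. ennreal (norm (Dmat (\<phi> k) z)) * indicator ?B z \<partial>M)"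
    unfolding nn_integral_lebesgue_on[OF \<Omega>_sets(1)] using sub by (intro nn_integral_cong) (auto simp: indicator_def)
  also have "\<dots> \<le> ennreal (sqrt (N * ?H))"
    by (rule CS_weight[OF _ sub _ _ norm_le_invw_mat _ N G H0])
      (auto intro!: borel_measurable_norm_msqrt_mat V_M pd \<phi>_M measurable_compose[OF \<phi>_M(2)])
  finally have le: "(\<integral>\<^sup>+z\<in>?B. ennreal (norm (Dmat (\<phi> k) z)) \<partial>lborel) \<le> ennreal (sqrt (N * ?H))" .
  have "ennreal (norm (bavg (\<phi> k) a r - bavg (\<phi> k) a' r')) \<le> ennreal ?D * (\<integral>\<^sup>+z\<in>?B. ennreal (norm (Dmat (\<phi> k) z)) \<partial>lborel)"
    by (rule bavg_diff_smooth[OF \<phi>_Ck B \<sigma> r r'])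
  also have "\<dots> \<le> ennreal ?D * ennreal (sqrt (N * ?H))" by (intro mult_left_mono le) simp
  also have "\<dots> = ennreal (?D * sqrt (N * ?H))" using D0 by (rule ennreal_mult'[symmetric])
  finally show ?thesis using D0 N(2) H0 by (subst (asm) ennreal_le_iff) auto
qed

text \<open>Weighted convergence in mean square gives unweighted convergence in mean on a ball,
  because \<open>invw\<close> is square integrable there.\<close>

lemma bavg_tendsto:
  assumes B: "cball a r \<subseteq> \<Omega>" and r: "0 < r"
  shows "(\<lambda>k. bavg (\<phi> k) a r) \<longlonglongrightarrow> bavg u a r"
proof -
  let ?B = "ball a r"
  have sub: "?B \<subseteq> \<Omega>" using B ball_subset_cball by blast
  have "(\<integral>\<^sup>+x\<in>?B. ennreal ((invw x)\<^sup>2) \<partial>lborel) \<le> (\<integral>\<^sup>+x. ennreal ((invw x)\<^sup>2) * indicator (kube a r) x \<partial>lborel)"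
    using ball_subset_kube[of a r] by (intro nn_integral_mono) (auto simp: indicator_def)
  also have "\<dots> < top" by (rule invw_locally_finite[OF _ r]) (simp add: w)
  finally obtain N where N: "(\<integral>\<^sup>+x\<in>?B. ennreal ((invw x)\<^sup>2) \<partial>lborel) \<le> ennreal N" "0 \<le> N"
    by (cases "\<integral>\<^sup>+x\<in>?B. ennreal ((invw x)\<^sup>2) \<partial>lborel") auto
  define \<delta> where "\<delta> k = wL2 V \<Omega> (\<lambda>x. u x - \<phi> k x)" for k
  have \<delta>0: "\<delta> \<longlonglongrightarrow> 0" using \<phi>_u unfolding \<delta>_def .
  \<comment> \<open>The distance may be infinite for early \<open>k\<close>, where
    \<open>enn2real\<close> would return 0.\<close>
  then have ev: "eventually (\<lambda>k. \<delta> k < top) sequentially" by (rule order_tendstoD) simp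
  have est: "norm (bavg u a r - bavg (\<phi> k) a r) \<le> (1 / (pi * r\<^sup>2)) * sqrt (N * enn2real (\<delta> k))" if fin: "\<delta> k < top" for k
  proof -
    let ?L = "lebesgue_on ?B"
    let ?f = "\<lambda>x. u x - \<phi> k x"
    have fM: "?f \<in> borel_measurable M" by (intro borel_measurable_diff u_meas \<phi>_M)
    have LM: "?L = restrict_space M ?B"
      using sub by (simp add: restrict_restrict_space \<Omega>_sets Int_absorb1)
    have fL: "?f \<in> borel_measurable ?L" unfolding LM by (rule measurable_restrict_space1[OF fM])
    have "(\<integral>\<^sup>+x. ennreal ((norm (msqrt (V x) *v ?f x))\<^sup>2) * indicator ?B x \<partial>M) \<le> \<delta> k"
      unfolding \<delta>_def wL2_eq[OF \<Omega>_sets(1)] by (intro nn_integral_mono) (auto simp: indicator_def)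
    also have "\<dots> = ennreal (enn2real (\<delta> k))" using fin by simp
    finally have G: "(\<integral>\<^sup>+x. ennreal ((norm (msqrt (V x) *v ?f x))\<^sup>2) * indicator ?B x \<partial>M) \<le> ennreal (enn2real (\<delta> k))" .
    have "(\<integral>\<^sup>+x. ennreal (norm (?f x)) \<partial>?L) = (\<integral>\<^sup>+x. ennreal (norm (?f x)) * indicator ?B x \<partial>M)"
      unfolding nn_integral_lebesgue_on[OF \<Omega>_sets(1)] using sub
      by (subst nn_integral_lebesgue_on) (auto simp: indicator_def intro!: nn_integral_cong)
    also have "\<dots> \<le> ennreal (sqrt (N * enn2real (\<delta> k)))"
      by (rule CS_weight[OF _ sub _ _ norm_le_invw_vec _ N G])
        (auto intro!: borel_measurable_norm_msqrt_vec V_M pd measurable_compose[OF fM])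
    finally have le: "(\<integral>\<^sup>+x. ennreal (norm (?f x)) \<partial>?L) \<le> ennreal (sqrt (N * enn2real (\<delta> k)))" .
    have fint: "integrable ?L ?f"
      by (rule integrableI_bounded[OF fL]) (use le in \<open>auto intro: le_less_trans\<close>)
    have pint: "integrable ?L (\<phi> k)"
    proof -
      have "continuous_on (cball a r) (\<phi> k)" using Ck_1_continuous[OF \<phi>_Ck] B continuous_on_subset by blast
      then have i1: "integrable lborel (\<lambda>x. indicator (cball a r) x *\<^sub>R \<phi> k x)"
        by (intro borel_integrable_compact) auto
      have "integrable lborel (\<lambda>x. indicator ?B x *\<^sub>R (indicator (cball a r) x *\<^sub>R \<phi> k x))"
        by (rule integrable_mult_indicator[OF _ i1]) simp
      moreover have "indicator ?B x *\<^sub>R (indicator (cball a r) x *\<^sub>R \<phi> k x) = indicator ?B x *\<^sub>R \<phi> k x" for x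
        by (auto simp: indicator_def)
      ultimately have "integrable lborel (\<lambda>x. indicator ?B x *\<^sub>R \<phi> k x)" by (simp only:)
      then have "integrable lebesgue (\<lambda>x. indicator ?B x *\<^sub>R \<phi> k x)"
        by (subst integrable_completion) auto
      then show ?thesis by (subst integrable_restrict_space) auto
    qed
    have "(\<integral>x. u x \<partial>?L) = (\<integral>x. ?f x + \<phi> k x \<partial>?L)" by simp
    also have "\<dots> = (\<integral>x. ?f x \<partial>?L) + (\<integral>x. \<phi> k x \<partial>?L)"
      by (rule Bochner_Integration.integral_add[OF fint pint])
    finally have "bavg u a r - bavg (\<phi> k) a r = (1 / (pi * r\<^sup>2)) *\<^sub>R (\<integral>x. ?f x \<partial>?L)"
      using r measure_ball_2[of r a] by (simp add: bavg_def scaleR_add_right)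
    moreover have "norm (\<integral>x. ?f x \<partial>?L) \<le> sqrt (N * enn2real (\<delta> k))"
    proof -
      have "ennreal (norm (\<integral>x. ?f x \<partial>?L)) \<le> ennreal (sqrt (N * enn2real (\<delta> k)))"
        using integral_norm_bound_ennreal[OF fint] le by (rule order_trans)
      then show ?thesis using N(2) by (subst (asm) ennreal_le_iff) auto
    qed
    ultimately show ?thesis using r by (simp add: divide_right_mono)
  qed
  have "(\<lambda>k. enn2real (\<delta> k)) \<longlonglongrightarrow> 0"
    using tendsto_enn2real[of \<delta> 0] \<delta>0 by simp
  then have "(\<lambda>k. (1 / (pi * r\<^sup>2)) * sqrt (N * enn2real (\<delta> k))) \<longlonglongrightarrow> (1 / (pi * r\<^sup>2)) * sqrt (N * 0)"
    by (rule tendsto_mult[OF tendsto_const tendsto_real_sqrt[OF tendsto_mult[OF tendsto_const]]])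
  then have lim0: "(\<lambda>k. (1 / (pi * r\<^sup>2)) * sqrt (N * enn2real (\<delta> k))) \<longlonglongrightarrow> 0" by simp
  have "(\<lambda>k. bavg u a r - bavg (\<phi> k) a r) \<longlonglongrightarrow> 0"
    by (rule Lim_null_comparison[OF _ lim0]) (use ev est in \<open>auto elim!: eventually_mono\<close>)
  then have "(\<lambda>k. bavg u a r - (bavg u a r - bavg (\<phi> k) a r)) \<longlonglongrightarrow> bavg u a r - 0"
    by (intro tendsto_intros)
  then show ?thesis by simp
qed

lemma bavg_u_diff:
  assumes B: "cball c \<sigma> \<subseteq> \<Omega>" and \<sigma>: "0 < \<sigma>"
    and r: "\<sigma> / 2 \<le> r" "dist a c + r \<le> \<sigma>" and r': "\<sigma> / 2 \<le> r'" "dist a' c + r' \<le> \<sigma>"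
    and N: "(\<integral>\<^sup>+x\<in>ball c \<sigma>. ennreal ((invw x)\<^sup>2) \<partial>lborel) \<le> ennreal N" "0 \<le> N"
  shows "norm (bavg u a r - bavg u a' r')
    \<le> (dist a a' + \<bar>r - r'\<bar>) * (4 / (pi * \<sigma>\<^sup>2)) * sqrt (N * (2 * E c \<sigma>))"
proof -
  have sub: "cball p s \<subseteq> \<Omega>" if "dist p c + s \<le> \<sigma>" for p s
  proof
    fix z assume "z \<in> cball p s"
    then have "dist c z \<le> \<sigma>" using dist_triangle[of c z p] that by (simp add: dist_commute)
    then show "z \<in> \<Omega>" using B by auto
  qed
  have pos: "0 < r" "0 < r'" using r r' \<sigma> by auto
  have "(\<lambda>k. norm (bavg (\<phi> k) a r - bavg (\<phi> k) a' r')) \<longlonglongrightarrow> norm (bavg u a r - bavg u a' r')"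
    by (intro tendsto_intros bavg_tendsto sub r r' pos)
  moreover have "(\<lambda>k. (dist a a' + \<bar>r - r'\<bar>) * (4 / (pi * \<sigma>\<^sup>2)) * sqrt (N * (2 * E c \<sigma> + 2 * err k)))
     \<longlonglongrightarrow> (dist a a' + \<bar>r - r'\<bar>) * (4 / (pi * \<sigma>\<^sup>2)) * sqrt (N * (2 * E c \<sigma> + 2 * 0))"
    by (intro tendsto_intros e2_tendsto)
  ultimately have "norm (bavg u a r - bavg u a' r') \<le> (dist a a' + \<bar>r - r'\<bar>) * (4 / (pi * \<sigma>\<^sup>2)) * sqrt (N * (2 * E c \<sigma> + 2 * 0))"
    by (rule LIMSEQ_le) (use bavg_phi_diff[OF B \<sigma> r r' N] in auto)
  then show ?thesis by simp
qed

end


section \<open>Morrey's estimate\<close>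

context A2_solution
begin

text \<open>The exponent is a balance of powers of \<open>\<sigma>\<close>: displacement over area
  gives -1, the root of the area power in \<open>Cxy\<close> gives \<open>1 - \<epsilon>\<close>,
  and the root of an energy decay with exponent \<open>4 * \<epsilon>\<close> gives
  \<open>2 * \<epsilon>\<close>, in total \<open>\<epsilon>\<close>.\<close>

lemma morrey:
  assumes R: "0 < R" and B6: "ball x0 (6 * R) \<subseteq> \<Omega>" and x: "x \<in> ball x0 R" and y: "y \<in> ball x0 R"
    and xy: "x \<noteq> y" and \<epsilon>: "0 < \<epsilon>"
    and q: "(lam / 2 + B0 * w) / (lam + B0 * w) \<le> 2 powr - (4 * \<epsilon>)" and C: "0 \<le> C"
    and N: "\<And>z \<sigma>. z = x \<or> z = y \<Longrightarrow> 0 < \<sigma> \<Longrightarrow> \<sigma> \<le> 2 * dist x y \<Longrightarrow> ball z \<sigma> \<subseteq> \<Omega> \<Longrightarrow>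
      (\<integral>\<^sup>+\<xi>\<in>ball z \<sigma>. ennreal ((invw \<xi>)\<^sup>2) \<partial>lborel) \<le> ennreal (C\<^sup>2 * (pi * \<sigma>\<^sup>2) powr (1 - \<epsilon>))"
  defines "P \<equiv> 4 / pi * pi powr ((1 - \<epsilon>) / 2) * sqrt (2 * (\<integral>x. g2 x \<partial>M)) * (2 / R) powr (2 * \<epsilon>)"
  shows "norm (rep u x - rep u y) \<le> P * (2 / (1 - 2 powr - \<epsilon>) + 2 powr \<epsilon>) * R powr \<epsilon> * C * (dist x y / R) powr \<epsilon>"
proof -
  let ?d = "dist x y"
  let ?E0 = "\<integral>x. g2 x \<partial>M"
  have E0: "0 \<le> ?E0" by (rule Bochner_Integration.integral_nonneg) (simp add: nonneg_2)
  have P0: "0 \<le> P" using E0 by (simp add: P_def)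
  \<comment> \<open>Balls of radius at most \<open>2 * ?d\<close> around \<open>x\<close> and
    \<open>y\<close> thus have radius below \<open>4 * R\<close> and stay in
    \<open>ball x0 (6 * R)\<close>. The cubes for the energy fit as well, lying in balls of radius
    \<open>2 * R\<close>.\<close>
  have d: "0 < ?d" "?d < 2 * R"
    using xy x y dist_triangle2[of x y x0] by (auto simp: dist_commute)
  have zin: "z \<in> ball x0 R" if "z = x \<or> z = y" for z using x y that by auto
  have zsub: "cball z s \<subseteq> \<Omega>" if z: "z = x \<or> z = y" and s: "s < 5 * R" for z s
  proof
    fix p assume "p \<in> cball z s"
    then have "dist x0 p < 6 * R" using dist_triangle[of x0 p z] zin[OF z] s by auto
    then show "p \<in> \<Omega>" using B6 by auto
  qed
  have ksub: "kube z R \<subseteq> \<Omega>" if z: "z = x \<or> z = y" for z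
    using kube_subset_cball[of z R] zsub[OF z, of "2 * R"] R by auto
  have key: "norm (bavg u a r - bavg u a' r') \<le> P * C * \<sigma> powr \<epsilon>"
    if z: "z = x \<or> z = y" and \<sigma>: "0 < \<sigma>" "\<sigma> \<le> 2 * ?d" and r: "\<sigma> / 2 \<le> r" "dist a z + r \<le> \<sigma>"
      and r': "\<sigma> / 2 \<le> r'" "dist a' z + r' \<le> \<sigma>" and D: "dist a a' + \<bar>r - r'\<bar> \<le> \<sigma>"
    for z \<sigma> a a' r r'
  proof -
    let ?N = "C\<^sup>2 * (pi * \<sigma>\<^sup>2) powr (1 - \<epsilon>)"
    have cb: "cball z \<sigma> \<subseteq> \<Omega>" using zsub[OF z] \<sigma> d by simp
    then have b: "ball z \<sigma> \<subseteq> \<Omega>" using ball_subset_cball by blast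
    have "norm (bavg u a r - bavg u a' r') \<le> (dist a a' + \<bar>r - r'\<bar>) * (4 / (pi * \<sigma>\<^sup>2)) * sqrt (?N * (2 * E z \<sigma>))"
      by (rule bavg_u_diff[OF cb \<sigma>(1) r r' N[OF z \<sigma> b]]) simp
    also have "\<dots> \<le> \<sigma> * (4 / (pi * \<sigma>\<^sup>2)) * sqrt (?N * (2 * ((2 * \<sigma> / R) powr (4 * \<epsilon>) * ?E0)))"
      using D \<sigma> E_decay[OF R ksub[OF z] _ q \<sigma>(1)] \<epsilon> E_nonneg[of z \<sigma>]
      by (intro mult_mono real_sqrt_le_mono mult_left_mono) auto
    also have "sqrt (?N * (2 * ((2 * \<sigma> / R) powr (4 * \<epsilon>) * ?E0)))
        = C * (pi * \<sigma>\<^sup>2) powr ((1 - \<epsilon>) / 2) * ((2 * \<sigma> / R) powr (2 * \<epsilon>) * sqrt (2 * ?E0))"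
    proof -
      have sp: "sqrt (t powr p) = t powr (p / 2)" if "0 < t" for t p :: real
        using that by (simp add: powr_half_sqrt[symmetric] powr_powr)
      have "sqrt (?N * (2 * ((2 * \<sigma> / R) powr (4 * \<epsilon>) * ?E0)))
          = sqrt (C\<^sup>2) * sqrt ((pi * \<sigma>\<^sup>2) powr (1 - \<epsilon>)) * (sqrt ((2 * \<sigma> / R) powr (4 * \<epsilon>)) * sqrt (2 * ?E0))"
        by (simp add: real_sqrt_mult)
      also have "sqrt ((pi * \<sigma>\<^sup>2) powr (1 - \<epsilon>)) = (pi * \<sigma>\<^sup>2) powr ((1 - \<epsilon>) / 2)" using \<sigma> by (intro sp) simp
      also have "sqrt ((2 * \<sigma> / R) powr (4 * \<epsilon>)) = (2 * \<sigma> / R) powr (2 * \<epsilon>)" using \<sigma> R by (subst sp) auto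
      finally show ?thesis using C by simp
    qed
    also have "(pi * \<sigma>\<^sup>2) powr ((1 - \<epsilon>) / 2) = pi powr ((1 - \<epsilon>) / 2) * \<sigma> powr (1 - \<epsilon>)"
    proof -
      have "(\<sigma>\<^sup>2) powr ((1 - \<epsilon>) / 2) = \<sigma> powr (1 - \<epsilon>)"
        using \<sigma> by (simp add: powr_numeral[symmetric] powr_powr diff_divide_distrib del: powr_numeral)
      then show ?thesis using \<sigma> by (simp add: powr_mult)
    qed
    also have "(2 * \<sigma> / R) powr (2 * \<epsilon>) = (2 / R) powr (2 * \<epsilon>) * \<sigma> powr (2 * \<epsilon>)"
      using \<sigma> R by (simp add: powr_mult[symmetric])
    also have "\<sigma> * (4 / (pi * \<sigma>\<^sup>2)) * (C * (pi powr ((1 - \<epsilon>) / 2) * \<sigma> powr (1 - \<epsilon>)) *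
         ((2 / R) powr (2 * \<epsilon>) * \<sigma> powr (2 * \<epsilon>) * sqrt (2 * ?E0)))
       = P * C * ((1 / \<sigma>) * (\<sigma> powr (1 - \<epsilon>) * \<sigma> powr (2 * \<epsilon>)))"
      using \<sigma> by (simp add: P_def power2_eq_square)
    also have "(1 / \<sigma>) * (\<sigma> powr (1 - \<epsilon>) * \<sigma> powr (2 * \<epsilon>)) = \<sigma> powr \<epsilon>"
      using \<sigma> by (simp add: powr_add[symmetric]) (simp add: powr_add)
    finally show ?thesis .
  qed
  have limit: "norm (rep u z - bavg u z ?d) \<le> P * C / (1 - 2 powr - \<epsilon>) * ?d powr \<epsilon>" if z: "z = x \<or> z = y" for z
  proof -
    obtain l where l: "(bavg u z \<longlongrightarrow> l) (at_right 0)" "norm (l - bavg u z ?d) \<le> P * C / (1 - 2 powr - \<epsilon>) * ?d powr \<epsilon>"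
    proof (rule dyadic_limit[of ?d \<epsilon> "P * C" "bavg u z"])
      fix \<rho> \<rho>' assume "0 < \<rho>" "\<rho> \<le> ?d" "\<rho> / 2 \<le> \<rho>'" "\<rho>' \<le> \<rho>"
      then show "norm (bavg u z \<rho>' - bavg u z \<rho>) \<le> P * C * \<rho> powr \<epsilon>"
        using d by (intro key[OF z]) auto
    qed (use d \<epsilon> P0 C in auto)
    \<comment> \<open>\<open>Lim\<close> is a description, so the value of \<open>rep\<close> is
      known only once the limit has been shown to exist.\<close>
    have "rep u z = l"
      using tendsto_Lim[OF _ l(1)] unfolding rep_def bavg_def by simp
    then show ?thesis using l(2) by simp
  qed
  \<comment> \<open>The ball around \<open>y\<close> of radius \<open>?d\<close> lies in the ball
    around \<open>x\<close> of radius \<open>2 * ?d\<close>, the largest radius that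
    \<open>Cxy\<close> admits.\<close>
  have mid: "norm (bavg u x ?d - bavg u y ?d) \<le> P * C * (2 * ?d) powr \<epsilon>"
    using d by (intro key[of x]) (auto simp: dist_commute)
  have "norm (rep u x - rep u y) \<le> norm (rep u x - bavg u x ?d) + norm (bavg u x ?d - bavg u y ?d) + norm (rep u y - bavg u y ?d)"
    using norm_triangle_ineq4[of "rep u x - bavg u x ?d + (bavg u x ?d - bavg u y ?d)" "rep u y - bavg u y ?d"]
      norm_triangle_ineq[of "rep u x - bavg u x ?d" "bavg u x ?d - bavg u y ?d"] by simp
  also have "\<dots> \<le> P * C / (1 - 2 powr - \<epsilon>) * ?d powr \<epsilon> + P * C * (2 * ?d) powr \<epsilon> + P * C / (1 - 2 powr - \<epsilon>) * ?d powr \<epsilon>"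
    by (intro add_mono limit mid) auto
  also have "\<dots> = P * (2 / (1 - 2 powr - \<epsilon>) + 2 powr \<epsilon>) * C * ?d powr \<epsilon>"
    using d by (simp add: powr_mult algebra_simps)
  also have "?d powr \<epsilon> = R powr \<epsilon> * (?d / R) powr \<epsilon>"
    using R d(1) by (simp add: powr_divide)
  finally show ?thesis by (simp add: mult_ac)
qed

lemma Cxy_bound:
  assumes fin: "Cxy V \<Omega> \<epsilon> x y \<noteq> top"
  obtains C where "Cxy V \<Omega> \<epsilon> x y = ennreal C" "0 \<le> C"
    "\<And>z \<sigma>. z = x \<or> z = y \<Longrightarrow> 0 < \<sigma> \<Longrightarrow> \<sigma> \<le> 2 * dist x y \<Longrightarrow> ball z \<sigma> \<subseteq> \<Omega> \<Longrightarrow>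
      (\<integral>\<^sup>+\<xi>\<in>ball z \<sigma>. ennreal ((invw \<xi>)\<^sup>2) \<partial>lborel) \<le> ennreal (C\<^sup>2 * (pi * \<sigma>\<^sup>2) powr (1 - \<epsilon>))"
proof -
  let ?\<B> = "{ball c r | c r. (c = x \<or> c = y) \<and> 0 < r \<and> r \<le> 2 * dist x y \<and> ball c r \<subseteq> \<Omega>}"
  define F where "F B' = ennreal (1 / (measure lebesgue B') powr (1 - \<epsilon>)) *
      (\<integral>\<^sup>+\<xi>\<in>B'. ennreal ((mnorm (msqrt (matrix_inv (V \<xi>))))\<^sup>2) \<partial>lebesgue)" for B'
  define S where "S = (SUP B' \<in> ?\<B>. F B')"
  have CS: "Cxy V \<Omega> \<epsilon> x y = esqrt S" unfolding Cxy_def S_def F_def ..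
  then have S: "S \<noteq> top" using fin by (auto simp: esqrt_def)
  define C where "C = sqrt (enn2real S)"
  have SC: "S = ennreal (C\<^sup>2)" using S by (simp add: C_def less_top)
  show ?thesis
  proof
    show "Cxy V \<Omega> \<epsilon> x y = ennreal C" using S by (simp add: CS esqrt_def C_def)
    show "0 \<le> C" by (simp add: C_def)
    fix z \<sigma> assume z: "z = x \<or> z = y" "0 < \<sigma>" "\<sigma> \<le> 2 * dist x y" "ball z \<sigma> \<subseteq> \<Omega>"
    let ?m = "(pi * \<sigma>\<^sup>2) powr (1 - \<epsilon>)"
    let ?I = "\<integral>\<^sup>+\<xi>\<in>ball z \<sigma>. ennreal ((invw \<xi>)\<^sup>2) \<partial>lborel"
    have m: "0 < ?m" using z(2) by simp
    have "ball z \<sigma> \<in> ?\<B>" using z by blast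
    then have "F (ball z \<sigma>) \<le> S" unfolding S_def by (rule SUP_upper)
    then have "ennreal (1 / ?m) * ?I \<le> ennreal (C\<^sup>2)"
      unfolding F_def SC measure_ball_2[OF less_imp_le[OF z(2)]] nn_integral_completion mnorm_msqrt_inv invw_def .
    then have "ennreal ?m * (ennreal (1 / ?m) * ?I) \<le> ennreal ?m * ennreal (C\<^sup>2)"
      by (rule mult_left_mono) simp
    moreover have "ennreal ?m * (ennreal (1 / ?m) * ?I) = ?I"
    proof -
      have "ennreal ?m * ennreal (1 / ?m) = 1"
        using m by (subst ennreal_mult[symmetric]) auto
      then show ?thesis by (simp only: mult.assoc[symmetric] mult_1_left)
    qed
    moreover have "ennreal ?m * ennreal (C\<^sup>2) = ennreal (C\<^sup>2 * ?m)"
      using m by (subst ennreal_mult[symmetric]) (auto simp: mult.commute)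
    ultimately show "?I \<le> ennreal (C\<^sup>2 * ?m)" by simp
  qed
qed

lemma holder:
  assumes R: "0 < R" and B6: "ball x0 (6 * R) \<subseteq> \<Omega>" and \<epsilon>: "0 < \<epsilon>"
    and q: "(lam / 2 + B0 * w) / (lam + B0 * w) \<le> 2 powr - (4 * \<epsilon>)"
  shows "\<exists>K. \<forall>x\<in>ball x0 R. \<forall>y\<in>ball x0 R.
    ennreal (norm (rep u x - rep u y)) \<le> ennreal K * Cxy V \<Omega> \<epsilon> x y * ennreal ((dist x y / R) powr \<epsilon>)"
proof -
  define P where "P = 4 / pi * pi powr ((1 - \<epsilon>) / 2) * sqrt (2 * (\<integral>x. g2 x \<partial>M)) * (2 / R) powr (2 * \<epsilon>)"
  define K0 where "K0 = P * (2 / (1 - 2 powr - \<epsilon>) + 2 powr \<epsilon>) * R powr \<epsilon>"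
  \<comment> \<open>The lower bound 1 matters when \<open>Cxy\<close> is infinite: in
    \<open>ennreal\<close> a factor 0 times \<open>top\<close> would be 0.\<close>
  define K where "K = max K0 1"
  have "ennreal (norm (rep u x - rep u y)) \<le> ennreal K * Cxy V \<Omega> \<epsilon> x y * ennreal ((dist x y / R) powr \<epsilon>)"
    if x: "x \<in> ball x0 R" and y: "y \<in> ball x0 R" for x y
  proof (cases "x = y")
    case False
    then have pos: "0 < (dist x y / R) powr \<epsilon>" using R by simp
    show ?thesis
    proof (cases "Cxy V \<Omega> \<epsilon> x y = top")
      case True
      then show ?thesis using pos by (simp add: K_def ennreal_mult_top ennreal_top_mult)
    next
      case fin: False
      from Cxy_bound[OF this] obtain C where C: "Cxy V \<Omega> \<epsilon> x y = ennreal C" "0 \<le> C"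
        and N: "\<And>z \<sigma>. z = x \<or> z = y \<Longrightarrow> 0 < \<sigma> \<Longrightarrow> \<sigma> \<le> 2 * dist x y \<Longrightarrow> ball z \<sigma> \<subseteq> \<Omega> \<Longrightarrow>
          (\<integral>\<^sup>+\<xi>\<in>ball z \<sigma>. ennreal ((invw \<xi>)\<^sup>2) \<partial>lborel) \<le> ennreal (C\<^sup>2 * (pi * \<sigma>\<^sup>2) powr (1 - \<epsilon>))" by blast
      have "norm (rep u x - rep u y) \<le> K0 * C * (dist x y / R) powr \<epsilon>"
        using morrey[OF R B6 x y False \<epsilon> q C(2) N] unfolding K0_def P_def by simp
      also have "\<dots> \<le> K * C * (dist x y / R) powr \<epsilon>"
        using C(2) by (intro mult_right_mono) (auto simp: K_def)
      finally have "ennreal (norm (rep u x - rep u y)) \<le> ennreal (K * C * (dist x y / R) powr \<epsilon>)"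
        by (rule ennreal_leI)
      also have "\<dots> = ennreal K * ennreal C * ennreal ((dist x y / R) powr \<epsilon>)"
        using C(2) by (simp add: ennreal_mult K_def)
      finally show ?thesis unfolding C(1) .
    qed
  qed simp
  then show ?thesis by blast
qed

end

section \<open>Passage from the weight to its Borel version, and the choice of the exponent\<close>

lemma wL2_cong:
  assumes "AE x in lborel. W x = V x"
  shows "wL2 W \<Omega> f = wL2 V \<Omega> f"
  unfolding wL2_def nn_integral_completion using assms
  by (intro nn_integral_cong_AE) (auto elim: eventually_mono)

lemma wL2grad_cong:
  assumes "AE x in lborel. W x = V x"
  shows "wL2grad W \<Omega> f = wL2grad V \<Omega> f"
  unfolding wL2grad_def nn_integral_completion using assms
  by (intro nn_integral_cong_AE) (auto elim: eventually_mono)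

lemma Cxy_cong:
  assumes "AE x in lborel. W x = V x"
  shows "Cxy W \<Omega> \<epsilon> x y = Cxy V \<Omega> \<epsilon> x y"
proof -
  have "(\<integral>\<^sup>+\<xi>\<in>B. ennreal ((mnorm (msqrt (matrix_inv (W \<xi>))))\<^sup>2) \<partial>lebesgue)
      = (\<integral>\<^sup>+\<xi>\<in>B. ennreal ((mnorm (msqrt (matrix_inv (V \<xi>))))\<^sup>2) \<partial>lebesgue)" for B
    unfolding nn_integral_completion using assms
    by (intro nn_integral_cong_AE) (auto elim: eventually_mono)
  then show ?thesis unfolding Cxy_def by simp
qed

lemma elliptic_cong:
  assumes ae: "AE x in lborel. W x = V x" and ell: "elliptic lam Lam W \<Omega> A"
  shows "elliptic lam Lam V \<Omega> A"
proof -
  have "AE x in lebesgue. W x = V x" using AE_completion[OF ae] .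
  moreover have "AE x in lebesgue. x \<in> \<Omega> \<longrightarrow>
        (\<forall>\<eta>. lam * (frob (msqrt (W x) ** \<eta>))\<^sup>2 \<le> Re (form A x \<eta> \<eta>)) \<and>
        (\<forall>\<eta> \<nu>. cmod (form A x \<nu> \<eta>) \<le> Lam * frob (msqrt (W x) ** \<eta>) * frob (msqrt (W x) ** \<nu>))"
    using ell by (simp add: elliptic_def)
  ultimately have "AE x in lebesgue. x \<in> \<Omega> \<longrightarrow>
        (\<forall>\<eta>. lam * (frob (msqrt (V x) ** \<eta>))\<^sup>2 \<le> Re (form A x \<eta> \<eta>)) \<and>
        (\<forall>\<eta> \<nu>. cmod (form A x \<nu> \<eta>) \<le> Lam * frob (msqrt (V x) ** \<eta>) * frob (msqrt (V x) ** \<nu>))"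
    by eventually_elim simp
  then show ?thesis using ell by (simp add: elliptic_def)
qed

text \<open>The quotient falls short of 1 by \<open>lam / 2 / (lam + b * w)\<close>. This is at
  least \<open>4 * \<epsilon>\<close>, because \<open>w powr (-8)\<close> is at most
  \<open>1 / w\<close> and \<open>lam + b * w\<close> at most \<open>(lam + b) * w\<close>; the 8 in
  the denominator is 4 times the 2 of \<open>lam / 2\<close>. The passage to a power of 2 uses
  \<open>1 + t \<le> exp t\<close> and \<open>ln 2 < 1\<close>.\<close>

lemma decay_rate:
  fixes lam b w \<epsilon> :: real
  assumes lam: "0 < lam" and b: "0 < b" and w: "1 \<le> w" and \<epsilon>: "\<epsilon> = lam / (8 * (lam + b)) * w powr (-8)"
  shows "(lam / 2 + b * w) / (lam + b * w) \<le> 2 powr - (4 * \<epsilon>)"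
proof -
  have "w powr (-8) \<le> w powr (-1)" using w by (intro powr_mono) auto
  also have "\<dots> = 1 / w" using w by (simp add: powr_minus_divide)
  finally have "4 * \<epsilon> \<le> 4 * (lam / (8 * (lam + b)) * (1 / w))"
    unfolding \<epsilon> using lam b by (intro mult_left_mono) auto
  also have "\<dots> = lam / 2 / ((lam + b) * w)" using lam b w by (simp add: divide_simps)
  also have "\<dots> \<le> lam / 2 / (lam + b * w)"
  proof (rule divide_left_mono)
    have "lam * 1 \<le> lam * w" using lam w by (intro mult_left_mono) auto
    then show "lam + b * w \<le> (lam + b) * w" by (simp add: algebra_simps)
  qed (use lam b w in \<open>auto intro!: mult_pos_pos add_pos_pos\<close>)
  finally have e4: "4 * \<epsilon> \<le> lam / 2 / (lam + b * w)" .
  have e0: "0 \<le> \<epsilon>" unfolding \<epsilon> using lam b by simp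
  have "(lam / 2 + b * w) / (lam + b * w) = 1 - lam / 2 / (lam + b * w)"
  proof -
    have "0 < lam + b * w" using lam b w by (intro add_pos_pos mult_pos_pos) auto
    moreover have "lam / 2 + b * w = (lam + b * w) - lam / 2" by simp
    ultimately show ?thesis by (simp only: diff_divide_distrib) simp
  qed
  also have "\<dots> \<le> 1 - 4 * \<epsilon>" using e4 by simp
  also have "\<dots> \<le> 1 + - (4 * \<epsilon>) * ln 2"
    using mult_left_mono[of "ln 2" 1 "4 * \<epsilon>"] e0 ln_2_less_1 by simp
  also have "\<dots> \<le> exp (- (4 * \<epsilon>) * ln 2)" by (rule exp_ge_add_one_self)
  also have "\<dots> = 2 powr - (4 * \<epsilon>)" by (simp add: powr_def)
  finally show ?thesis .
qed

theorem theorem1p6: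
  fixes lam Lam :: real
  assumes "0 < lam" and "0 < Lam"
  shows "\<exists>c1 c2. 0 < c1 \<and> 0 < c2 \<and>
    (\<forall>W :: real^2 \<Rightarrow> complex^'n^'n. matrix_A2_weight W \<longrightarrow>
      (\<exists>\<epsilon>. c1 * A2_const W powr (-8) \<le> \<epsilon> \<and> \<epsilon> \<le> c2 * A2_const W powr (-8) \<and>
        (\<forall>(\<Omega> :: (real^2) set) (A :: real^2 \<Rightarrow> 'n \<Rightarrow> 'n \<Rightarrow> 2 \<Rightarrow> 2 \<Rightarrow> complex)
            (u :: real^2 \<Rightarrow> complex^'n) (Du :: real^2 \<Rightarrow> complex^2^'n) (x0 :: real^2) (R :: real).
           open \<Omega> \<and> elliptic lam Lam W \<Omega> A \<and> in_H12 \<Omega> W u Du \<and> weak_solution \<Omega> A Du \<and>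
           0 < R \<and> ball x0 (6 * R) \<subseteq> \<Omega> \<longrightarrow>
           (\<exists>K. \<forall>x\<in>ball x0 R. \<forall>y\<in>ball x0 R.
              ennreal (norm (rep u x - rep u y))
                \<le> ennreal K * Cxy W \<Omega> \<epsilon> x y * ennreal ((dist x y / R) powr \<epsilon>)))))"
proof -
  \<comment> \<open>Apart from the absolute constant \<open>cutC\<close> only \<open>lam\<close> and
    \<open>Lam\<close> enter, so \<open>c\<close> serves as both \<open>c1\<close> and
    \<open>c2\<close>, and \<epsilon> is fixed before the domain, the coefficients and the
    solution.\<close>
  define c where "c = lam / (8 * (lam + hole_const lam Lam))"
  have b: "0 < hole_const lam Lam" using assms by (rule hole_const_pos)
  have c: "0 < c" using assms b by (simp add: c_def)
  have main: "\<exists>K. \<forall>x\<in>ball x0 R. \<forall>y\<in>ball x0 R.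
              ennreal (norm (rep u x - rep u y))
                \<le> ennreal K * Cxy W \<Omega> \<epsilon> x y * ennreal ((dist x y / R) powr \<epsilon>)"
    if W: "matrix_A2_weight W" and \<epsilon>: "\<epsilon> = c * A2_const W powr (-8)"
      and \<Omega>: "open \<Omega>" and ell: "elliptic lam Lam W \<Omega> A" and H: "in_H12 \<Omega> W u Du"
      and sol: "weak_solution \<Omega> A Du" and R: "0 < R" and B: "ball x0 (6 * R) \<subseteq> \<Omega>"
    for W :: "real^2 \<Rightarrow> complex^'n^'n" and \<epsilon> \<Omega> and A :: "real^2 \<Rightarrow> 'n \<Rightarrow> 'n \<Rightarrow> 2 \<Rightarrow> 2 \<Rightarrow> complex"
      and u Du x0 R
  proof -
    obtain V where V: "V \<in> borel_measurable borel" "\<And>x. pos_def (V x)" and ae: "AE x in lborel. W x = V x"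
      using weight_borel_version[OF W] by blast
    define w where "w = A2_const W"
    have AV: "A2_char V = ennreal w"
      using W A2_char_cong[OF ae] by (simp add: w_def A2_const_def matrix_A2_weight_def)
    have w1: "1 \<le> w" using A2_char_ge_1[OF V] unfolding AV by simp
    from H obtain \<phi> where \<phi>: "\<And>k. smooth_on \<Omega> (\<phi> k)" "\<And>k. wL2grad W \<Omega> (Dmat (\<phi> k)) < (top::ennreal)"
      "(\<lambda>k. wL2 W \<Omega> (\<lambda>x. u x - \<phi> k x)) \<longlonglongrightarrow> 0"
      "(\<lambda>k. wL2grad W \<Omega> (\<lambda>x. Du x - Dmat (\<phi> k) x)) \<longlonglongrightarrow> 0"
      and meas: "u \<in> borel_measurable (lebesgue_on \<Omega>)" "Du \<in> borel_measurable (lebesgue_on \<Omega>)"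
      unfolding in_H12_def by blast
    interpret A2_solution V lam Lam w \<Omega> A u Du \<phi>
    proof
      show "V \<in> borel_measurable borel" "\<And>x. pos_def (V x)" by (rule V)+
      show "elliptic lam Lam V \<Omega> A" by (rule elliptic_cong[OF ae ell])
    qed (use assms \<Omega> sol meas \<phi> AV w1 in \<open>simp_all add: wL2_cong[OF ae] wL2grad_cong[OF ae]\<close>)
    have \<epsilon>': "\<epsilon> = lam / (8 * (lam + hole_const lam Lam)) * w powr (-8)"
      by (simp add: \<epsilon> c_def w_def)
    have "0 < \<epsilon>" using c w1 by (simp add: \<epsilon> w_def[symmetric])
    then show ?thesis
      using holder[OF R B _ decay_rate[OF assms(1) b w1 \<epsilon>']] unfolding Cxy_cong[OF ae] by blast
  qed
  show ?thesis
    apply (rule exI[of _ c], rule exI[of _ c], intro conjI c allI impI)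
    subgoal for W
      by (rule exI[of _ "c * A2_const W powr (-8)"], intro conjI order_refl allI impI, elim conjE)
        (rule main[OF _ refl])
    done
qed

end
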